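(* There exists a family of positive finite constants $(C(d_1,d_2))_{d_1\ge 1,\,d_2\ge 0}$ such that for every $d\ge 2$ and every $z\in\mathbb{R}^d\setminus\{0\}$, \[ \mu_\epsilon(z)=\|z\|_1-C\big(d_1(z),d_2(z)\big)\,\gamma(z)\,\epsilon^{1/d_1(z)}+o\big(\epsilon^{1/d_1(z)}\big)\quad\text{as }\epsilon\to 0 . \]
   Context: Bernoulli site first-passage percolation on $\mathbb{Z}^d$, $d\ge 2$, $\epsilon\in[0,1]$: $(\tau_\epsilon(x))_{x\in\mathbb{Z}^d}$ are i.i.d. with $\mathbb{P}(\tau_\epsilon(x)=1)=1-\epsilon$ and $\mathbb{P}(\tau_\epsilon(x)=0)=\epsilon$; a site $x$ is open if $\tau_\epsilon(x)=0$. Two vertices are neighbours if their Euclidean distance is $1$; a path is a finite sequence $\pi=(x_0,\dots,x_n)$ of successive neighbours. Its travel time is $\tau_\epsilon(\pi)=\sum_{i=0}^{n-1}\tau_\epsilon(x_i)$ (the last vertex is not counted), and $T_\epsilon(x,y)=\inf_{\pi:x\to y}\tau_\epsilon(\pi)$. For $z\in\mathbb{R}^d$, $\lfloor z\rfloor$ is the coordinatewise integer part, and the time constant is $\mu_\epsilon(z)=\lim_{n\to\infty}\frac1n\mathbb{E}[T_\epsilon(0,\lfloor nz\rfloor)]$ (this limit exists). For $z=(z_1,\dots,z_d)$: $d_1(z)=\#\{i:z_i\neq 0\}$, $d_2(z)=d-d_1(z)$, and $\gamma(z)=\prod_{i:z_i\neq0}|z_i|^{1/d_1(z)}$ (geometric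 mean of the absolute values of the nonzero coordinates). $\|\cdot\|_1$ is the $\ell^1$ norm. *)

theory Defs
  imports "HOL-Probability.Probability" "HOL-Library.Landau_Symbols"
begin

definition Zd :: "nat \<Rightarrow> (nat \<Rightarrow> int) set" where
  "Zd d = {x. \<forall>i\<ge>d. x i = 0}"

definition Rd :: "nat \<Rightarrow> (nat \<Rightarrow> real) set" where
  "Rd d = {z. \<forall>i\<ge>d. z i = 0}"

text \<open>Neighbours: Euclidean distance 1 (equivalently l1 distance 1 on integer points).\<close>
definition nbr :: "nat \<Rightarrow> (nat \<Rightarrow> int) \<Rightarrow> (nat \<Rightarrow> int) \<Rightarrow> bool" where
  "nbr d x y \<longleftrightarrow> x \<in> Zd d \<and> y \<in> Zd d \<and> (\<Sum>i<d. (x i - y i)^2) = 1"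

definition is_path :: "nat \<Rightarrow> (nat \<Rightarrow> int) list \<Rightarrow> bool" where
  "is_path d p \<longleftrightarrow> p \<noteq> [] \<and> set p \<subseteq> Zd d \<and>
     (\<forall>i. Suc i < length p \<longrightarrow> nbr d (p ! i) (p ! Suc i))"

definition paths :: "nat \<Rightarrow> (nat \<Rightarrow> int) \<Rightarrow> (nat \<Rightarrow> int) \<Rightarrow> (nat \<Rightarrow> int) list set" where
  "paths d x y = {p. is_path d p \<and> hd p = x \<and> last p = y}"

definition tau :: "((nat \<Rightarrow> int) \<Rightarrow> bool) \<Rightarrow> (nat \<Rightarrow> int) \<Rightarrow> real" where
  "tau \<omega> x = (if \<omega> x then 0 else 1)"

definition travel_time :: "((nat \<Rightarrow> int) \<Rightarrow> bool) \<Rightarrow> (nat \<Rightarrow> int) list \<Rightarrow> real" where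
  "travel_time \<omega> p = sum_list (map (tau \<omega>) (butlast p))"

definition passage_time ::
  "nat \<Rightarrow> ((nat \<Rightarrow> int) \<Rightarrow> bool) \<Rightarrow> (nat \<Rightarrow> int) \<Rightarrow> (nat \<Rightarrow> int) \<Rightarrow> real" where
  "passage_time d \<omega> x y = (INF p\<in>paths d x y. travel_time \<omega> p)"

definition env :: "nat \<Rightarrow> real \<Rightarrow> ((nat \<Rightarrow> int) \<Rightarrow> bool) measure" where
  "env d \<epsilon> = PiM (Zd d) (\<lambda>_. measure_pmf (bernoulli_pmf \<epsilon>))"

definition floor_vec :: "(nat \<Rightarrow> real) \<Rightarrow> (nat \<Rightarrow> int)" where
  "floor_vec z = (\<lambda>i. \<lfloor>z i\<rfloor>)"

definition time_const :: "nat \<Rightarrow> real \<Rightarrow> (nat \<Rightarrow> real) \<Rightarrow> real" where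
  "time_const d \<epsilon> z = lim (\<lambda>n::nat.
     (\<integral>\<omega>. passage_time d \<omega> (\<lambda>_. 0) (floor_vec (\<lambda>i. real n * z i)) \<partial>env d \<epsilon>) / real n)"

definition dd1 :: "nat \<Rightarrow> (nat \<Rightarrow> real) \<Rightarrow> nat" where
  "dd1 d z = card {i. i < d \<and> z i \<noteq> 0}"

definition dd2 :: "nat \<Rightarrow> (nat \<Rightarrow> real) \<Rightarrow> nat" where
  "dd2 d z = d - dd1 d z"

definition gam :: "nat \<Rightarrow> (nat \<Rightarrow> real) \<Rightarrow> real" where
  "gam d z = (\<Prod>i\<in>{i. i < d \<and> z i \<noteq> 0}. \<bar>z i\<bar> powr (1 / real (dd1 d z)))"

definition norm1 :: "nat \<Rightarrow> (nat \<Rightarrow> real) \<Rightarrow> real" where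
  "norm1 d z = (\<Sum>i<d. \<bar>z i\<bar>)"

end

theory Submission
  imports Defs
begin

text \<open>
  Call the l1 norm of the target minus the passage time the gain.
  By symmetry the nonzero coordinates of \<open>z\<close> are the first \<open>d1\<close> ones and positive.
  Divide these coordinates by integers \<open>K i\<close> and call a block of sites open if it contains an open site.
  A fine path projects to a coarse path whose excess length (its length minus the l1 distance of its end points)
  is no larger, so the fine gain is at most the coarse gain plus the number of open sites beyond the first
  one in each visited block. Blocks with two open sites have density of order \<open>\<epsilon>\<^sup>2\<close>, where \<open>\<epsilon>\<close> is the density of
  open blocks, and an exponential moment bound over chains of sites shows that a path collects at most of order
  \<open>q\<^bsup>1/d1\<^esup>\<close> sites of density \<open>q\<close> per unit length. Hence the gain rate divided by \<open>\<gamma>(z) \<epsilon>'\<^bsup>1/d1\<^esup>\<close> at density \<open>\<epsilon>'\<close> in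
  direction \<open>z\<close> is, as \<open>\<epsilon>' \<rightarrow> 0\<close>, asymptotically at most the one at any fixed small density \<open>\<epsilon>\<close> in any other
  direction \<open>z'\<close>. This gives existence of the limit and its independence of \<open>z\<close> at once. It is positive
  because a diagonal box of side \<open>\<epsilon>\<^bsup>-1/d1\<^esup>\<close> contains an open site with probability bounded below.
\<close>

text \<open>The limit is not obtained from a continuum Poisson model: two lattice models are
  compared, at densities \<open>\<epsilon>'\<close> and \<open>\<epsilon>\<close> and in directions
  \<open>z\<close> and \<open>z'\<close>. One inequality suffices: for \<open>z' = z\<close> it
  bounds the limit superior by the limit inferior, and exchanging \<open>z\<close> and
  \<open>z'\<close> identifies the limits. The obstacle is that errors must be small against
  \<epsilon> to the power 1/k, with k nonzero coordinates, although a path may make detours to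
  collect surplus open sites. Those sites, of density about \<epsilon>^2, are charged to a fraction
  \<delta> of the excess length of the path; a cruder bound over all open sites shows that the
  excess is itself of order \<epsilon> to the power 1/k. The resulting error has the order of the
  main term, but the factor \<delta> makes it small. The geometric mean comes from volume: the two
  directions force the side ratios of the blocks, and prescribing the volume \<epsilon>/\<epsilon>'
  fixes their scale through a k-th root. Coordinates in which \<open>z\<close> vanishes are not
  rescaled, as a sideways step costs a full unit at every density; hence the coarse model has the
  same d2.\<close>

section \<open>Lattice paths and passage times\<close>

definition dist1 :: "nat \<Rightarrow> (nat \<Rightarrow> int) \<Rightarrow> (nat \<Rightarrow> int) \<Rightarrow> int" where
  "dist1 d x y = (\<Sum>i<d. \<bar>y i - x i\<bar>)"

text \<open>Nonzero integers have square at least 1, so a sum of squares equal to 1 leaves room for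
  a single differing coordinate.\<close>

lemma nbr_iff: "nbr d x y \<longleftrightarrow> x \<in> Zd d \<and> (\<exists>j<d. \<exists>s\<in>{1,-1}. y = x(j := x j + s))"
proof
  assume "nbr d x y"
  then have xy: "x \<in> Zd d" "y \<in> Zd d" and s: "(\<Sum>i<d. (x i - y i)^2) = 1" by (auto simp: nbr_def)
  have "\<exists>j<d. x j \<noteq> y j"
  proof (rule ccontr)
    assume "\<not> ?thesis"
    then have "(\<Sum>i<d. (x i - y i)^2) = 0" by (intro sum.neutral) auto
    with s show False by simp
  qed
  then obtain j where j: "j < d" "x j \<noteq> y j" by blast
  have split: "(\<Sum>i<d. (x i - y i)^2) = (x j - y j)^2 + (\<Sum>i\<in>{..<d}-{j}. (x i - y i)^2)"
    using j by (subst sum.remove[of _ j]) auto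
  have ge1: "(x j - y j)^2 \<ge> 1" using j by (simp add: int_one_le_iff_zero_less)
  have ge0: "(\<Sum>i\<in>{..<d}-{j}. (x i - y i)^2) \<ge> 0" by (intro sum_nonneg) auto
  have a: "(x j - y j)^2 = 1" and b: "(\<Sum>i\<in>{..<d}-{j}. (x i - y i)^2) = 0"
    using s split ge1 ge0 by linarith+
  have "\<forall>i\<in>{..<d}-{j}. (x i - y i)^2 = 0"
    using b by (subst (asm) sum_nonneg_eq_0_iff) auto
  then have eq: "y i = x i" if "i \<noteq> j" for i
    using that xy by (cases "i < d") (auto simp: Zd_def)
  have "x j - y j = 1 \<or> x j - y j = -1" using a by (simp add: power2_eq_1_iff)
  then have "y j = x j + (-1) \<or> y j = x j + 1" by linarith
  then have "y = x(j := x j + 1) \<or> y = x(j := x j + (-1))"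
    using eq by (auto simp: fun_eq_iff)
  with xy(1) j(1) show "x \<in> Zd d \<and> (\<exists>j<d. \<exists>s\<in>{1,-1}. y = x(j := x j + s))" by blast
next
  assume "x \<in> Zd d \<and> (\<exists>j<d. \<exists>s\<in>{1,-1}. y = x(j := x j + s))"
  then obtain j s where x: "x \<in> Zd d" "j < d" "s \<in> {1,-1}" "y = x(j := x j + s)" by blast
  have "(\<Sum>i<d. (x i - y i)^2) = (\<Sum>i<d. if i = j then 1 else 0)"
    using x by (intro sum.cong) auto
  also have "\<dots> = 1" using x by simp
  finally show "nbr d x y" using x by (auto simp: nbr_def Zd_def)
qed

lemma paths_iff: "p \<in> paths d x y \<longleftrightarrow>
    p \<noteq> [] \<and> set p \<subseteq> Zd d \<and> successively (nbr d) p \<and> hd p = x \<and> last p = y"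
  by (auto simp: paths_def is_path_def successively_conv_nth)

text \<open>A natural number, so that well-ordering turns the infimum over paths into a
  minimum.\<close>

definition closed_count :: "((nat \<Rightarrow> int) \<Rightarrow> bool) \<Rightarrow> (nat \<Rightarrow> int) list \<Rightarrow> nat" where
  "closed_count \<omega> p = length (filter (\<lambda>x. \<not> \<omega> x) (butlast p))"

lemma travel_time_eq: "travel_time \<omega> p = real (closed_count \<omega> p)"
proof -
  have "sum_list (map (tau \<omega>) q) = real (length (filter (\<lambda>x. \<not> \<omega> x) q))" for q
    by (induction q) (auto simp: tau_def)
  then show ?thesis by (simp add: travel_time_def closed_count_def)
qed

lemma travel_time_nonneg: "travel_time \<omega> p \<ge> 0"
  by (simp add: travel_time_eq)

lemma bdd_below_travel_time: "bdd_below (travel_time \<omega> ` A)"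
  by (rule bdd_belowI[of _ 0]) (auto simp: travel_time_nonneg)

lemma passage_time_le: "p \<in> paths d x y \<Longrightarrow> passage_time d \<omega> x y \<le> travel_time \<omega> p"
  unfolding passage_time_def by (intro cINF_lower bdd_below_travel_time)

lemma paths_single: "x \<in> Zd d \<Longrightarrow> [x] \<in> paths d x x"
  by (auto simp: paths_iff)

lemma paths_step: "nbr d x y \<Longrightarrow> p \<in> paths d y z \<Longrightarrow> x # p \<in> paths d x z"
  by (cases p) (auto simp: paths_iff nbr_def)

lemma travel_time_Cons: "p \<noteq> [] \<Longrightarrow> travel_time \<omega> (x # p) = tau \<omega> x + travel_time \<omega> p"
  by (simp add: travel_time_def)

lemma dist1_nonneg: "dist1 d x y \<ge> 0"
  by (auto simp: dist1_def intro: sum_nonneg)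

lemma dist1_triangle: "dist1 d x z \<le> dist1 d x y + dist1 d y z"
  unfolding dist1_def sum.distrib[symmetric] by (intro sum_mono) auto

lemma dist1_eq_0_iff:
  assumes "x \<in> Zd d" "y \<in> Zd d"
  shows "dist1 d x y = 0 \<longleftrightarrow> x = y"
proof
  assume "dist1 d x y = 0"
  then have "\<forall>i\<in>{..<d}. \<bar>y i - x i\<bar> = 0" unfolding dist1_def by (subst (asm) sum_nonneg_eq_0_iff) auto
  then have "x i = y i" for i using assms by (cases "i < d") (auto simp: Zd_def)
  then show "x = y" by auto
qed (simp add: dist1_def)

lemma dist1_step:
  assumes "x \<in> Zd d" "y \<in> Zd d" "x \<noteq> y"
  obtains x' where "nbr d x x'" "dist1 d x y = dist1 d x' y + 1"
proof -
  obtain j where j: "j < d" "x j \<noteq> y j"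
  proof -
    obtain j where "x j \<noteq> y j" using assms(3) by (auto simp: fun_eq_iff)
    moreover from this have "j < d" using assms by (auto simp: Zd_def not_le[symmetric])
    ultimately show ?thesis using that by blast
  qed
  define s :: int where "s = (if x j < y j then 1 else -1)"
  define x' where "x' = x(j := x j + s)"
  have "nbr d x x'" unfolding nbr_iff x'_def using assms j by (auto simp: s_def)
  moreover have "dist1 d x y = dist1 d x' y + 1"
  proof -
    have "dist1 d x y = \<bar>y j - x j\<bar> + (\<Sum>i\<in>{..<d}-{j}. \<bar>y i - x i\<bar>)"
      unfolding dist1_def using j by (subst sum.remove[of _ j]) auto
    moreover have "dist1 d x' y = \<bar>y j - x' j\<bar> + (\<Sum>i\<in>{..<d}-{j}. \<bar>y i - x' i\<bar>)"
      unfolding dist1_def using j by (subst sum.remove[of _ j]) auto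
    moreover have "(\<Sum>i\<in>{..<d}-{j}. \<bar>y i - x' i\<bar>) = (\<Sum>i\<in>{..<d}-{j}. \<bar>y i - x i\<bar>)"
      by (intro sum.cong) (auto simp: x'_def)
    moreover have "\<bar>y j - x j\<bar> = \<bar>y j - x' j\<bar> + 1" using j by (auto simp: x'_def s_def)
    ultimately show ?thesis by linarith
  qed
  ultimately show ?thesis using that by blast
qed

lemma geodesic_exists:
  assumes "x \<in> Zd d" "y \<in> Zd d"
  shows "\<exists>p\<in>paths d x y. travel_time \<omega> p \<le> of_int (dist1 d x y)"
  using assms(1)
proof (induction "nat (dist1 d x y)" arbitrary: x)
  case 0
  then have "x = y" using dist1_eq_0_iff[of x d y] assms dist1_nonneg[of d x y] by auto
  then show ?case using paths_single[OF assms(2)]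
    by (intro bexI[of _ "[x]"]) (auto simp: travel_time_def dist1_def)
next
  case (Suc n)
  then have "x \<noteq> y" by (auto simp: dist1_def)
  then obtain x' where x': "nbr d x x'" "dist1 d x y = dist1 d x' y + 1"
    using dist1_step Suc.prems assms(2) by metis
  then have "n = nat (dist1 d x' y)" using Suc.hyps(2) by linarith
  moreover have "x' \<in> Zd d" using x' by (simp add: nbr_def)
  ultimately obtain p where p: "p \<in> paths d x' y" "travel_time \<omega> p \<le> of_int (dist1 d x' y)"
    using Suc.hyps(1) by blast
  have "travel_time \<omega> (x # p) \<le> of_int (dist1 d x y)"
    using p x'(2) by (subst travel_time_Cons) (auto simp: paths_iff tau_def)
  then show ?case using paths_step[OF x'(1) p(1)] by blast
qed

lemma paths_nonempty: "x \<in> Zd d \<Longrightarrow> y \<in> Zd d \<Longrightarrow> paths d x y \<noteq> {}"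
  using geodesic_exists by blast

lemma passage_time_le_dist1:
  assumes "x \<in> Zd d" "y \<in> Zd d"
  shows "passage_time d \<omega> x y \<le> of_int (dist1 d x y)"
  using geodesic_exists[OF assms] passage_time_le by (meson order_trans)

lemma passage_time_attained:
  assumes "x \<in> Zd d" "y \<in> Zd d"
  obtains p where "p \<in> paths d x y" "passage_time d \<omega> x y = travel_time \<omega> p"
proof -
  obtain p where p: "p \<in> paths d x y" "\<And>q. q \<in> paths d x y \<Longrightarrow> closed_count \<omega> p \<le> closed_count \<omega> q"
    using paths_nonempty[OF assms] ex_has_least_nat[of "\<lambda>p. p \<in> paths d x y" _ "closed_count \<omega>"] by blast
  have "passage_time d \<omega> x y = travel_time \<omega> p"
    unfolding passage_time_def using p by (intro cInf_eq_minimum) (auto simp: travel_time_eq)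
  with p that show ?thesis by blast
qed

lemma passage_time_nonneg:
  assumes "x \<in> Zd d" "y \<in> Zd d"
  shows "0 \<le> passage_time d \<omega> x y"
  using passage_time_attained[OF assms] travel_time_nonneg by metis

lemma paths_append:
  assumes "p \<in> paths d x y" "q \<in> paths d y z"
  shows "butlast p @ q \<in> paths d x z"
proof (cases "butlast p = []")
  case True
  then have "p = [y]" using assms by (metis append_butlast_last_id append_Nil paths_iff)
  then show ?thesis using assms by (auto simp: paths_iff)
next
  case False
  have p: "p = butlast p @ [y]" using assms by (metis append_butlast_last_id paths_iff)
  have "successively (nbr d) (butlast p @ [y])" using assms p by (metis paths_iff)
  then have s: "successively (nbr d) (butlast p)" "nbr d (last (butlast p)) y"
    using False by (auto simp: successively_append_iff)
  have "hd (butlast p) = x" using p False assms by (metis hd_append2 paths_iff)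
  then show ?thesis using assms s False
    by (auto simp: paths_iff successively_append_iff dest: in_set_butlastD)
qed

text \<open>The last vertex of a path is free, so the junction \<open>y\<close> is paid for once and
  travel times add up exactly under concatenation.\<close>

lemma passage_time_triangle:
  assumes "x \<in> Zd d" "y \<in> Zd d" "z \<in> Zd d"
  shows "passage_time d \<omega> x z \<le> passage_time d \<omega> x y + passage_time d \<omega> y z"
proof -
  obtain p where p: "p \<in> paths d x y" "passage_time d \<omega> x y = travel_time \<omega> p"
    using passage_time_attained assms by metis
  obtain q where q: "q \<in> paths d y z" "passage_time d \<omega> y z = travel_time \<omega> q"
    using passage_time_attained assms by metis
  have "travel_time \<omega> (butlast p @ q) = travel_time \<omega> p + travel_time \<omega> q"
    using q by (simp add: travel_time_def butlast_append paths_iff)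
  then show ?thesis using passage_time_le[OF paths_append[OF p(1) q(1)], of \<omega>] p q by linarith
qed

text \<open>A geodesic out of an open site gets its first vertex for free. The end points must
  differ, since otherwise this vertex is the uncounted last one and nothing is saved.\<close>

lemma passage_time_open_start:
  assumes "x \<in> Zd d" "y \<in> Zd d" "x \<noteq> y" "\<omega> x"
  shows "passage_time d \<omega> x y \<le> of_int (dist1 d x y) - 1"
proof -
  obtain x' where x': "nbr d x x'" "dist1 d x y = dist1 d x' y + 1"
    using dist1_step assms by metis
  have x'Z: "x' \<in> Zd d" using x' by (simp add: nbr_def)
  then obtain p where p: "p \<in> paths d x' y" "travel_time \<omega> p \<le> of_int (dist1 d x' y)"
    using geodesic_exists assms by blast
  have "travel_time \<omega> (x # p) = travel_time \<omega> p"
    using p assms by (subst travel_time_Cons) (auto simp: paths_iff tau_def)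
  then show ?thesis using passage_time_le[OF paths_step[OF x'(1) p(1)], of \<omega>] p x' by simp
qed

text \<open>A shortest one among the optimal paths has no loop, because cutting a loop never
  increases the travel time. Simplicity allows the open sites on a path to be counted as a
  set.\<close>

lemma simple_path_attained:
  assumes "x \<in> Zd d" "y \<in> Zd d"
  obtains p where "p \<in> paths d x y" "passage_time d \<omega> x y = travel_time \<omega> p" "distinct p"
proof -
  let ?Q = "\<lambda>p. p \<in> paths d x y \<and> passage_time d \<omega> x y = travel_time \<omega> p"
  obtain p0 where "p0 \<in> paths d x y" "passage_time d \<omega> x y = travel_time \<omega> p0"
    by (rule passage_time_attained[OF assms])
  then have "?Q p0" by blast
  then obtain p where p: "?Q p" and least: "\<And>q. ?Q q \<Longrightarrow> length p \<le> length q"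
    using ex_has_least_nat[of ?Q p0 length] by blast
  have "distinct p"
  proof (rule ccontr)
    assume "\<not> distinct p"
    then obtain xs v ys zs where eq: "p = xs @ [v] @ ys @ [v] @ zs"
      using not_distinct_decomp by blast
    let ?q = "xs @ [v] @ zs"
    have "?q \<in> paths d x y"
    proof -
      have q: "successively (nbr d) (xs @ [v] @ ys @ [v] @ zs)" using p eq by (simp add: paths_iff)
      then have "successively (nbr d) (xs @ [v])" "successively (nbr d) ([v] @ zs)"
        by (metis append_assoc successively_append_iff)+
      then have "successively (nbr d) ?q"
        by (cases zs) (auto simp: successively_append_iff)
      moreover have "hd ?q = hd p" "last ?q = last p" "set ?q \<subseteq> set p"
        unfolding eq by (cases xs; simp) auto
      ultimately show ?thesis using p by (auto simp: paths_iff)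
    qed
    moreover have "travel_time \<omega> ?q \<le> travel_time \<omega> p"
      unfolding eq travel_time_eq closed_count_def by (cases zs) (auto simp: butlast_append)
    ultimately have "?Q ?q" using p passage_time_le[of ?q d x y \<omega>] by auto
    from least[OF this] show False by (simp add: eq)
  qed
  then show ?thesis using p that by blast
qed

text \<open>Points of the product space are \<open>undefined\<close> off \<open>Zd d\<close>; this
  lemma exchanges them for environments given by a formula on all index functions.\<close>

lemma passage_time_cong:
  assumes "\<And>x. x \<in> Zd d \<Longrightarrow> \<omega> x = \<omega>' x"
  shows "passage_time d \<omega> x y = passage_time d \<omega>' x y"
proof -
  have "travel_time \<omega> p = travel_time \<omega>' p" if "p \<in> paths d x y" for p
  proof -
    have "map (tau \<omega>) (butlast p) = map (tau \<omega>') (butlast p)"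
      using assms that by (auto simp: paths_iff tau_def dest!: in_set_butlastD)
    then show ?thesis unfolding travel_time_def by (rule arg_cong)
  qed
  then show ?thesis unfolding passage_time_def by (intro INF_cong) auto
qed

lemma passage_time_automorphism:
  assumes bij: "bij_betw \<psi> (Zd d) (Zd d)"
    and nb: "\<And>x y. x \<in> Zd d \<Longrightarrow> y \<in> Zd d \<Longrightarrow> nbr d (\<psi> x) (\<psi> y) \<longleftrightarrow> nbr d x y"
    and xy: "x \<in> Zd d" "y \<in> Zd d"
  shows "passage_time d \<omega> (\<psi> x) (\<psi> y) = passage_time d (\<lambda>v. \<omega> (\<psi> v)) x y"
proof -
  have inj: "inj_on \<psi> (Zd d)" and im: "\<psi> ` Zd d = Zd d" using bij by (auto simp: bij_betw_def)
  have suc: "successively (nbr d) (map \<psi> p) \<longleftrightarrow> successively (nbr d) p" if "set p \<subseteq> Zd d" for p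
    using that nb by (auto simp: successively_conv_nth subset_iff)
  have "paths d (\<psi> x) (\<psi> y) = map \<psi> ` paths d x y"
  proof (intro equalityI subsetI)
    fix p assume p: "p \<in> paths d (\<psi> x) (\<psi> y)"
    then have "set p \<subseteq> \<psi> ` Zd d" using im by (auto simp: paths_iff)
    then obtain q where q: "p = map \<psi> q" "set q \<subseteq> Zd d"
    proof -
      have "p \<in> lists (\<psi> ` Zd d)" using \<open>set p \<subseteq> \<psi> ` Zd d\<close> by auto
      then have "p \<in> map \<psi> ` lists (Zd d)" by (simp only: lists_image)
      then show ?thesis using that by auto
    qed
    have "q \<noteq> []" using p q by (auto simp: paths_iff)
    moreover have "\<psi> (hd q) = \<psi> x" "\<psi> (last q) = \<psi> y"
      using p q \<open>q \<noteq> []\<close> by (auto simp: paths_iff hd_map last_map)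
    moreover have "hd q \<in> Zd d" "last q \<in> Zd d" using q \<open>q \<noteq> []\<close> by auto
    ultimately have "hd q = x" "last q = y" using inj xy by (auto dest: inj_onD)
    then show "p \<in> map \<psi> ` paths d x y"
      using p q suc[OF q(2)] \<open>q \<noteq> []\<close> by (auto simp: paths_iff)
  next
    fix p assume "p \<in> map \<psi> ` paths d x y"
    then obtain q where q: "p = map \<psi> q" "q \<in> paths d x y" by blast
    then have "\<psi> ` set q \<subseteq> \<psi> ` Zd d" by (auto simp: paths_iff)
    then show "p \<in> paths d (\<psi> x) (\<psi> y)"
      using suc im q by (auto simp: paths_iff hd_map last_map)
  qed
  moreover have "travel_time \<omega> (map \<psi> p) = travel_time (\<lambda>v. \<omega> (\<psi> v)) p" for p
    by (simp add: travel_time_def tau_def[abs_def] map_butlast[symmetric] comp_def)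
  ultimately show ?thesis unfolding passage_time_def by (simp add: image_comp comp_def)
qed

section \<open>Coarse graining of paths\<close>

text \<open>The progress of a site in the first \<open>k\<close> directions. The excess length of a
  path is its number of steps minus the progress that it makes.\<close>

definition fwd :: "nat \<Rightarrow> (nat \<Rightarrow> int) \<Rightarrow> int" where
  "fwd k x = (\<Sum>i<k. x i)"

text \<open>Since \<open>div\<close> rounds downwards, the blocks tile the lattice evenly across
  negative coordinates too.\<close>

definition coarse :: "(nat \<Rightarrow> nat) \<Rightarrow> (nat \<Rightarrow> int) \<Rightarrow> (nat \<Rightarrow> int)" where
  "coarse K x = (\<lambda>i. x i div int (K i))"

lemma coarse_Zd: "x \<in> Zd d \<Longrightarrow> coarse K x \<in> Zd d"
  by (auto simp: Zd_def coarse_def)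

lemma zero_Zd [simp]: "(\<lambda>_. 0) \<in> Zd d"
  by (simp add: Zd_def)

lemma coarse_zero [simp]: "coarse K (\<lambda>_. 0) = (\<lambda>_. 0)"
  by (simp add: coarse_def)

lemma fwd_zero [simp]: "fwd k (\<lambda>_. 0) = 0"
  by (simp add: fwd_def)

lemma fwd_upd: "fwd k (x(j := v)) = fwd k x + (if j < k then v - x j else 0)"
proof (cases "j < k")
  case True
  then have "fwd k x = x j + (\<Sum>i\<in>{..<k}-{j}. x i)"
    "fwd k (x(j := v)) = v + (\<Sum>i\<in>{..<k}-{j}. (x(j := v)) i)"
    unfolding fwd_def by (subst sum.remove[of _ j]; simp)+
  moreover have "(\<Sum>i\<in>{..<k}-{j}. (x(j := v)) i) = (\<Sum>i\<in>{..<k}-{j}. x i)"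
    by (intro sum.cong) auto
  ultimately show ?thesis using True by simp
next
  case False
  then show ?thesis unfolding fwd_def by (auto intro!: sum.cong)
qed

lemma succ_div_cases:
  fixes a K :: int
  assumes "K \<ge> 1"
  shows "(a + 1) div K = a div K \<or> (a + 1) div K = a div K + 1"
proof -
  have "a div K \<le> (a + 1) div K" using assms by (intro zdiv_mono1) auto
  moreover have "(a + 1) div K \<le> (a + K) div K" using assms by (intro zdiv_mono1) auto
  moreover have "(a + K) div K = a div K + 1" using assms by simp
  ultimately show ?thesis by linarith
qed

text \<open>The excess of one step, 1 minus its progress, is 0 forwards, 1 sideways and 2 backwards.
  A step that leaves its block keeps its direction, hence its excess; a step inside a block
  contributes no excess to the coarse path. Sideways steps always leave the block, whose side is 1
  there.\<close>

lemma coarse_step: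
  assumes K: "\<And>i. K i \<ge> 1" "\<And>i. i \<ge> k \<Longrightarrow> K i = 1" and nb: "nbr d x y"
  defines "x' \<equiv> coarse K x" and "y' \<equiv> coarse K y"
  shows "x' = y' \<or> nbr d x' y'"
    and "(if x' = y' then 0 else 1) - (fwd k y' - fwd k x') \<le> 1 - (fwd k y - fwd k x)"
proof -
  obtain j s where x: "x \<in> Zd d" "j < d" "s \<in> {1,-1}" and y: "y = x(j := x j + s)"
    using nb unfolding nbr_iff by blast
  define e where "e = (x j + s) div int (K j) - x j div int (K j)"
  have y': "y' = x'(j := x' j + e)"
    by (auto simp: y'_def x'_def y coarse_def e_def)
  have K1: "int (K j) \<ge> 1" using K(1)[of j] by linarith
  have e: "e = 0 \<or> e = s"
    using x(3) succ_div_cases[OF K1, of "x j"] succ_div_cases[OF K1, of "x j - 1"]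
    by (auto simp: e_def)
  have e2: "e = s" if "j \<ge> k" using K(2)[OF that] by (simp add: e_def)
  have x'Z: "x' \<in> Zd d" using x by (simp add: x'_def coarse_Zd)
  show "x' = y' \<or> nbr d x' y'"
    using e x'Z x unfolding nbr_iff y' by auto
  have "x' = y' \<longleftrightarrow> e = 0" by (auto simp: y' fun_eq_iff)
  then show "(if x' = y' then 0 else 1) - (fwd k y' - fwd k x') \<le> 1 - (fwd k y - fwd k x)"
    using e e2 x(3) by (auto simp: y y' fwd_upd)
qed

text \<open>\<open>coarse_step\<close> summed along the path; \<open>remdups_adj\<close> merges
  consecutive sites of the same block, and the progress terms telescope.\<close>

lemma coarse_path:
  assumes K: "\<And>i. K i \<ge> 1" "\<And>i. i \<ge> k \<Longrightarrow> K i = 1"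
    and p: "successively (nbr d) p" "p \<noteq> []"
  defines "q \<equiv> remdups_adj (map (coarse K) p)"
  shows "successively (nbr d) q \<and>
    int (length q) - (fwd k (coarse K (last p)) - fwd k (coarse K (hd p)))
      \<le> int (length p) - (fwd k (last p) - fwd k (hd p))"
  using p unfolding q_def
proof (induction p rule: induct_list012)
  case (3 x y zs)
  have nb: "nbr d x y" using 3 by simp
  note st = coarse_step[where K=K and k=k, OF K nb]
  have IH: "successively (nbr d) (remdups_adj (map (coarse K) (y # zs)))"
    "int (length (remdups_adj (map (coarse K) (y # zs))))
      - (fwd k (coarse K (last (y # zs))) - fwd k (coarse K y))
      \<le> int (length (y # zs)) - (fwd k (last (y # zs)) - fwd k y)"
    using 3(2) 3(3) by (simp_all only: list.sel) auto
  show ?case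
  proof (cases "coarse K x = coarse K y")
    case True
    then have "remdups_adj (map (coarse K) (x # y # zs)) = remdups_adj (map (coarse K) (y # zs))"
      by simp
    then show ?thesis using IH st(2) True by (simp del: remdups_adj.simps)
  next
    case False
    then have eq: "remdups_adj (map (coarse K) (x # y # zs)) = coarse K x # remdups_adj (map (coarse K) (y # zs))"
      by simp
    have "hd (remdups_adj (map (coarse K) (y # zs))) = coarse K y"
      by (simp add: hd_remdups_adj del: remdups_adj.simps)
    then have "successively (nbr d) (coarse K x # remdups_adj (map (coarse K) (y # zs)))"
      using IH(1) st(1) False by (auto simp: successively_Cons simp del: remdups_adj.simps)
    then show ?thesis unfolding eq using IH(2) st(2) False by (simp del: remdups_adj.simps)
  qed
qed auto

text \<open>For an optimal simple path the gain is the number of its counted open sites minus its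
  excess length, and coarse graining does not increase the excess. Both bounds are for the same
  \<open>q\<close>: the first compares with the coarse gain at the price of the surplus open sites,
  and the second controls the excess length of \<open>q\<close>, since the fine gain is nonnegative.
  \<open>\<omega>'\<close> may have more open blocks than \<open>\<omega>\<close> forces, which
  leaves room to adjust its density.\<close>

lemma coarse_grained_path:
  fixes \<omega> \<omega>' :: "(nat \<Rightarrow> int) \<Rightarrow> bool"
  assumes K: "\<And>i. K i \<ge> 1" "\<And>i. i \<ge> k \<Longrightarrow> K i = 1"
    and a: "a \<in> Zd d"
    and open_imp: "\<And>x. x \<in> Zd d \<Longrightarrow> \<omega> x \<Longrightarrow> \<omega>' (coarse K x)"
    and fin: "\<And>y. finite {x \<in> Zd d. coarse K x = y}"
  defines "W \<equiv> \<lambda>y. card {x \<in> Zd d. coarse K x = y \<and> \<omega> x}"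
    and "b \<equiv> coarse K a"
  obtains q where "q \<in> paths d (\<lambda>_. 0) b"
    and "fwd k a - passage_time d \<omega> (\<lambda>_. 0) a
      \<le> fwd k b - passage_time d \<omega>' (\<lambda>_. 0) b + 1 + (\<Sum>y\<in>set q. real (W y - 1))"
    and "fwd k a - passage_time d \<omega> (\<lambda>_. 0) a
      \<le> (\<Sum>y\<in>set q. real (W y)) - (real (length q) - 1 - fwd k b)"
proof -
  obtain p where p: "p \<in> paths d (\<lambda>_. 0) a" "passage_time d \<omega> (\<lambda>_. 0) a = travel_time \<omega> p" "distinct p"
    using simple_path_attained[OF zero_Zd a] by blast
  have pne: "p \<noteq> []" and ps: "successively (nbr d) p" and hdp: "hd p = (\<lambda>_. 0)" and lp: "last p = a"
    and pZ: "set p \<subseteq> Zd d"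
    using p by (auto simp: paths_iff)
  define q where "q = remdups_adj (map (coarse K) p)"
  note cp = coarse_path[where K=K and k=k, OF K ps pne, folded q_def]
  have qne: "q \<noteq> []" using pne by (simp add: q_def)
  have setq: "set q = coarse K ` set p" by (simp add: q_def)
  have qZ: "set q \<subseteq> Zd d" using pZ coarse_Zd by (auto simp: setq)
  have q: "q \<in> paths d (\<lambda>_. 0) b"
    unfolding paths_iff using qne qZ cp pne hdp lp
    by (simp add: q_def hd_remdups_adj last_remdups_adj hd_map last_map b_def)
  have len: "int (length q) - fwd k b \<le> int (length p) - fwd k a"
    using cp by (simp add: hdp lp b_def)
  have Tp: "travel_time \<omega> p = real (length p) - 1 - real (length (filter \<omega> (butlast p)))"
    using sum_length_filter_compl[of \<omega> "butlast p"] pne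
    by (simp add: travel_time_eq closed_count_def of_nat_diff length_greater_0_conv[symmetric] Suc_leI
         del: length_greater_0_conv)
  have Tq: "travel_time \<omega>' q = real (length q) - 1 - real (length (filter \<omega>' (butlast q)))"
    using sum_length_filter_compl[of \<omega>' "butlast q"] qne
    by (simp add: travel_time_eq closed_count_def of_nat_diff length_greater_0_conv[symmetric] Suc_leI
         del: length_greater_0_conv)
  have "length (filter \<omega> (butlast p)) = card (set (filter \<omega> (butlast p)))"
    using p(3) by (simp add: distinct_card distinct_butlast del: set_filter)
  also have "\<dots> \<le> card (\<Union>y\<in>set q. {x \<in> Zd d. coarse K x = y \<and> \<omega> x})"
  proof (rule card_mono)
    show "finite (\<Union>y\<in>set q. {x \<in> Zd d. coarse K x = y \<and> \<omega> x})"
      by (auto intro: finite_subset[OF _ fin])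
    show "set (filter \<omega> (butlast p)) \<subseteq> (\<Union>y\<in>set q. {x \<in> Zd d. coarse K x = y \<and> \<omega> x})"
      using pZ by (auto simp: setq dest: in_set_butlastD)
  qed
  also have "\<dots> \<le> (\<Sum>y\<in>set q. W y)"
    unfolding W_def by (intro card_UN_le) auto
  finally have openp: "length (filter \<omega> (butlast p)) \<le> (\<Sum>y\<in>set q. W y)" .
  have W1: "W y \<le> (if \<omega>' y then 1 else 0) + (W y - 1)" if "y \<in> set q" for y
  proof (cases "\<omega>' y")
    case False
    then have "{x \<in> Zd d. coarse K x = y \<and> \<omega> x} = {}" using open_imp by auto
    then have "W y = 0" unfolding W_def by (simp only: card.empty)
    then show ?thesis by simp
  qed auto
  have "(\<Sum>y\<in>set q. W y) \<le> (\<Sum>y\<in>set q. (if \<omega>' y then 1 else 0) + (W y - 1))"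
    by (intro sum_mono W1)
  also have "\<dots> = card {y\<in>set q. \<omega>' y} + (\<Sum>y\<in>set q. W y - 1)"
    by (simp add: sum.distrib sum.If_cases Int_def)
  finally have W2: "(\<Sum>y\<in>set q. W y) \<le> card {y\<in>set q. \<omega>' y} + (\<Sum>y\<in>set q. W y - 1)" .
  \<comment> \<open>The last block of \<open>q\<close> may be open but is not counted by the travel
    time; this is the source of the summand 1 in the first bound.\<close>
  have "card {y\<in>set q. \<omega>' y} \<le> card (insert (last q) (set (filter \<omega>' (butlast q))))"
  proof (intro card_mono)
    have "set q = set (butlast q @ [last q])" using qne by simp
    also have "\<dots> = insert (last q) (set (butlast q))" by simp
    finally show "{y \<in> set q. \<omega>' y} \<subseteq> insert (last q) (set (filter \<omega>' (butlast q)))" by auto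
  qed auto
  also have "\<dots> \<le> Suc (card (set (filter \<omega>' (butlast q))))"
    by (simp add: card_insert_if)
  also have "\<dots> \<le> Suc (length (filter \<omega>' (butlast q)))"
    by (simp only: Suc_le_mono card_length)
  finally have openq: "card {y\<in>set q. \<omega>' y} \<le> Suc (length (filter \<omega>' (butlast q)))" .
  have len': "real (length q) - fwd k b \<le> real (length p) - fwd k a" using len by linarith
  have openp': "real (length (filter \<omega> (butlast p))) \<le> (\<Sum>y\<in>set q. real (W y))"
    using openp by (simp add: of_nat_sum[symmetric] del: of_nat_sum)
  have "(\<Sum>y\<in>set q. real (W y)) = real (\<Sum>y\<in>set q. W y)" by simp
  also have "\<dots> \<le> real (Suc (length (filter \<omega>' (butlast q))) + (\<Sum>y\<in>set q. W y - 1))"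
    using W2 openq by (intro of_nat_mono) linarith
  finally have W2': "(\<Sum>y\<in>set q. real (W y)) \<le> 1 + length (filter \<omega>' (butlast q)) + (\<Sum>y\<in>set q. real (W y - 1))"
    by simp
  have Tq': "passage_time d \<omega>' (\<lambda>_. 0) b \<le> travel_time \<omega>' q" by (rule passage_time_le[OF q])
  show ?thesis
  proof (rule that[OF q])
    show "fwd k a - passage_time d \<omega> (\<lambda>_. 0) a
      \<le> fwd k b - passage_time d \<omega>' (\<lambda>_. 0) b + 1 + (\<Sum>y\<in>set q. real (W y - 1))"
      using len' openp' W2' Tq' Tq Tp p(2) by linarith
    show "fwd k a - passage_time d \<omega> (\<lambda>_. 0) a
      \<le> (\<Sum>y\<in>set q. real (W y)) - (real (length q) - 1 - fwd k b)"
      using len' openp' Tp p(2) by linarith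
  qed
qed

text \<open>A forward step costs \<open>\<alpha>\<close>, a sideways step \<open>\<theta>\<close> and a backward step \<open>2 * \<theta> - \<alpha>\<close>, so that a path with
  excess length \<open>e\<close> to a point \<open>b\<close> of the positive orthant costs \<open>\<theta> * e + \<alpha> * fwd k b\<close>.\<close>
definition rho :: "nat \<Rightarrow> nat \<Rightarrow> real \<Rightarrow> real \<Rightarrow> (nat \<Rightarrow> int) \<Rightarrow> (nat \<Rightarrow> int) \<Rightarrow> real" where
  "rho d k \<theta> \<alpha> x y = \<theta> * dist1 d x y - (\<theta> - \<alpha>) * (fwd k y - fwd k x)"

fun chain_cost :: "('a \<Rightarrow> 'a \<Rightarrow> real) \<Rightarrow> 'a \<Rightarrow> 'a list \<Rightarrow> real" where
  "chain_cost r x [] = 0"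
| "chain_cost r x (y # ys) = r x y + chain_cost r y ys"

text \<open>Skipping a site of a chain cannot raise its cost, by the triangle inequality, or by
  nonnegativity if the site is the last one.\<close>

lemma chain_cost_mono:
  assumes tri: "\<And>x y z. r x z \<le> r x y + r y z" and nn: "\<And>x y. 0 \<le> r x y"
  shows "chain_cost r x (remdups (filter P ys)) \<le> chain_cost r x ys"
proof -
  have shift: "chain_cost r x ys \<le> r x y + chain_cost r y ys" for x y ys
  proof (cases ys)
    case (Cons z zs)
    then show ?thesis using tri[of x z y] by simp
  qed (use nn in simp)
  show ?thesis
  proof (induction ys arbitrary: x)
    case (Cons y ys)
    show ?case
    proof (cases "P y \<and> y \<notin> set ys")
      case True
      then show ?thesis using Cons[of y] by simp
    next
      case False
      then have "remdups (filter P (y # ys)) = remdups (filter P ys)" by auto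
      then show ?thesis using Cons[of x] shift[of x ys y] by (simp del: remdups.simps)
    qed
  qed simp
qed

lemma rho_triangle: "0 \<le> \<theta> \<Longrightarrow> rho d k \<theta> \<alpha> x z \<le> rho d k \<theta> \<alpha> x y + rho d k \<theta> \<alpha> y z"
  using mult_left_mono[of "real_of_int (dist1 d x z)" "real_of_int (dist1 d x y + dist1 d y z)" \<theta>]
    dist1_triangle[of d x z y]
  by (simp add: rho_def algebra_simps del: of_int_add) (simp add: algebra_simps)

lemma fwd_le_dist1:
  assumes "k \<le> d"
  shows "fwd k y - fwd k x \<le> dist1 d x y"
proof -
  have "fwd k y - fwd k x = (\<Sum>i<k. y i - x i)" by (simp add: fwd_def sum_subtractf)
  also have "\<dots> \<le> (\<Sum>i<k. \<bar>y i - x i\<bar>)" by (intro sum_mono) auto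
  also have "\<dots> \<le> (\<Sum>i<d. \<bar>y i - x i\<bar>)" using assms by (intro sum_mono2) auto
  finally show ?thesis by (simp add: dist1_def)
qed

lemma rho_nonneg:
  assumes "k \<le> d" "0 \<le> \<alpha>" "\<alpha> \<le> \<theta>"
  shows "0 \<le> rho d k \<theta> \<alpha> x y"
proof -
  have "(\<theta> - \<alpha>) * (fwd k y - fwd k x) \<le> (\<theta> - \<alpha>) * dist1 d x y"
    using fwd_le_dist1[OF assms(1), of y x] assms
    by (intro mult_left_mono) (auto simp flip: of_int_diff)
  also have "\<dots> \<le> \<theta> * dist1 d x y" using assms dist1_nonneg[of d x y] by (intro mult_right_mono) auto
  finally show ?thesis by (simp add: rho_def)
qed

lemma dist1_nbr: "nbr d x y \<Longrightarrow> dist1 d x y = 1"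
proof -
  assume "nbr d x y"
  then obtain j s where x: "j < d" "s \<in> {1,-1}" "y = x(j := x j + s)" unfolding nbr_iff by blast
  have "dist1 d x y = (\<Sum>i<d. if i = j then 1 else 0)"
    unfolding dist1_def using x by (intro sum.cong) auto
  then show ?thesis using x by simp
qed

lemma chain_cost_path:
  assumes "successively (nbr d) (x # q)"
  shows "chain_cost (rho d k \<theta> \<alpha>) x q
    = \<theta> * length q - (\<theta> - \<alpha>) * (fwd k (last (x # q)) - fwd k x)"
  using assms
proof (induction q arbitrary: x)
  case (Cons y q)
  then have "nbr d x y" by simp
  with Cons show ?case
    by (simp add: rho_def dist1_nbr successively_Cons algebra_simps)
qed simp

text \<open>The exponential cost of the chain of sites with positive weight visited by \<open>q\<close> pays for
  the excess length of \<open>q\<close>; this turns a supremum over paths into a sum over chains of sites.\<close>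
lemma path_weight_le:
  fixes w :: "(nat \<Rightarrow> int) \<Rightarrow> nat"
  assumes k: "k \<le> d" and al: "0 \<le> \<alpha>" "\<alpha> \<le> \<theta>" and th: "\<theta> = \<delta> * ln 2"
    and q: "q \<in> paths d (\<lambda>_. 0) b" and b: "fwd k b \<ge> 0"
  obtains xs where "distinct xs" "set xs \<subseteq> {y \<in> Zd d. w y > 0}"
    "(\<Sum>y\<in>set q. real (w y)) - \<delta> * (real (length q) - 1 - fwd k b)
      \<le> 2 * \<alpha> * fwd k b + 2 * (exp (- chain_cost (rho d k \<theta> \<alpha>) (\<lambda>_. 0) xs) * (\<Prod>x\<in>set xs. 2 ^ w x))"
proof -
  define xs where "xs = remdups (filter (\<lambda>y. w y > 0) q)"
  define c where "c = chain_cost (rho d k \<theta> \<alpha>) (\<lambda>_. 0) xs"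
  define e where "e = real (length q) - 1 - fwd k b"
  define s where "s = (\<Sum>y\<in>set q. real (w y))"
  have qq: "set q \<subseteq> Zd d" "successively (nbr d) q" "last q = b" using q by (auto simp: paths_iff)
  obtain q' where q': "q = (\<lambda>_. 0) # q'" using q by (cases q) (auto simp: paths_iff)
  have "c \<le> chain_cost (rho d k \<theta> \<alpha>) (\<lambda>_. 0) q"
    unfolding c_def xs_def
    by (intro chain_cost_mono rho_triangle rho_nonneg) (use k al in auto)
  also have "\<dots> = chain_cost (rho d k \<theta> \<alpha>) (\<lambda>_. 0) q'"
    by (simp add: q' rho_def dist1_def)
  also have "\<dots> = \<theta> * length q' - (\<theta> - \<alpha>) * fwd k b"
    using chain_cost_path[of d "\<lambda>_. 0" q' k \<theta> \<alpha>] qq by (simp add: q')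
  also have "\<dots> = \<theta> * e + \<alpha> * fwd k b" by (simp add: e_def q' algebra_simps)
  finally have c: "c \<le> \<theta> * e + \<alpha> * fwd k b" .
  have "s = (\<Sum>y\<in>{y\<in>set q. w y > 0}. real (w y))"
    unfolding s_def by (intro sum.mono_neutral_right) auto
  then have s: "s = (\<Sum>y\<in>set xs. real (w y))" by (simp add: xs_def)
  define Y where "Y = exp (- c) * (\<Prod>x\<in>set xs. 2 ^ w x)"
  have "(\<Prod>x\<in>set xs. 2 ^ w x :: real) = exp (ln 2 * s)"
    unfolding s sum_distrib_left
    by (subst exp_sum) (auto simp: exp_of_nat2_mult[symmetric] mult.commute exp_of_nat_mult intro!: prod.cong)
  then have Y: "Y = exp (ln 2 * s - c)" by (simp add: Y_def exp_diff exp_minus field_simps)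
  \<comment> \<open>Bounding a number by its exponential trades the weight along a path for one term
    of a sum over chains, whose mean can be computed.\<close>
  have "ln 2 * s - c \<le> Y" unfolding Y using exp_ge_add_one_self[of "ln 2 * s - c"] by linarith
  then have "ln 2 * s - \<theta> * e \<le> Y + \<alpha> * fwd k b" using c by linarith
  \<comment> \<open>A site weighted by \<open>2 ^ w\<close> contributes \<open>ln 2 * w\<close> to
    the exponent; this is why a charge of \<open>\<delta>\<close> per unit of excess requires
    \<open>\<theta> = \<delta> * ln 2\<close>.\<close>
  then have *: "ln 2 * (s - \<delta> * e) \<le> Y + \<alpha> * fwd k b" by (simp add: th algebra_simps)
  have l2: "ln 2 \<ge> (1/2 :: real)" using ln2_ge_two_thirds by simp
  have nn: "0 \<le> Y + \<alpha> * fwd k b" using al b by (simp add: Y)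
  define V where "V = Y + \<alpha> * fwd k b"
  \<comment> \<open>Dividing by \<open>ln 2\<close>, which is at least 1/2, costs a factor 2; a
    negative left side is trivial because \<open>V\<close> is nonnegative.\<close>
  have "s - \<delta> * e \<le> 2 * V"
  proof (cases "s - \<delta> * e \<ge> 0")
    case True
    then have "1/2 * (s - \<delta> * e) \<le> ln 2 * (s - \<delta> * e)" using l2 by (intro mult_right_mono)
    also note *
    finally show ?thesis by (simp add: V_def field_simps)
  qed (use nn[folded V_def] in linarith)
  then show ?thesis
    using qq by (intro that[of xs]) (auto simp: V_def Y_def c_def s_def e_def xs_def algebra_simps)
qed

section \<open>Sums over chains of sites\<close>

lemma nn_integral_count_space_Times:
  fixes f :: "'a \<times> 'b \<Rightarrow> ennreal"
  assumes "countable A" "countable B"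
  shows "(\<integral>\<^sup>+z. f z \<partial>count_space (A \<times> B)) = (\<integral>\<^sup>+x. (\<integral>\<^sup>+y. f (x, y) \<partial>count_space B) \<partial>count_space A)"
proof -
  interpret B: sigma_finite_measure "count_space B"
    by (rule sigma_finite_measure_count_space_countable[OF assms(2)])
  show ?thesis
    using B.nn_integral_fst[of f "count_space A"] assms
    by (simp add: pair_measure_countable)
qed

text \<open>Transfer operator argument: split off the first site of the chain. Its density gives
  \<open>q\<close> and the sum over its position gives at most \<open>c\<close>, whatever the
  starting point.\<close>

lemma chain_sum_length:
  fixes r :: "'a \<Rightarrow> 'a \<Rightarrow> real"
  assumes U: "countable U" and q: "0 \<le> q" and c: "0 \<le> c"
    and step: "\<And>x. x \<in> U \<Longrightarrow> (\<integral>\<^sup>+y. ennreal (exp (- r x y)) \<partial>count_space U) \<le> ennreal c"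
    and x: "x \<in> U"
  shows "(\<integral>\<^sup>+xs. ennreal (exp (- chain_cost r x xs) * q ^ length xs)
    \<partial>count_space {xs \<in> lists U. length xs = n}) \<le> ennreal ((q * c) ^ n)"
  using x
proof (induction n arbitrary: x)
  case 0
  have "{xs \<in> lists U. length xs = 0} = {[]}" by auto
  then show ?case by (simp add: nn_integral_count_space_finite)
next
  case (Suc n)
  let ?L = "{xs \<in> lists U. length xs = n}"
  let ?f = "\<lambda>x xs. ennreal (exp (- chain_cost r x xs) * q ^ length xs)"
  have cL: "countable ?L" using U by (auto intro: countable_subset[OF _ countable_lists[OF U]])
  have bij: "bij_betw (\<lambda>(y, ys). y # ys) (U \<times> ?L) {xs \<in> lists U. length xs = Suc n}"
    by (rule bij_betwI[where g="\<lambda>xs. (hd xs, tl xs)"]) (auto simp: length_Suc_conv)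
  have "(\<integral>\<^sup>+xs. ?f x xs \<partial>count_space {xs \<in> lists U. length xs = Suc n})
    = (\<integral>\<^sup>+z. ?f x ((\<lambda>(y, ys). y # ys) z) \<partial>count_space (U \<times> ?L))"
    by (rule nn_integral_bij_count_space[OF bij, symmetric])
  also have "\<dots> = (\<integral>\<^sup>+y. (\<integral>\<^sup>+ys. ?f x (y # ys) \<partial>count_space ?L) \<partial>count_space U)"
    by (subst nn_integral_count_space_Times[OF U cL]) simp
  also have "\<dots> = (\<integral>\<^sup>+y. (\<integral>\<^sup>+ys. ennreal (exp (- r x y) * q) * ?f y ys \<partial>count_space ?L) \<partial>count_space U)"
    using q by (intro nn_integral_cong) (simp add: ennreal_mult'[symmetric] exp_add[symmetric] exp_diff exp_minus field_simps)
  also have "\<dots> = (\<integral>\<^sup>+y. ennreal (exp (- r x y) * q) * (\<integral>\<^sup>+ys. ?f y ys \<partial>count_space ?L) \<partial>count_space U)"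
    by (intro nn_integral_cong nn_integral_cmult) auto
  also have "\<dots> \<le> (\<integral>\<^sup>+y. ennreal (exp (- r x y) * q) * ennreal ((q * c) ^ n) \<partial>count_space U)"
    using Suc.IH by (intro nn_integral_mono mult_left_mono) auto
  also have "\<dots> = (\<integral>\<^sup>+y. ennreal (exp (- r x y)) * ennreal (q * (q * c) ^ n) \<partial>count_space U)"
    using q c by (intro nn_integral_cong) (simp add: ennreal_mult'[symmetric] mult.assoc)
  also have "\<dots> = (\<integral>\<^sup>+y. ennreal (exp (- r x y)) \<partial>count_space U) * ennreal (q * (q * c) ^ n)"
    by (intro nn_integral_multc) auto
  also have "\<dots> \<le> ennreal c * ennreal (q * (q * c) ^ n)"
    using step[OF Suc.prems] by (intro mult_right_mono) auto
  also have "\<dots> = ennreal ((q * c) ^ Suc n)"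
    using q c by (simp add: ennreal_mult'[symmetric] algebra_simps)
  finally show ?case .
qed

text \<open>Chains are sorted by length, which leaves a geometric series of ratio at most
  1/2.\<close>

lemma chain_sum:
  fixes r :: "'a \<Rightarrow> 'a \<Rightarrow> real"
  assumes U: "countable U" and q: "0 \<le> q" and c: "0 \<le> c" and qc: "q * c \<le> 1/2"
    and step: "\<And>x. x \<in> U \<Longrightarrow> (\<integral>\<^sup>+y. ennreal (exp (- r x y)) \<partial>count_space U) \<le> ennreal c"
    and x: "x \<in> U"
  shows "(\<integral>\<^sup>+xs. ennreal (exp (- chain_cost r x xs) * q ^ length xs) \<partial>count_space (lists U)) \<le> 2"
proof -
  let ?f = "\<lambda>xs. ennreal (exp (- chain_cost r x xs) * q ^ length xs)"
  have "?f xs = (\<Sum>n. if n = length xs then ?f xs else 0)" for xs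
    using sums_single[of "length xs" "\<lambda>_. ?f xs"] by (simp add: sums_unique[symmetric])
  then have "(\<integral>\<^sup>+xs. ?f xs \<partial>count_space (lists U))
    = (\<integral>\<^sup>+xs. (\<Sum>n. if n = length xs then ?f xs else 0) \<partial>count_space (lists U))"
    by (intro nn_integral_cong) auto
  also have "\<dots> = (\<Sum>n. \<integral>\<^sup>+xs. (if n = length xs then ?f xs else 0) \<partial>count_space (lists U))"
    by (intro nn_integral_suminf) auto
  also have "\<dots> = (\<Sum>n. \<integral>\<^sup>+xs. ?f xs \<partial>count_space {xs \<in> lists U. length xs = n})"
  proof (intro suminf_cong)
    fix n
    have "(\<integral>\<^sup>+xs. (if n = length xs then ?f xs else 0) \<partial>count_space (lists U))
      = (\<integral>\<^sup>+xs. (if n = length xs then ?f xs else 0) \<partial>count_space {xs \<in> lists U. length xs = n})"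
      by (intro nn_integral_count_space_eq) auto
    also have "\<dots> = (\<integral>\<^sup>+xs. ?f xs \<partial>count_space {xs \<in> lists U. length xs = n})"
      by (intro nn_integral_cong) auto
    finally show "(\<integral>\<^sup>+xs. (if n = length xs then ?f xs else 0) \<partial>count_space (lists U))
      = (\<integral>\<^sup>+xs. ?f xs \<partial>count_space {xs \<in> lists U. length xs = n})" .
  qed
  also have "\<dots> \<le> (\<Sum>n. ennreal ((1/2) ^ n))"
  proof (intro suminf_le summableI)
    fix n
    have "(\<integral>\<^sup>+xs. ?f xs \<partial>count_space {xs \<in> lists U. length xs = n}) \<le> ennreal ((q * c) ^ n)"
      by (rule chain_sum_length[OF U q c step x])
    also have "\<dots> \<le> ennreal ((1/2) ^ n)" using q c qc by (intro ennreal_leI power_mono) auto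
    finally show "(\<integral>\<^sup>+xs. ?f xs \<partial>count_space {xs \<in> lists U. length xs = n}) \<le> ennreal ((1/2) ^ n)" .
  qed
  also have "\<dots> = 2"
    by (subst suminf_ennreal2) (auto simp: suminf_geometric summable_geometric)
  finally show ?thesis .
qed

section \<open>Exponential sums over the lattice\<close>

lemma countable_Zd: "countable (Zd d)"
proof -
  have "Zd d \<subseteq> range (\<lambda>(xs :: int list) i. if i < length xs then xs ! i else 0)"
  proof
    fix x assume "x \<in> Zd d"
    then have "x = (\<lambda>(xs :: int list) i. if i < length xs then xs ! i else 0) (map x [0..<d])"
      by (auto simp: Zd_def)
    then show "x \<in> range (\<lambda>(xs :: int list) i. if i < length xs then xs ! i else 0)" by blast
  qed
  then show ?thesis by (rule countable_subset) auto
qed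

lemma nn_integral_Zd_prod:
  fixes g :: "nat \<Rightarrow> int \<Rightarrow> ennreal"
  shows "(\<integral>\<^sup>+x. (\<Prod>i<d. g i (x i)) \<partial>count_space (Zd d)) = (\<Prod>i<d. \<integral>\<^sup>+t. g i t \<partial>count_space UNIV)"
proof (induction d)
  case 0
  have "Zd 0 = {\<lambda>_. 0}" by (auto simp: Zd_def)
  then show ?case by (simp add: nn_integral_count_space_finite)
next
  case (Suc d)
  have bij: "bij_betw (\<lambda>(x, t). x(d := t)) (Zd d \<times> UNIV) (Zd (Suc d))"
    by (rule bij_betwI[where g="\<lambda>x. (x(d := 0), x d)"]) (auto simp: Zd_def fun_eq_iff)
  have "(\<integral>\<^sup>+x. (\<Prod>i<Suc d. g i (x i)) \<partial>count_space (Zd (Suc d)))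
    = (\<integral>\<^sup>+z. (\<Prod>i<Suc d. g i (((\<lambda>(x, t). x(d := t)) z) i)) \<partial>count_space (Zd d \<times> UNIV))"
    by (rule nn_integral_bij_count_space[OF bij, symmetric])
  also have "\<dots> = (\<integral>\<^sup>+x. (\<integral>\<^sup>+t. (\<Prod>i<d. g i (x i)) * g d t \<partial>count_space UNIV) \<partial>count_space (Zd d))"
    by (subst nn_integral_count_space_Times) (auto simp: countable_Zd)
  also have "\<dots> = (\<integral>\<^sup>+x. (\<Prod>i<d. g i (x i)) * (\<integral>\<^sup>+t. g d t \<partial>count_space UNIV) \<partial>count_space (Zd d))"
    by (intro nn_integral_cong nn_integral_cmult) auto
  also have "\<dots> = (\<integral>\<^sup>+x. (\<Prod>i<d. g i (x i)) \<partial>count_space (Zd d)) * (\<integral>\<^sup>+t. g d t \<partial>count_space UNIV)"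
    by (intro nn_integral_multc) auto
  finally show ?case by (simp add: Suc)
qed

text \<open>A two-sided geometric series. With 0 counted twice it is at most 2 / (1 - exp(-a)), and
  1 - exp(-a) >= a / (1 + a) >= a / 2 yields the constant.\<close>

lemma nn_integral_exp_abs_int:
  assumes a: "0 < a" "a \<le> 1"
  shows "(\<integral>\<^sup>+t. ennreal (exp (- a * \<bar>real_of_int (t - c)\<bar>)) \<partial>count_space UNIV) \<le> ennreal (4 / a)"
proof -
  let ?g = "\<lambda>n::nat. ennreal (exp (- a) ^ n)"
  have bij: "bij_betw (\<lambda>t. t + c) UNIV (UNIV :: int set)"
    by (rule bij_betwI[where g="\<lambda>t. t - c"]) auto
  have ea: "exp (- a) \<le> 1 / (1 + a)"
    using exp_ge_add_one_self[of a] a by (simp add: exp_minus field_simps)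
  have ea1: "exp (- a) < 1" using a by simp
  have "(\<integral>\<^sup>+t. ennreal (exp (- a * \<bar>real_of_int (t - c)\<bar>)) \<partial>count_space UNIV)
    = (\<integral>\<^sup>+t. ennreal (exp (- a * \<bar>real_of_int t\<bar>)) \<partial>count_space UNIV)"
    by (subst nn_integral_bij_count_space[OF bij, symmetric]) simp
  also have "\<dots> \<le> (\<integral>\<^sup>+t. (\<Sum>n. ?g n * indicator {int n} t + ?g n * indicator {- int n} t) \<partial>count_space UNIV)"
  proof (intro nn_integral_mono)
    fix t :: int
    define n where "n = nat \<bar>t\<bar>"
    have "ennreal (exp (- a * \<bar>real_of_int t\<bar>)) = ?g n"
      by (simp add: n_def exp_of_nat_mult[symmetric] mult.commute)
    also have "\<dots> \<le> ?g n * indicator {int n} t + ?g n * indicator {- int n} t"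
      by (auto simp: n_def indicator_def)
    also have "\<dots> \<le> (\<Sum>n. ?g n * indicator {int n} t + ?g n * indicator {- int n} t)"
      using sum_le_suminf[of "\<lambda>n. ?g n * indicator {int n} t + ?g n * indicator {- int n} t" "{n}"]
      by (simp add: summableI)
    finally show "ennreal (exp (- a * \<bar>real_of_int t\<bar>))
      \<le> (\<Sum>n. ?g n * indicator {int n} t + ?g n * indicator {- int n} t)" .
  qed
  also have "\<dots> = (\<Sum>n. ?g n + ?g n)"
    by (subst nn_integral_suminf) (auto simp: nn_integral_add nn_integral_cmult)
  also have "\<dots> = (\<Sum>n. ennreal (2 * exp (- a) ^ n))"
    by (simp add: ennreal_plus[symmetric] del: ennreal_plus)
  also have "\<dots> = ennreal (2 * (1 / (1 - exp (- a))))"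
    using ea1 by (subst suminf_ennreal2) (auto simp: suminf_mult suminf_geometric summable_geometric)
  also have "\<dots> \<le> ennreal (4 / a)"
  proof (intro ennreal_leI)
    have "1 - exp (- a) \<ge> a / (1 + a)" using ea a by (simp add: field_simps)
    moreover have "a / (1 + a) \<ge> a / 2" using a by (intro divide_left_mono) auto
    ultimately have "1 - exp (- a) \<ge> a / 2" by linarith
    then have "1 / (1 - exp (- a)) \<le> 1 / (a / 2)" using a by (intro divide_left_mono) auto
    then show "2 * (1 / (1 - exp (- a))) \<le> 4 / a" by (simp add: field_simps)
  qed
  finally show ?thesis .
qed

text \<open>\<open>rho\<close> dominates an l1 distance with weight \<open>\<alpha>\<close> on the
  first \<open>k\<close> coordinates and \<open>\<theta>\<close> on the others, and the exponential
  of that distance factorises. The \<open>k\<close> factors 1/\<alpha> are the origin of the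
  exponent 1/k: a density q times this sum stays bounded when \<alpha> is of the order of the k-th
  root of q.\<close>

lemma rho_sum:
  assumes k: "k \<le> d" and al: "0 < \<alpha>" "\<alpha> \<le> \<theta>" "\<theta> \<le> 1"
  shows "(\<integral>\<^sup>+y. ennreal (exp (- rho d k \<theta> \<alpha> x y)) \<partial>count_space (Zd d))
    \<le> ennreal ((4 / \<alpha>) ^ k * (4 / \<theta>) ^ (d - k))"
proof -
  define s where "s i = (if i < k then \<alpha> else \<theta>)" for i
  have s: "0 < s i" "s i \<le> 1" for i using al by (auto simp: s_def)
  have split: "{..<d} = {..<k} \<union> {k..<d}" using k by auto
  have le: "(\<Sum>i<d. s i * \<bar>real_of_int (y i - x i)\<bar>) \<le> rho d k \<theta> \<alpha> x y" for y
  proof -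
    have "(\<Sum>i<d. s i * \<bar>real_of_int (y i - x i)\<bar>) \<le>
      (\<Sum>i<d. \<theta> * \<bar>real_of_int (y i - x i)\<bar> - (if i < k then (\<theta> - \<alpha>) * real_of_int (y i - x i) else 0))"
    proof (intro sum_mono)
      fix i
      have "(\<theta> - \<alpha>) * real_of_int (y i - x i) \<le> (\<theta> - \<alpha>) * \<bar>real_of_int (y i - x i)\<bar>"
        using al by (intro mult_left_mono) auto
      then show "s i * \<bar>real_of_int (y i - x i)\<bar> \<le>
        \<theta> * \<bar>real_of_int (y i - x i)\<bar> - (if i < k then (\<theta> - \<alpha>) * real_of_int (y i - x i) else 0)"
        by (auto simp: s_def left_diff_distrib)
    qed
    also have "\<dots> = \<theta> * dist1 d x y - (\<Sum>i<d. if i < k then (\<theta> - \<alpha>) * real_of_int (y i - x i) else 0)"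
      by (simp add: sum_subtractf sum_distrib_left dist1_def)
    also have "(\<Sum>i<d. if i < k then (\<theta> - \<alpha>) * real_of_int (y i - x i) else 0)
      = (\<Sum>i<k. (\<theta> - \<alpha>) * real_of_int (y i - x i))"
      using k by (intro sum.mono_neutral_cong_right) auto
    also have "\<dots> = (\<theta> - \<alpha>) * (fwd k y - fwd k x)"
      by (simp add: fwd_def sum_subtractf flip: sum_distrib_left)
    finally show ?thesis by (simp add: rho_def)
  qed
  have "(\<integral>\<^sup>+y. ennreal (exp (- rho d k \<theta> \<alpha> x y)) \<partial>count_space (Zd d))
    \<le> (\<integral>\<^sup>+y. (\<Prod>i<d. ennreal (exp (- s i * \<bar>real_of_int (y i - x i)\<bar>))) \<partial>count_space (Zd d))"
  proof (intro nn_integral_mono)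
    fix y
    have "(\<Prod>i<d. ennreal (exp (- s i * \<bar>real_of_int (y i - x i)\<bar>)))
      = ennreal (exp (- (\<Sum>i<d. s i * \<bar>real_of_int (y i - x i)\<bar>)))"
      by (subst prod_ennreal) (auto simp: exp_sum[symmetric] sum_negf)
    then show "ennreal (exp (- rho d k \<theta> \<alpha> x y)) \<le> (\<Prod>i<d. ennreal (exp (- s i * \<bar>real_of_int (y i - x i)\<bar>)))"
      using le[of y] by (simp only:) (intro ennreal_leI, simp)
  qed
  also have "\<dots> = (\<Prod>i<d. \<integral>\<^sup>+t. ennreal (exp (- s i * \<bar>real_of_int (t - x i)\<bar>)) \<partial>count_space UNIV)"
    by (rule nn_integral_Zd_prod)
  also have "\<dots> \<le> (\<Prod>i<d. ennreal (4 / s i))"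
    by (intro prod_mono_ennreal nn_integral_exp_abs_int s)
  also have "\<dots> = ennreal (\<Prod>i<d. 4 / s i)"
    using s by (intro prod_ennreal) (auto intro: less_imp_le)
  also have "(\<Prod>i<d. 4 / s i) = (\<Prod>i<k. 4 / s i) * (\<Prod>i\<in>{k..<d}. 4 / s i)"
    unfolding split by (intro prod.union_disjoint) auto
  also have "\<dots> = (4 / \<alpha>) ^ k * (4 / \<theta>) ^ (d - k)" by (simp add: s_def)
  finally show ?thesis .
qed

section \<open>Laws of coarse environments\<close>

text \<open>Carries the sigma-algebra of \<open>env d \<epsilon>\<close> for all
  \<open>\<epsilon>\<close> at once, so measurability is proved a single time.\<close>

abbreviation site_space :: "nat \<Rightarrow> ((nat \<Rightarrow> int) \<Rightarrow> bool) measure" where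
  "site_space d \<equiv> PiM (Zd d) (\<lambda>_. count_space UNIV)"

lemma sets_env [measurable_cong]: "sets (env d \<epsilon>) = sets (site_space d)"
  unfolding env_def by (intro sets_PiM_cong) auto

lemma prob_space_env: "prob_space (env d \<epsilon>)"
  unfolding env_def by (intro prob_space_PiM measure_pmf.prob_space_axioms)

lemma measurable_travel_time:
  assumes "set p \<subseteq> Zd d"
  shows "(\<lambda>\<omega>. travel_time \<omega> p) \<in> borel_measurable (site_space d)"
proof -
  have tau: "(\<lambda>\<omega>. tau \<omega> x) \<in> borel_measurable (site_space d)" if "x \<in> Zd d" for x
    unfolding tau_def
    by (rule measurable_compose[OF measurable_component_singleton[OF that]]) auto
  have "(\<lambda>\<omega>. sum_list (map (tau \<omega>) q)) \<in> borel_measurable (site_space d)" if "set q \<subseteq> Zd d" for q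
    using that by (induction q) (auto intro!: borel_measurable_add tau)
  then show ?thesis
    unfolding travel_time_def using assms by (auto dest: in_set_butlastD)
qed

lemma countable_paths: "countable (paths d x y)"
  by (rule countable_subset[OF _ countable_lists[OF countable_Zd[of d]]]) (auto simp: paths_iff)

lemma measurable_passage_time [measurable]:
  "(\<lambda>\<omega>. passage_time d \<omega> x y) \<in> borel_measurable (site_space d)"
  unfolding passage_time_def
  by (intro borel_measurable_cINF_real countable_paths measurable_travel_time) (auto simp: paths_iff)

lemma integrable_passage_time:
  assumes "prob_space M" "T \<in> measurable M (site_space d)" "x \<in> Zd d" "y \<in> Zd d"
  shows "integrable M (\<lambda>\<omega>. passage_time d (T \<omega>) x y)"
proof -
  interpret prob_space M by fact
  show ?thesis
    using assms passage_time_nonneg[OF assms(3,4)] passage_time_le_dist1[OF assms(3,4)]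
    by (intro integrable_const_bound[of _ "of_int (dist1 d x y)"]) auto
qed

definition mean_time :: "nat \<Rightarrow> real \<Rightarrow> (nat \<Rightarrow> int) \<Rightarrow> (nat \<Rightarrow> int) \<Rightarrow> real" where
  "mean_time d \<epsilon> x y = (\<integral>\<omega>. passage_time d \<omega> x y \<partial>env d \<epsilon>)"

lemma integrable_env:
  "x \<in> Zd d \<Longrightarrow> y \<in> Zd d \<Longrightarrow> integrable (env d \<epsilon>) (\<lambda>\<omega>. passage_time d \<omega> x y)"
  using integrable_passage_time[of "env d \<epsilon>" "\<lambda>\<omega>. \<omega>" d x y] prob_space_env by simp

lemma indep_vars_PiM_coordinates:
  assumes M: "\<And>i. i \<in> I \<Longrightarrow> prob_space (M i)" and I: "I \<noteq> {}"
  shows "prob_space.indep_vars (PiM I M) M (\<lambda>i \<omega>. \<omega> i) I"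
proof -
  interpret prob_space "PiM I M" using M by (rule prob_space_PiM)
  have "distr (PiM I M) (PiM I M) (\<lambda>x. \<lambda>i\<in>I. x i) = distr (PiM I M) (PiM I M) (\<lambda>x. x)"
    by (intro distr_cong) (auto simp: space_PiM PiE_def extensional_restrict)
  also have "\<dots> = PiM I M" by (rule distr_id)
  also have "\<dots> = PiM I (\<lambda>i. distr (PiM I M) (M i) (\<lambda>\<omega>. \<omega> i))"
    by (intro PiM_cong refl distr_PiM_component[symmetric] M)
  finally show ?thesis
    by (subst indep_vars_iff_distr_eq_PiM'[OF I]) auto
qed

lemma indep_vars_PiM_blocks:
  fixes P :: "'a pmf"
  assumes I: "I \<noteq> {}" and B: "\<And>y. y \<in> L \<Longrightarrow> B y \<subseteq> I" "disjoint_family_on B L"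
    and g: "\<And>y. y \<in> L \<Longrightarrow> g y \<in> measurable (PiM (B y) (\<lambda>_. measure_pmf P)) (Q y)"
  shows "prob_space.indep_vars (PiM I (\<lambda>_. measure_pmf P)) Q (\<lambda>y \<omega>. g y (restrict \<omega> (B y))) L"
proof -
  interpret prob_space "PiM I (\<lambda>_. measure_pmf P)"
    by (intro prob_space_PiM measure_pmf.prob_space_axioms)
  have "indep_vars (\<lambda>_. measure_pmf P) (\<lambda>i \<omega>. \<omega> i) I"
    by (intro indep_vars_PiM_coordinates measure_pmf.prob_space_axioms I)
  from indep_vars_restrict[OF this B] have
    "indep_vars (\<lambda>j. PiM (B j) (\<lambda>_. measure_pmf P)) (\<lambda>j \<omega>. restrict \<omega> (B j)) L" .
  from indep_vars_compose2[OF this g] show ?thesis .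
qed

lemma prob_block_avoid:
  fixes P :: "'a pmf"
  assumes "finite B" "B \<subseteq> I"
  shows "measure (PiM I (\<lambda>_. measure_pmf P)) {\<omega> \<in> space (PiM I (\<lambda>_. measure_pmf P)). \<not> (\<exists>x\<in>B. \<omega> x \<in> S x)}
    = (\<Prod>x\<in>B. 1 - measure_pmf.prob P (S x))"
proof -
  interpret product_prob_space "\<lambda>_. measure_pmf P" I by unfold_locales
  let ?M = "PiM I (\<lambda>_. measure_pmf P)"
  have "{\<omega> \<in> space ?M. \<not> (\<exists>x\<in>B. \<omega> x \<in> S x)} = {\<omega> \<in> space ?M. \<forall>x\<in>B. \<omega> x \<in> - S x}" by auto
  then have "emeasure ?M {\<omega> \<in> space ?M. \<not> (\<exists>x\<in>B. \<omega> x \<in> S x)}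
    = (\<Prod>x\<in>B. emeasure (measure_pmf P) (- S x))"
    using assms by (simp only:) (intro emeasure_PiM_Collect, auto)
  also have "\<dots> = (\<Prod>x\<in>B. ennreal (1 - measure_pmf.prob P (S x)))"
    using measure_pmf.prob_compl[of _ P]
    by (intro prod.cong refl) (simp add: measure_pmf.emeasure_eq_measure Compl_eq_Diff_UNIV)
  also have "\<dots> = ennreal (\<Prod>x\<in>B. 1 - measure_pmf.prob P (S x))"
    by (intro prod_ennreal) (auto simp: measure_pmf.prob_le_1)
  finally show ?thesis
    by (intro measure_eq_emeasure_eq_ennreal prod_nonneg) (auto simp: measure_pmf.prob_le_1)
qed

lemma measurable_block_open:
  fixes P :: "'a pmf"
  assumes "finite B" "B \<subseteq> I"
  shows "(\<lambda>\<omega>. \<exists>x\<in>B. \<omega> x \<in> S x) \<in> measurable (PiM I (\<lambda>_. measure_pmf P)) (count_space UNIV)"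
proof -
  have "(\<lambda>\<omega>. \<omega> x \<in> S x) \<in> measurable (PiM I (\<lambda>_. measure_pmf P)) (count_space UNIV)" if "x \<in> B" for x
    using that assms by (intro measurable_compose[OF measurable_component_singleton]) auto
  with assms(1) show ?thesis by measurable
qed

text \<open>Events that depend on disjoint blocks are independent, and a family of independent
  Bernoulli variables has a product law. The marks have an arbitrary law \<open>P\<close> and the
  opening set \<open>S x\<close> depends on the site, so that selected sites can be given additional
  randomness.\<close>

lemma env_law:
  fixes P :: "'a pmf"
  assumes B: "\<And>y. y \<in> Zd d \<Longrightarrow> finite (B y)" "\<And>y. y \<in> Zd d \<Longrightarrow> B y \<subseteq> Zd d" "disjoint_family_on B (Zd d)"
    and prod: "\<And>y. y \<in> Zd d \<Longrightarrow> (\<Prod>x\<in>B y. 1 - measure_pmf.prob P (S x)) = 1 - \<epsilon>"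
    and e: "0 \<le> \<epsilon>" "\<epsilon> \<le> 1"
  defines "M \<equiv> PiM (Zd d) (\<lambda>_. measure_pmf P)"
    and "T \<equiv> \<lambda>\<omega>. \<lambda>y\<in>Zd d. \<exists>x\<in>B y. \<omega> x \<in> S x"
  shows "T \<in> measurable M (site_space d)" "distr M (site_space d) T = env d \<epsilon>"
proof -
  interpret prob_space M unfolding M_def by (intro prob_space_PiM measure_pmf.prob_space_axioms)
  define X where "X y \<omega> = (\<exists>x\<in>B y. \<omega> x \<in> S x)" for y and \<omega> :: "(nat \<Rightarrow> int) \<Rightarrow> 'a"
  have T: "T = (\<lambda>\<omega>. \<lambda>y\<in>Zd d. X y \<omega>)" by (simp add: T_def X_def)
  have Xm: "X y \<in> measurable M (count_space UNIV)" if "y \<in> Zd d" for y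
    unfolding X_def[abs_def] M_def using B(1,2)[OF that] by (rule measurable_block_open)
  show "T \<in> measurable M (site_space d)"
    unfolding T by (intro measurable_restrict Xm)
  have Zne: "Zd d \<noteq> {}" using zero_Zd by blast
  have "indep_vars (\<lambda>_. count_space UNIV) (\<lambda>y \<omega>. X y (restrict \<omega> (B y))) (Zd d)"
    unfolding M_def X_def
    by (rule indep_vars_PiM_blocks[OF Zne B(2,3)]) (auto intro!: measurable_block_open B(1))
  moreover have "X y (restrict \<omega> (B y)) = X y \<omega>" for y \<omega> by (auto simp: X_def)
  ultimately have ind: "indep_vars (\<lambda>_. count_space UNIV) X (Zd d)" by simp
  have "distr M (site_space d) T = PiM (Zd d) (\<lambda>y. distr M (count_space UNIV) (X y))"
    unfolding T by (rule indep_vars_iff_distr_eq_PiM'[THEN iffD1, OF Zne _ ind]) (rule Xm)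
  also have "\<dots> = PiM (Zd d) (\<lambda>_. measure_pmf (bernoulli_pmf \<epsilon>))"
  proof (intro PiM_cong refl)
    fix y assume y: "y \<in> Zd d"
    have F: "measure M {\<omega> \<in> space M. \<not> X y \<omega>} = 1 - \<epsilon>"
      unfolding M_def X_def by (subst prob_block_avoid) (use B y prod in auto)
    have ev: "{\<omega> \<in> space M. X y \<omega>} \<in> events"
      using Xm[OF y] by simp
    have Tr: "measure M {\<omega> \<in> space M. X y \<omega>} = \<epsilon>"
    proof -
      have "{\<omega> \<in> space M. \<not> X y \<omega>} = space M - {\<omega> \<in> space M. X y \<omega>}" by auto
      then show ?thesis using prob_compl[OF ev] F by simp
    qed
    show "distr M (count_space UNIV) (X y) = measure_pmf (bernoulli_pmf \<epsilon>)"
    proof (rule measure_eqI_countable[of _ UNIV])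
      fix a :: bool
      have "X y -` {a} \<inter> space M = (if a then {\<omega> \<in> space M. X y \<omega>} else {\<omega> \<in> space M. \<not> X y \<omega>})" by auto
      then have "emeasure (distr M (count_space UNIV) (X y)) {a} = ennreal (if a then \<epsilon> else 1 - \<epsilon>)"
        using F Tr Xm[OF y] by (auto simp: emeasure_distr emeasure_eq_measure)
      also have "\<dots> = emeasure (measure_pmf (bernoulli_pmf \<epsilon>)) {a}"
        using e by (cases a) (auto simp: emeasure_pmf_single)
      finally show "emeasure (distr M (count_space UNIV) (X y)) {a} = emeasure (measure_pmf (bernoulli_pmf \<epsilon>)) {a}" .
    qed auto
  qed
  finally show "distr M (site_space d) T = env d \<epsilon>" by (simp add: env_def)
qed

text \<open>For couplings: mean times at different densities become integrals over one common
  probability space.\<close>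

lemma mean_time_law:
  fixes P :: "'a pmf"
  assumes B: "\<And>y. y \<in> Zd d \<Longrightarrow> finite (B y)" "\<And>y. y \<in> Zd d \<Longrightarrow> B y \<subseteq> Zd d" "disjoint_family_on B (Zd d)"
    and prod: "\<And>y. y \<in> Zd d \<Longrightarrow> (\<Prod>x\<in>B y. 1 - measure_pmf.prob P (S x)) = 1 - \<epsilon>"
    and e: "0 \<le> \<epsilon>" "\<epsilon> \<le> 1" and uv: "u \<in> Zd d" "v \<in> Zd d"
  defines "M \<equiv> PiM (Zd d) (\<lambda>_. measure_pmf P)"
    and "opn \<equiv> \<lambda>\<omega> y. \<exists>x\<in>B y. \<omega> x \<in> S x"
  shows "integrable M (\<lambda>\<omega>. passage_time d (opn \<omega>) u v)"
    and "mean_time d \<epsilon> u v = (\<integral>\<omega>. passage_time d (opn \<omega>) u v \<partial>M)"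
proof -
  let ?T = "\<lambda>\<omega>. \<lambda>y\<in>Zd d. \<exists>x\<in>B y. \<omega> x \<in> S x"
  note law = env_law[OF B prod e, folded M_def]
  have eq: "passage_time d (?T \<omega>) u v = passage_time d (opn \<omega>) u v" for \<omega>
    by (rule passage_time_cong) (simp add: opn_def)
  have "prob_space M" unfolding M_def by (intro prob_space_PiM measure_pmf.prob_space_axioms)
  from integrable_passage_time[OF this law(1) uv]
  show "integrable M (\<lambda>\<omega>. passage_time d (opn \<omega>) u v)" unfolding eq .
  have "mean_time d \<epsilon> u v = (\<integral>\<omega>. passage_time d \<omega> u v \<partial>distr M (site_space d) ?T)"
    by (simp add: mean_time_def law(2))
  also have "\<dots> = (\<integral>\<omega>. passage_time d (opn \<omega>) u v \<partial>M)"
    by (subst integral_distr) (use law(1) in \<open>auto simp: eq\<close>)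
  finally show "mean_time d \<epsilon> u v = (\<integral>\<omega>. passage_time d (opn \<omega>) u v \<partial>M)" .
qed

lemma mean_time_automorphism:
  assumes bij: "bij_betw \<psi> (Zd d) (Zd d)"
    and nb: "\<And>x y. x \<in> Zd d \<Longrightarrow> y \<in> Zd d \<Longrightarrow> nbr d (\<psi> x) (\<psi> y) \<longleftrightarrow> nbr d x y"
    and xy: "x \<in> Zd d" "y \<in> Zd d" and e: "0 \<le> \<epsilon>" "\<epsilon> \<le> 1"
  shows "mean_time d \<epsilon> (\<psi> x) (\<psi> y) = mean_time d \<epsilon> x y"
proof -
  have \<psi>Z: "\<psi> v \<in> Zd d" if "v \<in> Zd d" for v using bij that by (auto simp: bij_betw_def)
  \<comment> \<open>The blocks are the singletons of the permuted sites, which says that the law of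
    the environment is invariant under \<open>\<psi>\<close>.\<close>
  have "mean_time d \<epsilon> x y
    = (\<integral>\<omega>. passage_time d (\<lambda>v. \<exists>u\<in>{\<psi> v}. \<omega> u \<in> {True}) x y \<partial>PiM (Zd d) (\<lambda>_. measure_pmf (bernoulli_pmf \<epsilon>)))"
  proof (rule mean_time_law(2))
    show "disjoint_family_on (\<lambda>v. {\<psi> v}) (Zd d)"
      using bij by (auto simp: disjoint_family_on_def bij_betw_def dest: inj_onD)
  qed (use \<psi>Z xy e in \<open>auto simp: measure_pmf_single\<close>)
  also have "\<dots> = (\<integral>\<omega>. passage_time d \<omega> (\<psi> x) (\<psi> y) \<partial>env d \<epsilon>)"
    unfolding env_def by (simp add: passage_time_automorphism[OF bij nb xy])
  finally show ?thesis by (simp add: mean_time_def)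
qed

section \<open>Weights of blocks\<close>

text \<open>\<open>Z\<close> resembles the partition function of a polymer in a random potential.
  The sites of a chain are distinct, so the mean of the product factorises and each site contributes
  at most \<open>q\<close>; this reduces the mean to the deterministic chain sum.\<close>

lemma (in prob_space) chain_partition:
  fixes f :: "(nat \<Rightarrow> int) \<Rightarrow> 'a \<Rightarrow> ennreal"
  assumes ind: "indep_vars (\<lambda>_. borel) f (Zd d)"
    and fq: "\<And>x. x \<in> Zd d \<Longrightarrow> (\<integral>\<^sup>+\<omega>. f x \<omega> \<partial>M) \<le> ennreal q" and q: "0 \<le> q"
    and k: "k \<le> d" and al: "0 < \<alpha>" "\<alpha> \<le> \<theta>" "\<theta> \<le> 1"
    and small: "q * ((4 / \<alpha>) ^ k * (4 / \<theta>) ^ (d - k)) \<le> 1/2"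
  defines "Z \<equiv> \<lambda>\<omega>. \<integral>\<^sup>+xs. ennreal (exp (- chain_cost (rho d k \<theta> \<alpha>) (\<lambda>_. 0) xs)) * (\<Prod>x\<in>set xs. f x \<omega>)
      \<partial>count_space {xs \<in> lists (Zd d). distinct xs}"
  shows "Z \<in> borel_measurable M" "(\<integral>\<^sup>+\<omega>. Z \<omega> \<partial>M) \<le> 2"
proof -
  let ?A = "{xs \<in> lists (Zd d). distinct xs}"
  let ?c = "\<lambda>xs. exp (- chain_cost (rho d k \<theta> \<alpha>) (\<lambda>_. 0) xs)"
  have A: "countable ?A" by (rule countable_subset[OF _ countable_lists[OF countable_Zd[of d]]]) auto
  have fm: "f x \<in> borel_measurable M" if "x \<in> Zd d" for x
    using ind that by (auto simp: indep_vars_def)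
  have tm: "(\<lambda>\<omega>. ennreal (?c xs) * (\<Prod>x\<in>set xs. f x \<omega>)) \<in> borel_measurable M" if "xs \<in> ?A" for xs
    using that by (intro borel_measurable_times_ennreal borel_measurable_prod_ennreal measurable_const fm) auto
  interpret A: sigma_finite_measure "count_space ?A"
    by (rule sigma_finite_measure_count_space_countable[OF A])
  show "Z \<in> borel_measurable M"
    unfolding Z_def
  proof (rule A.borel_measurable_nn_integral)
    have "(\<lambda>b. ennreal (?c (snd b)) * (\<Prod>x\<in>set (snd b). f x (fst b)))
        \<in> borel_measurable (M \<Otimes>\<^sub>M count_space ?A)"
      by (rule measurable_compose_countable'[where I="?A" and g=snd and
            f="\<lambda>xs b. ennreal (?c xs) * (\<Prod>x\<in>set xs. f x (fst b))"])
         (use A in \<open>auto intro!: measurable_compose[OF measurable_fst] tm\<close>)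
    then show "(\<lambda>(\<omega>, xs). ennreal (?c xs) * (\<Prod>x\<in>set xs. f x \<omega>)) \<in> borel_measurable (M \<Otimes>\<^sub>M count_space ?A)"
      by (simp add: case_prod_beta')
  qed
  have "(\<integral>\<^sup>+\<omega>. Z \<omega> \<partial>M) = (\<integral>\<^sup>+xs. (\<integral>\<^sup>+\<omega>. ennreal (?c xs) * (\<Prod>x\<in>set xs. f x \<omega>) \<partial>M) \<partial>count_space ?A)"
    unfolding Z_def by (rule nn_integral_count_space_nn_integral[OF A tm])
  also have "\<dots> \<le> (\<integral>\<^sup>+xs. ennreal (?c xs * q ^ length xs) \<partial>count_space ?A)"
  proof (intro nn_integral_mono)
    fix xs assume "xs \<in> space (count_space ?A)"
    then have xs: "set xs \<subseteq> Zd d" "distinct xs" by auto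
    have "(\<integral>\<^sup>+\<omega>. ennreal (?c xs) * (\<Prod>x\<in>set xs. f x \<omega>) \<partial>M)
      = ennreal (?c xs) * (\<integral>\<^sup>+\<omega>. (\<Prod>x\<in>set xs. f x \<omega>) \<partial>M)"
      using xs by (intro nn_integral_cmult borel_measurable_prod_ennreal fm) auto
    also have "(\<integral>\<^sup>+\<omega>. (\<Prod>x\<in>set xs. f x \<omega>) \<partial>M) = (\<Prod>x\<in>set xs. \<integral>\<^sup>+\<omega>. f x \<omega> \<partial>M)"
      by (intro indep_vars_nn_integral indep_vars_subset[OF ind xs(1)]) auto
    also have "\<dots> \<le> (\<Prod>x\<in>set xs. ennreal q)"
      using xs fq by (intro prod_mono_ennreal) auto
    also have "\<dots> = ennreal (q ^ length xs)"
      using xs q by (simp add: distinct_card ennreal_power)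
    finally show "(\<integral>\<^sup>+\<omega>. ennreal (?c xs) * (\<Prod>x\<in>set xs. f x \<omega>) \<partial>M) \<le> ennreal (?c xs * q ^ length xs)"
      using q by (simp add: ennreal_mult mult_left_mono)
  qed
  also have "\<dots> \<le> (\<integral>\<^sup>+xs. ennreal (?c xs * q ^ length xs) \<partial>count_space (lists (Zd d)))"
  proof -
    have "(\<integral>\<^sup>+xs. ennreal (?c xs * q ^ length xs) \<partial>count_space ?A)
      = (\<integral>\<^sup>+xs. ennreal (?c xs * q ^ length xs) * indicator ?A xs \<partial>count_space (lists (Zd d)))"
    proof -
      have "(\<integral>\<^sup>+xs. ennreal (?c xs * q ^ length xs) \<partial>count_space ?A)
        = (\<integral>\<^sup>+xs. ennreal (?c xs * q ^ length xs) * indicator ?A xs \<partial>count_space ?A)"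
        by (intro nn_integral_cong) auto
      also have "\<dots> = (\<integral>\<^sup>+xs. ennreal (?c xs * q ^ length xs) * indicator ?A xs \<partial>count_space (lists (Zd d)))"
        by (intro nn_integral_count_space_eq) (auto simp: indicator_def)
      finally show ?thesis .
    qed
    also have "\<dots> \<le> (\<integral>\<^sup>+xs. ennreal (?c xs * q ^ length xs) \<partial>count_space (lists (Zd d)))"
      by (intro nn_integral_mono) (auto simp: indicator_def)
    finally show ?thesis .
  qed
  also have "\<dots> \<le> 2"
    by (rule chain_sum[OF countable_Zd q _ small]) (use al rho_sum[OF k al] in auto)
  finally show "(\<integral>\<^sup>+\<omega>. Z \<omega> \<partial>M) \<le> 2" .
qed

text \<open>The value 0 at 0 confines the chains to sites of positive weight, and makes the mean
  weight of a site small instead of about 1.\<close>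

definition pow2_pos :: "nat \<Rightarrow> ennreal" where
  "pow2_pos n = (if n = 0 then 0 else ennreal (2 ^ n))"

lemma ennreal_le_diff:
  assumes "x + ennreal a \<le> ennreal b" "0 \<le> a"
  shows "x \<le> ennreal (b - a)"
proof -
  have "x \<noteq> \<top>" using assms by (auto simp: top_unique)
  then obtain r where r: "x = ennreal r" "0 \<le> r" by (cases x) auto
  then have "ennreal (r + a) \<le> ennreal b" using assms by simp
  then have "r + a \<le> b \<or> r + a \<le> 0" by (simp add: ennreal_le_iff2 del: ennreal_plus) linarith
  then have "r \<le> b - a \<or> r = 0" using r assms by linarith
  then show ?thesis using r by (auto intro: ennreal_leI)
qed

section \<open>Moments of the number of marked sites in a block\<close>

context
  fixes P :: "'a pmf" and I B :: "'i set" and F :: "'a set" and p :: real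
  assumes B: "finite B" "B \<subseteq> I" and p: "p = measure_pmf.prob P F"
begin

private abbreviation (input) "M \<equiv> PiM I (\<lambda>_. measure_pmf P)"
private abbreviation (input) "W \<equiv> \<lambda>\<omega>. card {x\<in>B. \<omega> x \<in> F}"

lemma measurable_block_count: "W \<in> measurable M (count_space UNIV)"
proof -
  have m: "(\<lambda>\<omega>. if \<omega> x \<in> F then 1 else 0 :: nat) \<in> measurable M (count_space UNIV)" if "x \<in> B" for x
    using that B by (intro measurable_compose[OF measurable_component_singleton]) auto
  have "W = (\<lambda>\<omega>. \<Sum>x\<in>B. if \<omega> x \<in> F then 1 else 0)"
    using B by (auto simp: sum.If_cases Int_def)
  also have "\<dots> \<in> measurable M (count_space UNIV)"
    using m by (intro measurable_sum_nat) auto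
  finally show ?thesis .
qed

lemma block_count_mean: "(\<integral>\<^sup>+\<omega>. ennreal (real (W \<omega>)) \<partial>M) = ennreal (real (card B) * p)"
proof -
  interpret product_prob_space "\<lambda>_. measure_pmf P" I by unfold_locales
  have m: "(\<lambda>\<omega>. indicator F (\<omega> x) :: ennreal) \<in> borel_measurable M" if "x \<in> B" for x
    using that B by (intro measurable_compose[OF measurable_component_singleton]) auto
  have "(\<integral>\<^sup>+\<omega>. ennreal (real (W \<omega>)) \<partial>M) = (\<integral>\<^sup>+\<omega>. (\<Sum>x\<in>B. indicator F (\<omega> x)) \<partial>M)"
    using B by (intro nn_integral_cong) (simp add: indicator_def sum.If_cases Int_def ennreal_of_nat_eq_real_of_nat)
  also have "\<dots> = (\<Sum>x\<in>B. \<integral>\<^sup>+\<omega>. indicator F (\<omega> x) \<partial>M)"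
    by (intro nn_integral_sum m)
  also have "\<dots> = (\<Sum>x\<in>B. ennreal p)"
  proof (intro sum.cong refl)
    fix x assume "x \<in> B"
    then have "x \<in> I" using B by auto
    have "(\<integral>\<^sup>+\<omega>. indicator F (\<omega> x) \<partial>M) = (\<integral>\<^sup>+v. indicator F v \<partial>distr M (measure_pmf P) (\<lambda>\<omega>. \<omega> x))"
      using \<open>x \<in> I\<close> by (subst nn_integral_distr) auto
    also have "\<dots> = ennreal p"
      using \<open>x \<in> I\<close> by (subst distr_PiM_component) (auto simp: measure_pmf.prob_space_axioms p measure_pmf.emeasure_eq_measure)
    finally show "(\<integral>\<^sup>+\<omega>. indicator F (\<omega> x) \<partial>M) = ennreal p" .
  qed
  also have "\<dots> = ennreal (real (card B) * p)"
    by (simp add: p ennreal_mult ennreal_of_nat_eq_real_of_nat)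
  finally show ?thesis .
qed

text \<open>The generating function of a binomial variable at 2: each site contributes an
  independent factor of mean 1 + p.\<close>

lemma block_count_exp: "(\<integral>\<^sup>+\<omega>. ennreal (2 ^ W \<omega>) \<partial>M) = ennreal ((1 + p) ^ card B)"
proof (cases "B = {}")
  case True
  interpret prob_space M by (intro prob_space_PiM measure_pmf.prob_space_axioms)
  show ?thesis using True by (simp add: emeasure_space_1)
next
  case False
  interpret prob_space M by (intro prob_space_PiM measure_pmf.prob_space_axioms)
  have I: "I \<noteq> {}" using False B by auto
  define g :: "'a \<Rightarrow> ennreal" where "g v = 1 + indicator F v" for v
  have "indep_vars (\<lambda>_. measure_pmf P) (\<lambda>i \<omega>. \<omega> i) I"
    by (intro indep_vars_PiM_coordinates measure_pmf.prob_space_axioms I)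
  then have "indep_vars (\<lambda>_. borel) (\<lambda>i \<omega>. g (\<omega> i)) I"
    by (rule indep_vars_compose2) auto
  then have ind: "indep_vars (\<lambda>_. borel) (\<lambda>i \<omega>. g (\<omega> i)) B"
    by (rule indep_vars_subset) (rule B)
  have "ennreal (2 ^ W \<omega>) = (\<Prod>x\<in>B. g (\<omega> x))" for \<omega>
  proof -
    have "(\<Prod>x\<in>B. g (\<omega> x)) = (\<Prod>x\<in>B. if \<omega> x \<in> F then 2 else 1)"
      by (intro prod.cong) (auto simp: g_def)
    also have "\<dots> = 2 ^ W \<omega>" using B by (simp add: prod.If_cases Int_def)
    finally show ?thesis by (simp add: ennreal_power[symmetric])
  qed
  then have "(\<integral>\<^sup>+\<omega>. ennreal (2 ^ W \<omega>) \<partial>M) = (\<integral>\<^sup>+\<omega>. (\<Prod>x\<in>B. g (\<omega> x)) \<partial>M)" by simp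
  also have "\<dots> = (\<Prod>x\<in>B. \<integral>\<^sup>+\<omega>. g (\<omega> x) \<partial>M)"
    by (intro indep_vars_nn_integral ind B) auto
  also have "\<dots> = (\<Prod>x\<in>B. ennreal (1 + p))"
  proof (intro prod.cong refl)
    fix x assume "x \<in> B"
    then have "x \<in> I" using B by auto
    have "(\<integral>\<^sup>+\<omega>. g (\<omega> x) \<partial>M) = (\<integral>\<^sup>+v. g v \<partial>distr M (measure_pmf P) (\<lambda>\<omega>. \<omega> x))"
      using \<open>x \<in> I\<close> by (subst nn_integral_distr) auto
    also have "\<dots> = (\<integral>\<^sup>+v. g v \<partial>measure_pmf P)"
      using \<open>x \<in> I\<close> by (subst distr_PiM_component) (auto simp: measure_pmf.prob_space_axioms)
    also have "\<dots> = 1 + ennreal p"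
      unfolding g_def by (subst nn_integral_add) (auto simp: p measure_pmf.emeasure_eq_measure)
    also have "\<dots> = ennreal (1 + p)" by (simp add: p)
    finally show "(\<integral>\<^sup>+\<omega>. g (\<omega> x) \<partial>M) = ennreal (1 + p)" .
  qed
  also have "\<dots> = ennreal ((1 + p) ^ card B)"
    by (simp add: p ennreal_power del: ennreal_plus)
  finally show ?thesis .
qed

lemma block_exp_le:
  assumes small: "real (card B) * p \<le> 1"
  shows "(1 + p) ^ card B \<le> 1 + real (card B) * p + (real (card B) * p)\<^sup>2"
proof -
  have "p \<ge> 0" by (simp add: p)
  then have "(1 + p) ^ card B \<le> exp p ^ card B" by (intro power_mono) auto
  also have "\<dots> = exp (real (card B) * p)" by (simp add: exp_of_nat_mult)
  also have "\<dots> \<le> 1 + real (card B) * p + (real (card B) * p)\<^sup>2"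
    using small \<open>p \<ge> 0\<close> by (intro exp_bound) auto
  finally show ?thesis .
qed

text \<open>The pointwise bound by 2 * 2^n - 2 vanishes at n = 0, so the constant term of the mean
  cancels and a linear one remains.\<close>

lemma block_weight:
  assumes small: "real (card B) * p \<le> 1"
  shows "(\<integral>\<^sup>+\<omega>. pow2_pos (W \<omega>) \<partial>M) \<le> ennreal (4 * (real (card B) * p))"
proof -
  interpret prob_space M by (intro prob_space_PiM measure_pmf.prob_space_axioms)
  note [measurable] = measurable_block_count
  have pt: "pow2_pos n + ennreal 2 \<le> ennreal (2 * 2 ^ n)" for n :: nat
  proof (cases "n = 0")
    case False
    then have "(2::real) ^ 1 \<le> 2 ^ n" by (intro power_increasing) auto
    then have "ennreal (2 ^ n + 2) \<le> ennreal (2 * 2 ^ n)" by (intro ennreal_leI) auto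
    then show ?thesis using False by (simp add: pow2_pos_def)
  qed (simp add: pow2_pos_def)
  have "(\<integral>\<^sup>+\<omega>. pow2_pos (W \<omega>) \<partial>M) + ennreal 2 = (\<integral>\<^sup>+\<omega>. pow2_pos (W \<omega>) + ennreal 2 \<partial>M)"
    by (subst nn_integral_add) (auto simp: emeasure_space_1)
  also have "\<dots> \<le> (\<integral>\<^sup>+\<omega>. ennreal 2 * ennreal (2 ^ W \<omega>) \<partial>M)"
    using pt by (intro nn_integral_mono) (simp add: ennreal_mult)
  also have "\<dots> = ennreal 2 * ennreal ((1 + p) ^ card B)"
    by (subst nn_integral_cmult) (auto simp: block_count_exp)
  also have "\<dots> = ennreal (2 * (1 + p) ^ card B)" by (simp add: ennreal_mult p)
  finally have "(\<integral>\<^sup>+\<omega>. pow2_pos (W \<omega>) \<partial>M) \<le> ennreal (2 * (1 + p) ^ card B - 2)"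
    by (rule ennreal_le_diff) simp
  also have "\<dots> \<le> ennreal (4 * (real (card B) * p))"
  proof (intro ennreal_leI)
    have "(real (card B) * p)\<^sup>2 \<le> real (card B) * p"
      using small by (simp add: power2_eq_square p mult_left_le_one_le)
    then show "2 * (1 + p) ^ card B - 2 \<le> 4 * (real (card B) * p)" using block_exp_le[OF small] by linarith
  qed
  finally show ?thesis .
qed

text \<open>The pointwise bound by 2 * 2^n - 2 - 2 * n vanishes at n = 0 and at n = 1. Constant and
  linear terms of the mean therefore cancel, and what remains is quadratic in the mean number of
  marked sites.\<close>

lemma block_excess_weight:
  assumes small: "real (card B) * p \<le> 1"
  shows "(\<integral>\<^sup>+\<omega>. pow2_pos (W \<omega> - 1) \<partial>M) \<le> ennreal (2 * (real (card B) * p)\<^sup>2)"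
proof -
  interpret prob_space M by (intro prob_space_PiM measure_pmf.prob_space_axioms)
  note [measurable] = measurable_block_count
  have ineq: "2 ^ n + 2 + 2 * real (Suc n) \<le> 2 * 2 ^ Suc n" if "n \<ge> 1" for n
    using that by (induction n rule: dec_induct) auto
  have pt: "pow2_pos (n - 1) + ennreal (2 + 2 * real n) \<le> ennreal (2 * 2 ^ n)" for n :: nat
  proof (cases "n - 1 = 0")
    case True
    then have "n = 0 \<or> n = 1" by auto
    then show ?thesis by (auto simp: pow2_pos_def)
  next
    case False
    then obtain m where m: "n = Suc m" "m \<ge> 1" by (cases n) auto
    have "ennreal (2 ^ m + (2 + 2 * real n)) \<le> ennreal (2 * 2 ^ n)"
      using ineq[OF m(2)] by (intro ennreal_leI) (simp add: m)
    then show ?thesis using m by (simp add: pow2_pos_def)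
  qed
  have "(\<integral>\<^sup>+\<omega>. pow2_pos (W \<omega> - 1) \<partial>M) + ennreal (2 + 2 * (real (card B) * p))
    = (\<integral>\<^sup>+\<omega>. pow2_pos (W \<omega> - 1) \<partial>M) + (ennreal 2 + ennreal 2 * (\<integral>\<^sup>+\<omega>. ennreal (real (W \<omega>)) \<partial>M))"
    unfolding block_count_mean by (simp add: p ennreal_mult)
  also have "\<dots> = (\<integral>\<^sup>+\<omega>. pow2_pos (W \<omega> - 1) + (ennreal 2 + ennreal 2 * ennreal (real (W \<omega>))) \<partial>M)"
    by (subst nn_integral_add, simp, simp, subst nn_integral_add) (auto simp: emeasure_space_1 nn_integral_cmult)
  also have "\<dots> \<le> (\<integral>\<^sup>+\<omega>. ennreal 2 * ennreal (2 ^ W \<omega>) \<partial>M)"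
    using pt by (intro nn_integral_mono) (simp add: ennreal_mult)
  also have "\<dots> = ennreal 2 * ennreal ((1 + p) ^ card B)"
    by (subst nn_integral_cmult) (auto simp: block_count_exp)
  also have "\<dots> = ennreal (2 * (1 + p) ^ card B)" by (simp add: ennreal_mult p)
  finally have "(\<integral>\<^sup>+\<omega>. pow2_pos (W \<omega> - 1) \<partial>M) \<le> ennreal (2 * (1 + p) ^ card B - (2 + 2 * (real (card B) * p)))"
    by (rule ennreal_le_diff) (simp add: p)
  also have "\<dots> \<le> ennreal (2 * (real (card B) * p)\<^sup>2)"
    using block_exp_le[OF small] by (intro ennreal_leI) linarith
  finally show ?thesis .
qed

end

lemma coarse_fiber:
  assumes K: "\<And>i. K i \<ge> 1"
  shows "finite {x \<in> Zd d. coarse K x = y}"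
    and "y \<in> Zd d \<Longrightarrow> card {x \<in> Zd d. coarse K x = y} = (\<Prod>i<d. K i)"
proof -
  have *: "finite {x \<in> Zd d. coarse K x = y} \<and> card {x \<in> Zd d. coarse K x = y} = (\<Prod>i<d. K i)"
    if y: "y \<in> Zd d" for y
  proof -
    let ?R = "\<lambda>i. {int (K i) * y i ..< int (K i) * y i + int (K i)}"
    have dv: "v div int (K i) = y i \<longleftrightarrow> v \<in> ?R i" for v i
    proof -
      have K0: "int (K i) > 0" using K[of i] by linarith
      show ?thesis
      proof
        assume "v div int (K i) = y i"
        then have "v = int (K i) * y i + v mod int (K i)" by (metis mult_div_mod_eq)
        then show "v \<in> ?R i"
          using pos_mod_bound[OF K0, of v] pos_mod_sign[OF K0, of v] by auto
      next
        assume "v \<in> ?R i"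
        then show "v div int (K i) = y i"
          by (intro int_div_pos_eq[of _ _ _ "v - int (K i) * y i"]) auto
      qed
    qed
    have bij: "bij_betw (\<lambda>f i. if i < d then f i else 0) (PiE {..<d} ?R) {x \<in> Zd d. coarse K x = y}"
    proof (rule bij_betwI[where g="\<lambda>x. restrict x {..<d}"])
      show "(\<lambda>f i. if i < d then f i else 0) \<in> PiE {..<d} ?R \<rightarrow> {x \<in> Zd d. coarse K x = y}"
      proof (intro funcsetI CollectI conjI)
        fix f assume f: "f \<in> PiE {..<d} ?R"
        show "(\<lambda>i. if i < d then f i else 0) \<in> Zd d" by (auto simp: Zd_def)
        have "(if i < d then f i else 0) div int (K i) = y i" for i
          using f y by (cases "i < d") (auto simp: dv Zd_def PiE_def Pi_def)
        then show "coarse K (\<lambda>i. if i < d then f i else 0) = y" by (auto simp: coarse_def)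
      qed
      show "(\<lambda>x. restrict x {..<d}) \<in> {x \<in> Zd d. coarse K x = y} \<rightarrow> PiE {..<d} ?R"
      proof (intro funcsetI PiE_I)
        fix x i assume x: "x \<in> {x \<in> Zd d. coarse K x = y}" and i: "i \<in> {..<d}"
        then have "x i div int (K i) = y i" by (auto simp: coarse_def)
        then show "restrict x {..<d} i \<in> ?R i" using i dv by simp
      qed auto
    qed (auto simp: Zd_def PiE_def extensional_def fun_eq_iff)
    have "finite (PiE {..<d} ?R)" by (intro finite_PiE) auto
    moreover have "card (PiE {..<d} ?R) = (\<Prod>i<d. K i)" by (subst card_PiE) auto
    ultimately show ?thesis using bij_betw_finite[OF bij] bij_betw_same_card[OF bij] by simp
  qed
  show "finite {x \<in> Zd d. coarse K x = y}"
  proof (cases "y \<in> Zd d")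
    case False
    then have "{x \<in> Zd d. coarse K x = y} = {}" using coarse_Zd by auto
    then show ?thesis by (simp only: finite.emptyI)
  qed (use * in blast)
  show "y \<in> Zd d \<Longrightarrow> card {x \<in> Zd d. coarse K x = y} = (\<Prod>i<d. K i)" using * by blast
qed

section \<open>Coarse graining of mean passage times\<close>

lemma fwd_eq_dist1:
  assumes "k \<le> d" "\<And>i. a i \<ge> 0" "\<And>i. i \<ge> k \<Longrightarrow> a i = 0"
  shows "fwd k a = dist1 d (\<lambda>_. 0) a"
proof -
  have "dist1 d (\<lambda>_. 0) a = (\<Sum>i<d. a i)" unfolding dist1_def using assms(2) by (intro sum.cong) auto
  also have "\<dots> = (\<Sum>i<k. a i)" using assms by (intro sum.mono_neutral_right) auto
  finally show ?thesis by (simp add: fwd_def)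
qed

text \<open>The pathwise comparison in the mean. \<open>small1\<close> is the convergence condition
  of the chain sum for surplus weights, of mean at most \<open>2 * \<epsilon>\<^sup>2\<close>, and
  \<open>small2\<close> that for full weights, of mean at most \<open>4 * \<epsilon>\<close>. Each
  chain sum has mean at most 2, so they add 4 + 8 * \<delta> to the 1 for the uncounted last block,
  at most 13 in all; this constant disappears after division by the distance.\<close>

lemma coarse_graining:
  fixes K :: "nat \<Rightarrow> nat" and a :: "nat \<Rightarrow> int" and \<epsilon> \<epsilon>' \<delta> :: real
  assumes K: "\<And>i. K i \<ge> 1" "\<And>i. i \<ge> k \<Longrightarrow> K i = 1" and k: "k \<le> d"
    and a: "\<And>i. a i \<ge> 0" "\<And>i. i \<ge> k \<Longrightarrow> a i = 0"
    and e: "0 \<le> \<epsilon>'" "real (\<Prod>i<d. K i) * \<epsilon>' \<le> \<epsilon>" "\<epsilon> < 1"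
    and \<delta>: "0 < \<delta>" "\<delta> \<le> 1"
    and al1: "0 < \<alpha>1" "\<alpha>1 \<le> \<delta> * ln 2" and al2: "0 < \<alpha>2" "\<alpha>2 \<le> 1/2 * ln 2"
    and small1: "2 * \<epsilon>\<^sup>2 * ((4 / \<alpha>1) ^ k * (4 / (\<delta> * ln 2)) ^ (d - k)) \<le> 1/2"
    and small2: "4 * \<epsilon> * ((4 / \<alpha>2) ^ k * (4 / (1/2 * ln 2)) ^ (d - k)) \<le> 1/2"
  defines "b \<equiv> coarse K a"
  shows "fwd k a - mean_time d \<epsilon>' (\<lambda>_. 0) a
    \<le> fwd k b - mean_time d \<epsilon> (\<lambda>_. 0) b + (2 * \<alpha>1 + 4 * \<delta> * \<alpha>2) * fwd k b + 13"
proof -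
  define m where "m = (\<Prod>i<d. K i)"
  have "m \<ge> 1" unfolding m_def using K(1) by (intro prod_ge_1) auto
  then have "1 * \<epsilon>' \<le> real m * \<epsilon>'" using e(1) by (intro mult_right_mono) auto
  then have e': "\<epsilon>' \<le> \<epsilon>" "\<epsilon>' < 1" "0 \<le> \<epsilon>" using e by (auto simp: m_def)
  have bern: "1 - \<epsilon> \<le> (1 - \<epsilon>') ^ m"
    using Bernoulli_inequality[of "- \<epsilon>'" m] e e' by (simp add: m_def)
  have pos: "(1 - \<epsilon>') ^ m > 0" using e' by simp
  \<comment> \<open>Opening one site of each block with an additional probability \<open>s\<close> makes the density of the
    coarse environment exactly \<open>\<epsilon>\<close>.\<close>
  define s where "s = 1 - (1 - \<epsilon>) / (1 - \<epsilon>') ^ m"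
  have s: "0 \<le> s" "s \<le> 1" using bern pos e by (auto simp: s_def)
  \<comment> \<open>Each site carries two independent coins. The first decides whether the fine site
    is open; the second is consulted only at the corner of a block and only for the coarse
    environment.\<close>
  define P where "P = pair_pmf (bernoulli_pmf \<epsilon>') (bernoulli_pmf s)"
  have PF: "measure_pmf.prob P {v. fst v} = \<epsilon>'"
  proof -
    have "measure_pmf.prob P {v. fst v} = measure_pmf.prob (map_pmf fst P) {True}"
      by (auto simp: measure_map_pmf vimage_def)
    also have "map_pmf fst P = bernoulli_pmf \<epsilon>'" by (simp add: P_def map_fst_pair_pmf)
    finally show ?thesis using e(1) e'(2) by (simp add: measure_pmf_single)
  qed
  have PG: "measure_pmf.prob P {v. fst v \<or> snd v} = 1 - (1 - \<epsilon>') * (1 - s)"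
  proof -
    have "{v. fst v \<or> snd v} = UNIV - {(False, False)}" by auto
    then have "measure_pmf.prob P {v. fst v \<or> snd v} = 1 - measure_pmf.prob P {(False, False)}"
      using measure_pmf.prob_compl[of "{(False, False)}" P] by simp
    also have "measure_pmf.prob P {(False, False)} = (1 - \<epsilon>') * (1 - s)"
      using e(1) e'(2) s by (simp add: measure_pmf_single P_def pmf_pair)
    finally show ?thesis .
  qed
  define M where "M = PiM (Zd d) (\<lambda>_. measure_pmf P)"
  interpret prob_space M unfolding M_def by (intro prob_space_PiM measure_pmf.prob_space_axioms)
  define B where "B y = {x \<in> Zd d. coarse K x = y}" for y
  have Bfin: "finite (B y)" for y unfolding B_def by (rule coarse_fiber(1)[OF K(1)])
  have Bcard: "card (B y) = m" if "y \<in> Zd d" for y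
    unfolding B_def m_def by (rule coarse_fiber(2)[OF K(1) that])
  have Bsub: "B y \<subseteq> Zd d" for y by (auto simp: B_def)
  have Bdisj: "disjoint_family_on B (Zd d)" by (auto simp: disjoint_family_on_def B_def)
  define corner where "corner y = (\<lambda>i. int (K i) * y i)" for y :: "nat \<Rightarrow> int"
  have cc: "coarse K (corner y) = y" for y
  proof
    fix i
    have "int (K i) \<noteq> 0" using K(1)[of i] by linarith
    then show "coarse K (corner y) i = y i" by (simp add: coarse_def corner_def)
  qed
  have cB: "corner y \<in> B y" if "y \<in> Zd d" for y
    using that cc by (auto simp: B_def Zd_def corner_def)
  define S where "S x = (if x = corner (coarse K x) then {v. fst v \<or> snd v} else {v. fst v})" for x
  have Sprod: "(\<Prod>x\<in>B y. 1 - measure_pmf.prob P (S x)) = 1 - \<epsilon>" if y: "y \<in> Zd d" for y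
  proof -
    have "(\<Prod>x\<in>B y. 1 - measure_pmf.prob P (S x))
      = (1 - measure_pmf.prob P (S (corner y))) * (\<Prod>x\<in>B y - {corner y}. 1 - measure_pmf.prob P (S x))"
      by (rule prod.remove[OF Bfin cB[OF y]])
    also have "(\<Prod>x\<in>B y - {corner y}. 1 - measure_pmf.prob P (S x)) = (\<Prod>x\<in>B y - {corner y}. 1 - \<epsilon>')"
      by (intro prod.cong refl) (auto simp: S_def B_def PF)
    also have "\<dots> = (1 - \<epsilon>') ^ (m - 1)"
      using Bfin cB[OF y] Bcard[OF y] by simp
    also have "1 - measure_pmf.prob P (S (corner y)) = (1 - \<epsilon>') * (1 - s)"
      by (simp add: S_def cc PG)
    also have "(1 - \<epsilon>') * (1 - s) * (1 - \<epsilon>') ^ (m - 1) = (1 - \<epsilon>') ^ m * (1 - s)"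
      using \<open>m \<ge> 1\<close> by (cases m) auto
    also have "\<dots> = 1 - \<epsilon>" using e'(2) by (simp add: s_def)
    finally show ?thesis .
  qed
  have aZ: "a \<in> Zd d" using a(2) k by (auto simp: Zd_def)
  then have bZ: "b \<in> Zd d" unfolding b_def by (rule coarse_Zd)
  have b0: "b i \<ge> 0" for i using a(1) by (simp add: b_def coarse_def div_int_pos_iff)
  have bk: "b i = 0" if "i \<ge> k" for i using a(2)[OF that] by (simp add: b_def coarse_def)
  have fb: "real_of_int (fwd k b) = dist1 d (\<lambda>_. 0) b" using fwd_eq_dist1[of k d b] k b0 bk by simp
  have fa: "real_of_int (fwd k a) = dist1 d (\<lambda>_. 0) a" using fwd_eq_dist1[of k d a] k a by simp
  have fb0: "fwd k b \<ge> 0" using b0 by (auto simp: fwd_def intro: sum_nonneg)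
  define cf where "cf \<omega> y = (\<exists>x\<in>B y. \<omega> x \<in> S x)" for \<omega> :: "(nat \<Rightarrow> int) \<Rightarrow> bool \<times> bool" and y
  define ff where "ff \<omega> x = fst (\<omega> x)" for \<omega> :: "(nat \<Rightarrow> int) \<Rightarrow> bool \<times> bool" and x
  have coarse_law: "integrable M (\<lambda>\<omega>. passage_time d (cf \<omega>) (\<lambda>_. 0) b)"
    "mean_time d \<epsilon> (\<lambda>_. 0) b = (\<integral>\<omega>. passage_time d (cf \<omega>) (\<lambda>_. 0) b \<partial>M)"
    unfolding M_def cf_def
    by (rule mean_time_law[OF Bfin Bsub Bdisj Sprod _ _ zero_Zd bZ]; use e'(3) less_imp_le[OF e(3)] in simp)+
  \<comment> \<open>The fine environment has the same form with singleton blocks, so both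
    environments live on \<open>M\<close>.\<close>
  have fine_eq: "(\<lambda>y. \<exists>x\<in>{y}. \<omega> x \<in> {v. fst v}) = ff \<omega>" for \<omega> :: "(nat \<Rightarrow> int) \<Rightarrow> bool \<times> bool"
    by (auto simp: ff_def)
  have fine_law: "integrable M (\<lambda>\<omega>. passage_time d (ff \<omega>) (\<lambda>_. 0) a)"
    "mean_time d \<epsilon>' (\<lambda>_. 0) a = (\<integral>\<omega>. passage_time d (ff \<omega>) (\<lambda>_. 0) a \<partial>M)"
    unfolding M_def fine_eq[symmetric]
    by (rule mean_time_law[where B="\<lambda>y. {y}" and S="\<lambda>_. {v. fst v}", OF _ _ _ _ _ _ zero_Zd aZ];
        use less_imp_le[OF e'(2)] e(1) PF in \<open>simp add: disjoint_family_on_def\<close>)+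
  define W where "W \<omega> y = card {x \<in> B y. \<omega> x \<in> {v. fst v}}" for \<omega> :: "(nat \<Rightarrow> int) \<Rightarrow> bool \<times> bool" and y
  define Z where "Z g \<alpha> \<theta> \<omega> = (\<integral>\<^sup>+xs. ennreal (exp (- chain_cost (rho d k \<theta> \<alpha>) (\<lambda>_. 0) xs)) *
      (\<Prod>x\<in>set xs. pow2_pos (g (W \<omega> x))) \<partial>count_space {xs \<in> lists (Zd d). distinct xs})"
    for g :: "nat \<Rightarrow> nat" and \<alpha> \<theta> :: real and \<omega>
  have Wind: "indep_vars (\<lambda>_. borel) (\<lambda>y \<omega>. pow2_pos (g (W \<omega> y))) (Zd d)" for g :: "nat \<Rightarrow> nat"
  proof -
    have Zne: "Zd d \<noteq> {}" using zero_Zd by blast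
    have "indep_vars (\<lambda>_. borel) (\<lambda>y \<omega>. pow2_pos (g (W (restrict \<omega> (B y)) y))) (Zd d)"
      unfolding M_def W_def
      by (rule indep_vars_PiM_blocks[OF Zne Bsub Bdisj])
         (rule measurable_compose[OF measurable_block_count[OF Bfin order_refl refl]], simp)
    moreover have "W (restrict \<omega> (B y)) y = W \<omega> y" for y \<omega>
      unfolding W_def by (rule arg_cong[where f=card]) auto
    ultimately show ?thesis by simp
  qed
  have me: "real m * \<epsilon>' \<le> \<epsilon>" "0 \<le> real m * \<epsilon>'" "real m * \<epsilon>' \<le> 1"
    using e unfolding m_def[symmetric] by auto
  have ln2: "ln 2 < (1::real)" using ln_2_less_1 .
  have q1: "(\<integral>\<^sup>+\<omega>. pow2_pos (W \<omega> y - 1) \<partial>M) \<le> ennreal (2 * \<epsilon>\<^sup>2)" if y: "y \<in> Zd d" for y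
  proof -
    have "(\<integral>\<^sup>+\<omega>. pow2_pos (W \<omega> y - 1) \<partial>M) \<le> ennreal (2 * (real m * \<epsilon>')\<^sup>2)"
      unfolding M_def W_def Bcard[OF y, symmetric]
      by (rule block_excess_weight[OF Bfin Bsub]) (use PF Bcard[OF y] me in auto)
    also have "\<dots> \<le> ennreal (2 * \<epsilon>\<^sup>2)" using me by (intro ennreal_leI mult_left_mono power_mono) auto
    finally show ?thesis .
  qed
  have q2: "(\<integral>\<^sup>+\<omega>. pow2_pos (W \<omega> y) \<partial>M) \<le> ennreal (4 * \<epsilon>)" if y: "y \<in> Zd d" for y
  proof -
    have "(\<integral>\<^sup>+\<omega>. pow2_pos (W \<omega> y) \<partial>M) \<le> ennreal (4 * (real m * \<epsilon>'))"
      unfolding M_def W_def Bcard[OF y, symmetric]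
      by (rule block_weight[OF Bfin Bsub]) (use PF Bcard[OF y] me in auto)
    also have "\<dots> \<le> ennreal (4 * \<epsilon>)" using me by (intro ennreal_leI mult_left_mono) auto
    finally show ?thesis .
  qed
  have th1: "\<delta> * ln 2 \<le> 1" using \<delta> ln2 by (intro mult_le_one) auto
  have th2: "1/2 * ln 2 \<le> (1::real)" using ln2 by simp
  \<comment> \<open>\<open>Z1\<close> runs over chains of blocks with at least two fine open sites,
    \<open>Z2\<close> over chains of blocks with at least one.\<close>
  define Z1 where "Z1 = Z (\<lambda>n. n - 1) \<alpha>1 (\<delta> * ln 2)"
  define Z2 where "Z2 = Z (\<lambda>n. n) \<alpha>2 (1/2 * ln 2)"
  have Z1: "Z1 \<in> borel_measurable M" "(\<integral>\<^sup>+\<omega>. Z1 \<omega> \<partial>M) \<le> 2"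
    unfolding Z1_def Z_def
    by (rule chain_partition[OF Wind q1 _ k al1 th1 small1]; simp)+
  have Z2: "Z2 \<in> borel_measurable M" "(\<integral>\<^sup>+\<omega>. Z2 \<omega> \<partial>M) \<le> 2"
    unfolding Z2_def Z_def
    by (rule chain_partition[OF Wind q2 _ k al2 th2 small2]; use e' in simp)+
  have Zge: "ennreal (exp (- chain_cost (rho d k \<theta> \<alpha>) (\<lambda>_. 0) xs) * (\<Prod>x\<in>set xs. 2 ^ g (W \<omega> x))) \<le> Z g \<alpha> \<theta> \<omega>"
    if xs: "distinct xs" "set xs \<subseteq> {y \<in> Zd d. g (W \<omega> y) > 0}" for g \<alpha> \<theta> \<omega> xs
  proof -
    have "ennreal (\<Prod>x\<in>set xs. 2 ^ g (W \<omega> x)) = (\<Prod>x\<in>set xs. ennreal (2 ^ g (W \<omega> x)))"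
      by (rule prod_ennreal[symmetric]) simp
    also have "\<dots> = (\<Prod>x\<in>set xs. pow2_pos (g (W \<omega> x)))"
      using xs by (intro prod.cong) (auto simp: pow2_pos_def)
    finally have "ennreal (exp (- chain_cost (rho d k \<theta> \<alpha>) (\<lambda>_. 0) xs) * (\<Prod>x\<in>set xs. 2 ^ g (W \<omega> x)))
      = ennreal (exp (- chain_cost (rho d k \<theta> \<alpha>) (\<lambda>_. 0) xs)) * (\<Prod>x\<in>set xs. pow2_pos (g (W \<omega> x)))"
      by (simp add: ennreal_mult prod_nonneg)
    also have "\<dots> \<le> Z g \<alpha> \<theta> \<omega>"
      unfolding Z_def by (rule nn_integral_ge_point) (use xs in auto)
    finally show ?thesis .
  qed
  define G where "G \<omega> = fwd k a - passage_time d (ff \<omega>) (\<lambda>_. 0) a" for \<omega>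
  define Gc where "Gc \<omega> = fwd k b - passage_time d (cf \<omega>) (\<lambda>_. 0) b" for \<omega>
  define c where "c = 1 + (2 * \<alpha>1 + 4 * \<delta> * \<alpha>2) * fwd k b"
  have c0: "c \<ge> 0" using al1 al2 \<delta> fb0 by (simp add: c_def)
  have G0: "G \<omega> \<ge> 0" for \<omega>
    using passage_time_le_dist1[OF zero_Zd aZ, of "ff \<omega>"] fa by (simp add: G_def)
  have Gc0: "Gc \<omega> \<ge> 0" for \<omega>
    using passage_time_le_dist1[OF zero_Zd bZ, of "cf \<omega>"] fb by (simp add: Gc_def)
  have Gint: "integrable M G" unfolding G_def using fine_law(1) by simp
  have Gcint: "integrable M Gc" unfolding Gc_def using coarse_law(1) by simp
  have point: "ennreal (G \<omega>) \<le> ennreal (Gc \<omega> + c) + (ennreal 2 * Z1 \<omega> + ennreal (4 * \<delta>) * Z2 \<omega>)" for \<omega>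
  proof -
    have imp: "cf \<omega> (coarse K x)" if "x \<in> Zd d" "ff \<omega> x" for x
      unfolding cf_def using that by (intro bexI[of _ x]) (auto simp: ff_def S_def B_def)
    have Weq: "card {x \<in> Zd d. coarse K x = y \<and> ff \<omega> x} = W \<omega> y" for y
      unfolding W_def B_def ff_def by (rule arg_cong[where f=card]) auto
    obtain q where q: "q \<in> paths d (\<lambda>_. 0) b"
      and g1: "G \<omega> \<le> Gc \<omega> + 1 + (\<Sum>y\<in>set q. real (W \<omega> y - 1))"
      and g2: "G \<omega> \<le> (\<Sum>y\<in>set q. real (W \<omega> y)) - (real (length q) - 1 - fwd k b)"
      using coarse_grained_path[where K=K and k=k and \<omega>="ff \<omega>" and \<omega>'="cf \<omega>", OF K aZ imp coarse_fiber(1)[OF K(1)]]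
      unfolding Weq b_def[symmetric] G_def Gc_def by blast
    define ex where "ex = real (length q) - 1 - fwd k b"
    obtain xs1 where xs1: "distinct xs1" "set xs1 \<subseteq> {y \<in> Zd d. W \<omega> y - 1 > 0}"
      "(\<Sum>y\<in>set q. real (W \<omega> y - 1)) - \<delta> * ex \<le> 2 * \<alpha>1 * fwd k b +
        2 * (exp (- chain_cost (rho d k (\<delta> * ln 2) \<alpha>1) (\<lambda>_. 0) xs1) * (\<Prod>x\<in>set xs1. 2 ^ (W \<omega> x - 1)))"
      using path_weight_le[OF k less_imp_le[OF al1(1)] al1(2) refl q fb0, of "\<lambda>y. W \<omega> y - 1"]
      unfolding ex_def by blast
    obtain xs2 where xs2: "distinct xs2" "set xs2 \<subseteq> {y \<in> Zd d. W \<omega> y > 0}"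
      "(\<Sum>y\<in>set q. real (W \<omega> y)) - 1/2 * ex \<le> 2 * \<alpha>2 * fwd k b +
        2 * (exp (- chain_cost (rho d k (1/2 * ln 2) \<alpha>2) (\<lambda>_. 0) xs2) * (\<Prod>x\<in>set xs2. 2 ^ W \<omega> x))"
      using path_weight_le[OF k less_imp_le[OF al2(1)] al2(2) refl q fb0, of "W \<omega>"]
      unfolding ex_def by blast
    define Y1 where "Y1 = exp (- chain_cost (rho d k (\<delta> * ln 2) \<alpha>1) (\<lambda>_. 0) xs1) * (\<Prod>x\<in>set xs1. 2 ^ (W \<omega> x - 1) :: real)"
    define Y2 where "Y2 = exp (- chain_cost (rho d k (1/2 * ln 2) \<alpha>2) (\<lambda>_. 0) xs2) * (\<Prod>x\<in>set xs2. 2 ^ W \<omega> x :: real)"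
    have Y: "0 \<le> Y1" "0 \<le> Y2" by (auto simp: Y1_def Y2_def intro!: mult_nonneg_nonneg prod_nonneg)
    have Y1: "ennreal Y1 \<le> Z1 \<omega>" unfolding Y1_def Z1_def by (rule Zge) (use xs1 in auto)
    have Y2: "ennreal Y2 \<le> Z2 \<omega>" unfolding Y2_def Z2_def by (rule Zge) (use xs2 in auto)
    \<comment> \<open>The fine gain is nonnegative, so \<open>g2\<close> bounds the excess by the
      total weight. The chain bound charges only half of the excess, and that half is absorbed on
      the left.\<close>
    have "ex \<le> 4 * \<alpha>2 * fwd k b + 4 * Y2"
      using g2 G0[of \<omega>] xs2(3) unfolding Y2_def[symmetric] ex_def[symmetric] by linarith
    then have "\<delta> * ex \<le> \<delta> * (4 * \<alpha>2 * fwd k b + 4 * Y2)" using \<delta> by (intro mult_left_mono) auto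
    then have "G \<omega> \<le> Gc \<omega> + 1 + 2 * \<alpha>1 * fwd k b + 2 * Y1 + \<delta> * (4 * \<alpha>2 * fwd k b + 4 * Y2)"
      using g1 xs1(3) unfolding Y1_def[symmetric] by linarith
    also have "\<dots> = Gc \<omega> + c + (2 * Y1 + 4 * \<delta> * Y2)" by (simp add: c_def algebra_simps)
    finally have "ennreal (G \<omega>) \<le> ennreal (Gc \<omega> + c + (2 * Y1 + 4 * \<delta> * Y2))" by (rule ennreal_leI)
    also have "\<dots> = ennreal (Gc \<omega> + c) + (ennreal 2 * ennreal Y1 + ennreal (4 * \<delta>) * ennreal Y2)"
      using Y \<delta> Gc0[of \<omega>] c0 by (subst ennreal_plus) (auto simp: ennreal_mult)
    also have "\<dots> \<le> ennreal (Gc \<omega> + c) + (ennreal 2 * Z1 \<omega> + ennreal (4 * \<delta>) * Z2 \<omega>)"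
      using Y1 Y2 by (intro add_mono mult_left_mono) auto
    finally show ?thesis .
  qed
  have EGc: "0 \<le> (\<integral>\<omega>. Gc \<omega> \<partial>M)" using Gc0 by (intro Bochner_Integration.integral_nonneg) auto
  have "ennreal (\<integral>\<omega>. G \<omega> \<partial>M) = (\<integral>\<^sup>+\<omega>. ennreal (G \<omega>) \<partial>M)"
    by (rule nn_integral_eq_integral[symmetric]) (use Gint G0 in auto)
  also have "\<dots> \<le> (\<integral>\<^sup>+\<omega>. ennreal (Gc \<omega> + c) + (ennreal 2 * Z1 \<omega> + ennreal (4 * \<delta>) * Z2 \<omega>) \<partial>M)"
    by (intro nn_integral_mono point)
  also have "\<dots> = (\<integral>\<^sup>+\<omega>. ennreal (Gc \<omega> + c) \<partial>M) + (ennreal 2 * (\<integral>\<^sup>+\<omega>. Z1 \<omega> \<partial>M) + ennreal (4 * \<delta>) * (\<integral>\<^sup>+\<omega>. Z2 \<omega> \<partial>M))"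
    using Z1(1) Z2(1) Gcint by (simp add: nn_integral_add nn_integral_cmult)
  also have "(\<integral>\<^sup>+\<omega>. ennreal (Gc \<omega> + c) \<partial>M) = ennreal (\<integral>\<omega>. Gc \<omega> + c \<partial>M)"
    by (rule nn_integral_eq_integral) (use Gcint Gc0 c0 in auto)
  also have "(\<integral>\<omega>. Gc \<omega> + c \<partial>M) = (\<integral>\<omega>. Gc \<omega> \<partial>M) + c" using Gcint by (simp add: prob_space)
  also have "ennreal ((\<integral>\<omega>. Gc \<omega> \<partial>M) + c) + (ennreal 2 * (\<integral>\<^sup>+\<omega>. Z1 \<omega> \<partial>M) + ennreal (4 * \<delta>) * (\<integral>\<^sup>+\<omega>. Z2 \<omega> \<partial>M))
    \<le> ennreal ((\<integral>\<omega>. Gc \<omega> \<partial>M) + c) + (ennreal 2 * ennreal 2 + ennreal (4 * \<delta>) * ennreal 2)"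
    using Z1(2) Z2(2) by (intro add_mono mult_left_mono) auto
  also have "\<dots> = ennreal ((\<integral>\<omega>. Gc \<omega> \<partial>M) + c + (4 + 8 * \<delta>))"
  proof -
    have "ennreal 2 * ennreal 2 + ennreal (4 * \<delta>) * ennreal 2 = ennreal (4 + 8 * \<delta>)"
    proof -
      have "ennreal (4 * \<delta>) * ennreal 2 = ennreal (8 * \<delta>)"
        using ennreal_mult[of "4 * \<delta>" 2] \<delta> by simp
      moreover have "ennreal 2 * ennreal 2 = ennreal 4" using ennreal_mult[of 2 2] by simp
      ultimately show ?thesis using \<delta> by simp
    qed
    then show ?thesis using EGc c0 \<delta> by (simp add: ennreal_plus[symmetric] del: ennreal_plus)
  qed
  finally have "(\<integral>\<omega>. G \<omega> \<partial>M) \<le> (\<integral>\<omega>. Gc \<omega> \<partial>M) + c + (4 + 8 * \<delta>)"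
    using \<delta> c0 EGc by (subst (asm) ennreal_le_iff) auto
  moreover have "(\<integral>\<omega>. G \<omega> \<partial>M) = fwd k a - mean_time d \<epsilon>' (\<lambda>_. 0) a"
    unfolding G_def using fine_law by (simp add: prob_space)
  moreover have "(\<integral>\<omega>. Gc \<omega> \<partial>M) = fwd k b - mean_time d \<epsilon> (\<lambda>_. 0) b"
    unfolding Gc_def using coarse_law by (simp add: prob_space)
  ultimately show ?thesis using \<delta> by (simp add: c_def)
qed

section \<open>Time constants\<close>

lemma fekete:
  fixes u :: "nat \<Rightarrow> real"
  assumes sub: "\<And>m n. u (m + n) \<le> u m + u n" and nn: "\<And>n. 0 \<le> u n"
  shows "convergent (\<lambda>n. u n / real n)"
proof -
  let ?S = "(\<lambda>n. u n / real n) ` {1..}"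
  define l where "l = Inf ?S"
  have bdd: "bdd_below ?S" using nn by (intro bdd_belowI[of _ 0]) auto
  have l_le: "l \<le> u n / real n" if "n \<ge> 1" for n
    unfolding l_def using that bdd by (intro cInf_lower) auto
  have mult: "u (q * m + r) \<le> real q * u m + u r" for q m r
  proof (induction q)
    case (Suc q)
    have "u (Suc q * m + r) = u (m + (q * m + r))" by (simp add: algebra_simps)
    also have "\<dots> \<le> u m + u (q * m + r)" by (rule sub)
    finally show ?case using Suc by (simp add: algebra_simps)
  qed simp
  have "(\<lambda>n. u n / real n) \<longlonglongrightarrow> l"
  proof (rule LIMSEQ_I)
    fix e :: real assume e: "e > 0"
    have "\<exists>x\<in>?S. x < l + e/2"
      unfolding l_def using e by (intro cInf_lessD) auto
    then obtain m where m: "m \<ge> 1" "u m / real m < l + e/2" by auto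
    define c where "c = (\<Sum>r<m. u r)"
    have c: "u r \<le> c" if "r < m" for r
      unfolding c_def using that nn by (intro member_le_sum) auto
    obtain N where N: "real N > 2 * c / e" using reals_Archimedean2 by blast
    show "\<exists>no. \<forall>n\<ge>no. norm (u n / real n - l) < e"
    proof (intro exI[of _ "Suc N"] allI impI)
      fix n assume n: "n \<ge> Suc N"
      have "u n = u (n div m * m + n mod m)" by simp
      also have "\<dots> \<le> real (n div m) * u m + u (n mod m)" by (rule mult)
      also have "u (n mod m) \<le> c" using m by (intro c) auto
      also have "real (n div m) * u m = real (n div m * m) * (u m / real m)" using m by simp
      also have "\<dots> \<le> real n * (u m / real m)"
        using nn[of m] div_times_less_eq_dividend[of n m] by (intro mult_right_mono of_nat_mono) auto
      finally have "u n \<le> real n * (u m / real m) + c" by simp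
      then have "u n / real n \<le> u m / real m + c / real n" using n by (simp add: field_simps)
      moreover have "c / real n < e/2"
      proof -
        have "2 * c / e < real n" using N n by linarith
        then show ?thesis using e n by (simp add: field_simps)
      qed
      ultimately have "u n / real n < l + e" using m(2) by linarith
      moreover have "l \<le> u n / real n" using n by (intro l_le) auto
      ultimately show "norm (u n / real n - l) < e" by simp
    qed
  qed
  then show ?thesis by (rule convergentI)
qed

lemma mean_time_triangle:
  assumes "x \<in> Zd d" "y \<in> Zd d" "z \<in> Zd d"
  shows "mean_time d \<epsilon> x z \<le> mean_time d \<epsilon> x y + mean_time d \<epsilon> y z"
proof -
  have "mean_time d \<epsilon> x z \<le> (\<integral>\<omega>. passage_time d \<omega> x y + passage_time d \<omega> y z \<partial>env d \<epsilon>)"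
    unfolding mean_time_def using assms
    by (intro integral_mono passage_time_triangle integrable_env Bochner_Integration.integrable_add)
  then show ?thesis using assms by (simp add: mean_time_def integrable_env)
qed

lemma mean_time_nonneg: "x \<in> Zd d \<Longrightarrow> y \<in> Zd d \<Longrightarrow> 0 \<le> mean_time d \<epsilon> x y"
  unfolding mean_time_def by (intro Bochner_Integration.integral_nonneg passage_time_nonneg)

lemma mean_time_le_dist1:
  assumes "x \<in> Zd d" "y \<in> Zd d"
  shows "mean_time d \<epsilon> x y \<le> dist1 d x y"
proof -
  interpret prob_space "env d \<epsilon>" by (rule prob_space_env)
  have "mean_time d \<epsilon> x y \<le> (\<integral>\<omega>. real_of_int (dist1 d x y) \<partial>env d \<epsilon>)"
    unfolding mean_time_def using assms
    by (intro integral_mono passage_time_le_dist1 integrable_env integrable_const)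
  then show ?thesis by (simp add: prob_space)
qed

lemma mean_time_translate:
  assumes "x \<in> Zd d" "y \<in> Zd d" "a \<in> Zd d" "0 \<le> \<epsilon>" "\<epsilon> \<le> 1"
  shows "mean_time d \<epsilon> (\<lambda>i. x i + a i) (\<lambda>i. y i + a i) = mean_time d \<epsilon> x y"
proof (rule mean_time_automorphism[where \<psi>="\<lambda>v i. v i + a i"])
  show "bij_betw (\<lambda>v i. v i + a i) (Zd d) (Zd d)"
    by (rule bij_betwI[where g="\<lambda>v i. v i - a i"]) (use assms in \<open>auto simp: Zd_def\<close>)
qed (use assms in \<open>auto simp: nbr_def Zd_def\<close>)

lemma mean_time_subadditive:
  assumes "v \<in> Zd d" "w \<in> Zd d" "0 \<le> \<epsilon>" "\<epsilon> \<le> 1"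
  shows "mean_time d \<epsilon> (\<lambda>_. 0) (\<lambda>i. v i + w i) \<le> mean_time d \<epsilon> (\<lambda>_. 0) v + mean_time d \<epsilon> (\<lambda>_. 0) w"
proof -
  have "(\<lambda>i. v i + w i) \<in> Zd d" using assms by (auto simp: Zd_def)
  then have "mean_time d \<epsilon> (\<lambda>_. 0) (\<lambda>i. v i + w i)
    \<le> mean_time d \<epsilon> (\<lambda>_. 0) v + mean_time d \<epsilon> v (\<lambda>i. v i + w i)"
    using assms by (intro mean_time_triangle) auto
  also have "mean_time d \<epsilon> v (\<lambda>i. v i + w i) = mean_time d \<epsilon> (\<lambda>_. 0) w"
    using mean_time_translate[OF zero_Zd assms(2,1,3,4)] by (simp add: add.commute)
  finally show ?thesis by simp
qed

text \<open>Makes bounded changes of the end point, such as rounding, negligible after division by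
  \<open>n\<close>.\<close>

lemma mean_time_lipschitz:
  assumes "v \<in> Zd d" "w \<in> Zd d"
  shows "\<bar>mean_time d \<epsilon> (\<lambda>_. 0) v - mean_time d \<epsilon> (\<lambda>_. 0) w\<bar> \<le> dist1 d v w"
proof -
  have "dist1 d w v = dist1 d v w" by (auto simp: dist1_def intro!: sum.cong)
  then show ?thesis
    using mean_time_triangle[OF zero_Zd assms, of \<epsilon>] mean_time_triangle[OF zero_Zd assms(2,1), of \<epsilon>]
      mean_time_le_dist1[OF assms, of \<epsilon>] mean_time_le_dist1[OF assms(2,1), of \<epsilon>] by linarith
qed

lemma floor_vec_Zd: "z \<in> Rd d \<Longrightarrow> floor_vec (\<lambda>i. c * z i) \<in> Zd d"
  by (auto simp: Rd_def Zd_def floor_vec_def)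

text \<open>\<open>time_const\<close> is defined by \<open>lim\<close>, so it carries information
  only once convergence is known. Rounding is additive up to 1 in each coordinate, and by the
  Lipschitz bound adding \<open>d\<close> to the mean times restores subadditivity.\<close>

lemma time_const_limit:
  assumes z: "z \<in> Rd d" and e: "0 \<le> \<epsilon>" "\<epsilon> \<le> 1"
  shows "(\<lambda>n. mean_time d \<epsilon> (\<lambda>_. 0) (floor_vec (\<lambda>i. real n * z i)) / real n) \<longlonglongrightarrow> time_const d \<epsilon> z"
proof -
  define A where "A n = mean_time d \<epsilon> (\<lambda>_. 0) (floor_vec (\<lambda>i. real n * z i))" for n :: nat
  have A0: "A n \<ge> 0" for n unfolding A_def by (intro mean_time_nonneg zero_Zd floor_vec_Zd z)
  have sub: "A (m + n) \<le> A m + A n + d" for m n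
  proof -
    let ?f = "\<lambda>n. floor_vec (\<lambda>i. real n * z i)"
    let ?s = "\<lambda>i. ?f m i + ?f n i"
    have Z: "?f m \<in> Zd d" "?f n \<in> Zd d" "?f (m + n) \<in> Zd d" by (rule floor_vec_Zd[OF z])+
    have sZ: "?s \<in> Zd d" using Z(1,2) by (auto simp: Zd_def)
    have "dist1 d (?f (m + n)) ?s \<le> (\<Sum>i<d. 1)"
      unfolding dist1_def
    proof (intro sum_mono)
      fix i
      show "\<bar>?s i - ?f (m + n) i\<bar> \<le> 1"
        unfolding floor_vec_def by (simp add: algebra_simps) linarith
    qed
    then have "real_of_int (dist1 d (?f (m + n)) ?s) \<le> d" by simp
    then have "A (m + n) \<le> mean_time d \<epsilon> (\<lambda>_. 0) ?s + d"
      using mean_time_lipschitz[OF Z(3) sZ, of \<epsilon>] unfolding A_def by linarith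
    also have "mean_time d \<epsilon> (\<lambda>_. 0) ?s \<le> A m + A n"
      unfolding A_def by (rule mean_time_subadditive[OF Z(1,2) e])
    finally show ?thesis by simp
  qed
  have "convergent (\<lambda>n. (A n + d) / real n)"
    using sub A0 by (intro fekete) (auto simp: algebra_simps)
  then obtain l where l: "(\<lambda>n. (A n + d) / real n) \<longlonglongrightarrow> l" by (auto simp: convergent_def)
  have "(\<lambda>n. real d / real n) \<longlonglongrightarrow> 0" by (rule lim_const_over_n)
  from tendsto_diff[OF l this] have "(\<lambda>n. A n / real n) \<longlonglongrightarrow> l"
    by (simp add: add_divide_distrib)
  moreover from this have "time_const d \<epsilon> z = l"
    unfolding time_const_def mean_time_def[symmetric] A_def by (rule limI)
  ultimately show ?thesis by (simp add: A_def)
qed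

lemma time_const_limit_near:
  assumes z: "z \<in> Rd d" and e: "0 \<le> \<epsilon>" "\<epsilon> \<le> 1"
    and a: "\<And>n. a n \<in> Zd d" "\<And>n. dist1 d (a n) (floor_vec (\<lambda>i. real n * z i)) \<le> c"
  shows "(\<lambda>n. mean_time d \<epsilon> (\<lambda>_. 0) (a n) / real n) \<longlonglongrightarrow> time_const d \<epsilon> z"
proof -
  let ?f = "\<lambda>n. floor_vec (\<lambda>i. real n * z i)"
  have "(\<lambda>n. mean_time d \<epsilon> (\<lambda>_. 0) (a n) / real n - mean_time d \<epsilon> (\<lambda>_. 0) (?f n) / real n) \<longlonglongrightarrow> 0"
  proof (rule Lim_null_comparison)
    show "(\<lambda>n. real_of_int c / real n) \<longlonglongrightarrow> 0" by (rule lim_const_over_n)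
    have "norm (mean_time d \<epsilon> (\<lambda>_. 0) (a n) / real n - mean_time d \<epsilon> (\<lambda>_. 0) (?f n) / real n) \<le> c / real n" for n
    proof -
      have "\<bar>mean_time d \<epsilon> (\<lambda>_. 0) (a n) - mean_time d \<epsilon> (\<lambda>_. 0) (?f n)\<bar> \<le> real_of_int c"
        using mean_time_lipschitz[OF a(1) floor_vec_Zd[OF z], of \<epsilon> n "real n"] a(2)[of n] by linarith
      then show ?thesis by (simp add: diff_divide_distrib[symmetric] divide_right_mono)
    qed
    then show "\<forall>\<^sub>F n in sequentially. norm (mean_time d \<epsilon> (\<lambda>_. 0) (a n) / real n
        - mean_time d \<epsilon> (\<lambda>_. 0) (?f n) / real n) \<le> c / real n" by simp
  qed
  from tendsto_add[OF this time_const_limit[OF z e]] show ?thesis by simp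
qed

section \<open>Directions up to symmetry\<close>

definition pos_cone :: "nat \<Rightarrow> (nat \<Rightarrow> real) set" where
  "pos_cone k = {z. (\<forall>i<k. z i > 0) \<and> (\<forall>i\<ge>k. z i = 0)}"

lemma pos_cone_Rd: "z \<in> pos_cone k \<Longrightarrow> k \<le> d \<Longrightarrow> z \<in> Rd d"
  by (auto simp: pos_cone_def Rd_def)

text \<open>A signed permutation of the coordinates is an automorphism of the lattice graph that
  fixes the origin. It carries \<open>z\<close> to a point whose positive coordinates come
  first.\<close>

lemma symmetrize:
  assumes z: "z \<in> Rd d"
  obtains z' where "z' \<in> pos_cone (dd1 d z)" "dd1 d z' = dd1 d z" "gam d z' = gam d z" "norm1 d z' = norm1 d z"
    "\<And>\<epsilon>. 0 \<le> \<epsilon> \<Longrightarrow> \<epsilon> \<le> 1 \<Longrightarrow> time_const d \<epsilon> z' = time_const d \<epsilon> z"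
proof -
  define D where "D = {i. i < d \<and> z i \<noteq> 0}"
  define k where "k = card D"
  have k: "dd1 d z = k" by (simp add: dd1_def D_def k_def)
  have D: "finite D" "D \<subseteq> {..<d}" by (auto simp: D_def)
  have kd: "k \<le> d" unfolding k_def using card_mono[OF _ D(2)] by simp
  obtain f where f: "bij_betw f {..<k} D"
    using finite_same_card_bij[of "{..<k}" D] D by (auto simp: k_def)
  have "card {k..<d} = card ({..<d} - D)" using D by (simp add: card_Diff_subset k_def)
  then obtain g where g: "bij_betw g {k..<d} ({..<d} - D)"
    using finite_same_card_bij[of "{k..<d}" "{..<d} - D"] by auto
  define \<pi> where "\<pi> i = (if i < k then f i else g i)" for i
  have \<pi>D: "bij_betw \<pi> {..<k} D"
    using f by (subst bij_betw_cong[where g=f]) (auto simp: \<pi>_def)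
  have \<pi>D': "bij_betw \<pi> {k..<d} ({..<d} - D)"
    using g by (subst bij_betw_cong[where g=g]) (auto simp: \<pi>_def)
  have "bij_betw \<pi> ({..<k} \<union> {k..<d}) (D \<union> ({..<d} - D))"
    by (rule bij_betw_combine[OF \<pi>D \<pi>D']) auto
  moreover have "{..<k} \<union> {k..<d} = {..<d}" "D \<union> ({..<d} - D) = {..<d}" using kd D by auto
  ultimately have \<pi>: "bij_betw \<pi> {..<d} {..<d}" by simp
  have \<pi>lt: "\<pi> i < d" if "i < d" for i using \<pi> that by (auto simp: bij_betw_def)
  define z' where "z' i = (if i < d then \<bar>z (\<pi> i)\<bar> else 0)" for i
  have nz: "z (\<pi> i) = 0 \<longleftrightarrow> k \<le> i" if "i < d" for i
  proof (cases "i < k")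
    case True
    then have "\<pi> i \<in> D" using \<pi>D by (auto simp: bij_betw_def)
    then show ?thesis using True by (simp add: D_def)
  next
    case False
    then have "\<pi> i \<in> {..<d} - D" using \<pi>D' that by (auto simp: bij_betw_def)
    then show ?thesis using False by (auto simp: D_def)
  qed
  have cone: "z' \<in> pos_cone k" using nz kd by (force simp: pos_cone_def z'_def)
  have D': "{i. i < d \<and> z' i \<noteq> 0} = {..<k}" using nz kd by (force simp: z'_def)
  then have k': "dd1 d z' = k" by (simp add: dd1_def)
  have gam: "gam d z' = gam d z"
  proof -
    have "gam d z' = (\<Prod>i<k. \<bar>z' i\<bar> powr (1 / real k))" by (simp add: gam_def D' k')
    also have "\<dots> = (\<Prod>i<k. \<bar>z (\<pi> i)\<bar> powr (1 / real k))"
      using kd by (intro prod.cong) (auto simp: z'_def)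
    also have "\<dots> = (\<Prod>i\<in>D. \<bar>z i\<bar> powr (1 / real k))"
      by (rule prod.reindex_bij_betw[OF \<pi>D])
    finally show ?thesis by (simp add: gam_def k D_def)
  qed
  have norm: "norm1 d z' = norm1 d z"
  proof -
    have "norm1 d z' = (\<Sum>i<d. \<bar>z (\<pi> i)\<bar>)" unfolding norm1_def by (intro sum.cong) (auto simp: z'_def)
    also have "\<dots> = norm1 d z" unfolding norm1_def by (rule sum.reindex_bij_betw[OF \<pi>])
    finally show ?thesis .
  qed
  define s :: "nat \<Rightarrow> int" where "s i = (if z (\<pi> i) < 0 then -1 else 1)" for i
  have ss: "s i * s i = 1" for i by (simp add: s_def)
  define \<psi> where "\<psi> v = (\<lambda>i. if i < d then s i * v (\<pi> i) else 0)" for v :: "nat \<Rightarrow> int"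
  define \<pi>' where "\<pi>' = the_inv_into {..<d} \<pi>"
  have inj: "inj_on \<pi> {..<d}" using \<pi> by (simp add: bij_betw_def)
  have \<pi>': "\<pi>' (\<pi> i) = i" if "i < d" for i
    using that by (simp add: \<pi>'_def the_inv_into_f_f[OF inj])
  have \<pi>'2: "\<pi> (\<pi>' i) = i \<and> \<pi>' i < d" if "i < d" for i
  proof -
    have "i \<in> \<pi> ` {..<d}" using \<pi> that by (simp add: bij_betw_def)
    then show ?thesis using \<pi>' by auto
  qed
  have bij: "bij_betw \<psi> (Zd d) (Zd d)"
  proof (rule bij_betwI[where g="\<lambda>v i. if i < d then s (\<pi>' i) * v (\<pi>' i) else 0"])
    fix v assume v: "v \<in> Zd d"
    show "(\<lambda>i. if i < d then s (\<pi>' i) * \<psi> v (\<pi>' i) else 0) = v"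
    proof
      fix i
      show "(if i < d then s (\<pi>' i) * \<psi> v (\<pi>' i) else 0) = v i"
        using v \<pi>'2[of i] ss[of "\<pi>' i"] by (auto simp: \<psi>_def Zd_def mult.assoc[symmetric])
    qed
    show "\<psi> (\<lambda>i. if i < d then s (\<pi>' i) * v (\<pi>' i) else 0) = v"
    proof
      fix i
      show "\<psi> (\<lambda>i. if i < d then s (\<pi>' i) * v (\<pi>' i) else 0) i = v i"
        using v \<pi>'[of i] \<pi>lt[of i] ss[of i] by (auto simp: \<psi>_def Zd_def mult.assoc[symmetric])
    qed
  qed (auto simp: \<psi>_def Zd_def)
  have nb: "nbr d (\<psi> v) (\<psi> w) \<longleftrightarrow> nbr d v w" if "v \<in> Zd d" "w \<in> Zd d" for v w
  proof -
    have "(\<Sum>i<d. (\<psi> v i - \<psi> w i)^2) = (\<Sum>i<d. (v (\<pi> i) - w (\<pi> i))^2)"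
      by (intro sum.cong) (auto simp: \<psi>_def s_def power2_eq_square algebra_simps)
    also have "\<dots> = (\<Sum>i<d. (v i - w i)^2)" by (rule sum.reindex_bij_betw[OF \<pi>])
    finally show ?thesis using that by (auto simp: nbr_def \<psi>_def Zd_def)
  qed
  have "time_const d \<epsilon> z' = time_const d \<epsilon> z" if e: "0 \<le> \<epsilon>" "\<epsilon> \<le> 1" for \<epsilon>
  proof -
    let ?f = "\<lambda>n. floor_vec (\<lambda>i. real n * z i)"
    have fZ: "?f n \<in> Zd d" for n by (rule floor_vec_Zd[OF z])
    have "\<psi> (\<lambda>_. 0) = (\<lambda>_. 0)" by (auto simp: \<psi>_def)
    then have eq: "mean_time d \<epsilon> (\<lambda>_. 0) (\<psi> (?f n)) = mean_time d \<epsilon> (\<lambda>_. 0) (?f n)" for n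
      using mean_time_automorphism[OF bij nb zero_Zd fZ e, of n] by simp
    have "(\<lambda>n. mean_time d \<epsilon> (\<lambda>_. 0) (\<psi> (?f n)) / real n) \<longlonglongrightarrow> time_const d \<epsilon> z'"
    proof (rule time_const_limit_near[OF pos_cone_Rd[OF cone kd] e])
      show "\<psi> (?f n) \<in> Zd d" for n by (auto simp: \<psi>_def Zd_def)
      show "dist1 d (\<psi> (?f n)) (floor_vec (\<lambda>i. real n * z' i)) \<le> int d" for n
      proof -
        have "dist1 d (\<psi> (?f n)) (floor_vec (\<lambda>i. real n * z' i)) \<le> (\<Sum>i<d. 1)"
          unfolding dist1_def
        proof (intro sum_mono)
          fix i assume "i \<in> {..<d}"
          then show "\<bar>floor_vec (\<lambda>i. real n * z' i) i - \<psi> (?f n) i\<bar> \<le> 1"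
            \<comment> \<open>Negation does not commute with the integer part, but the two differ by
              at most 1; hence the detour through \<open>time_const_limit_near\<close>.\<close>
            by (auto simp: floor_vec_def \<psi>_def z'_def s_def) linarith
        qed
        then show ?thesis by simp
      qed
    qed
    then have "(\<lambda>n. mean_time d \<epsilon> (\<lambda>_. 0) (?f n) / real n) \<longlonglongrightarrow> time_const d \<epsilon> z'" unfolding eq .
    from LIMSEQ_unique[OF this time_const_limit[OF z e]] show ?thesis .
  qed
  with that cone k k' gam norm show ?thesis by metis
qed

section \<open>Comparison of gain rates\<close>

definition gain_rate :: "nat \<Rightarrow> real \<Rightarrow> (nat \<Rightarrow> real) \<Rightarrow> real" where
  "gain_rate d \<epsilon> z = norm1 d z - time_const d \<epsilon> z"

lemma norm1_cone:
  assumes "z \<in> pos_cone k" "k \<le> d"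
  shows "norm1 d z = (\<Sum>i<k. z i)"
proof -
  have "norm1 d z = (\<Sum>i<k. \<bar>z i\<bar>)"
    unfolding norm1_def using assms by (intro sum.mono_neutral_right) (auto simp: pos_cone_def)
  also have "\<dots> = (\<Sum>i<k. z i)" using assms by (intro sum.cong) (auto simp: pos_cone_def less_imp_le)
  finally show ?thesis .
qed

lemma dd1_cone:
  assumes "z \<in> pos_cone k" "k \<le> d"
  shows "{i. i < d \<and> z i \<noteq> 0} = {..<k}" "dd1 d z = k"
proof -
  show *: "{i. i < d \<and> z i \<noteq> 0} = {..<k}"
    using assms by (force simp: pos_cone_def not_less[symmetric])
  show "dd1 d z = k" by (simp add: dd1_def *)
qed

lemma powr_inverse_power:
  assumes "(x::real) > 0" "1 \<le> k"
  shows "(x powr (1 / real k)) ^ k = x"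
  using assms by (simp add: powr_realpow[symmetric] powr_powr)

lemma gam_cone:
  assumes "z \<in> pos_cone k" "1 \<le> k" "k \<le> d"
  shows "gam d z > 0" "gam d z ^ k = (\<Prod>i<k. z i)"
proof -
  have pos: "z i > 0" if "i < k" for i using assms that by (simp add: pos_cone_def)
  have eq: "gam d z = (\<Prod>i<k. z i powr (1 / real k))"
    unfolding gam_def dd1_cone[OF assms(1,3)] using pos by (intro prod.cong) (auto simp: less_imp_le)
  show "gam d z > 0" unfolding eq using pos by (intro prod_pos) force
  have "gam d z ^ k = (\<Prod>i<k. (z i powr (1 / real k)) ^ k)" unfolding eq by (rule prod_power_distrib)
  also have "\<dots> = (\<Prod>i<k. z i)"
    using pos assms(2) by (intro prod.cong refl powr_inverse_power) auto
  finally show "gam d z ^ k = (\<Prod>i<k. z i)" .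
qed

lemma floor_mult_over_n: "(\<lambda>n. real_of_int \<lfloor>real n * x\<rfloor> / real n) \<longlonglongrightarrow> x"
proof -
  have "(\<lambda>n. real_of_int \<lfloor>real n * x\<rfloor> / real n - x) \<longlonglongrightarrow> 0"
  proof (rule Lim_null_comparison)
    show "(\<lambda>n. 1 / real n) \<longlonglongrightarrow> 0" by (rule lim_const_over_n)
    show "\<forall>\<^sub>F n in sequentially. norm (real_of_int \<lfloor>real n * x\<rfloor> / real n - x) \<le> 1 / real n"
    proof (rule eventually_sequentiallyI[of 1])
      fix n :: nat assume n: "n \<ge> 1"
      have "real_of_int \<lfloor>real n * x\<rfloor> / real n - x = (real_of_int \<lfloor>real n * x\<rfloor> - real n * x) / real n"
        using n by (simp add: field_simps)
      moreover have "\<bar>real_of_int \<lfloor>real n * x\<rfloor> - real n * x\<bar> \<le> 1" by linarith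
      ultimately show "norm (real_of_int \<lfloor>real n * x\<rfloor> / real n - x) \<le> 1 / real n"
        by (simp add: divide_right_mono)
    qed
  qed
  from tendsto_add[OF this tendsto_const[of x]] show ?thesis by simp
qed

lemma gain_limit:
  assumes z: "z \<in> pos_cone k" "k \<le> d" and e: "0 \<le> \<epsilon>" "\<epsilon> \<le> 1"
  defines "a \<equiv> \<lambda>n. floor_vec (\<lambda>i. real n * z i)"
  shows "(\<lambda>n. (fwd k (a n) - mean_time d \<epsilon> (\<lambda>_. 0) (a n)) / real n) \<longlonglongrightarrow> gain_rate d \<epsilon> z"
proof -
  have "(\<lambda>n. \<Sum>i<k. real_of_int \<lfloor>real n * z i\<rfloor> / real n) \<longlonglongrightarrow> (\<Sum>i<k. z i)"
    by (intro tendsto_sum floor_mult_over_n)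
  then have "(\<lambda>n. real_of_int (fwd k (a n)) / real n) \<longlonglongrightarrow> norm1 d z"
    by (simp add: fwd_def a_def floor_vec_def sum_divide_distrib norm1_cone[OF z])
  from tendsto_diff[OF this time_const_limit[OF pos_cone_Rd[OF z] e]]
  show ?thesis by (simp add: gain_rate_def a_def diff_divide_distrib)
qed

lemma dist1_eq_fwd_diff:
  assumes "k \<le> d" "\<And>i. a i \<le> b i" "\<And>i. i \<ge> k \<Longrightarrow> a i = b i"
  shows "dist1 d a b = fwd k b - fwd k a"
proof -
  have "dist1 d a b = (\<Sum>i<d. b i - a i)" unfolding dist1_def using assms(2) by (intro sum.cong) auto
  also have "\<dots> = (\<Sum>i<k. b i - a i)" using assms by (intro sum.mono_neutral_right) auto
  finally show ?thesis by (simp add: fwd_def sum_subtractf)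
qed

text \<open>Going on from \<open>a\<close> to \<open>b\<close> costs at most the progress made. This
  permits replacing a coarse end point by a larger one on the ray of the other direction.\<close>

lemma gain_mono:
  assumes "k \<le> d" "a \<in> Zd d" "b \<in> Zd d" "\<And>i. a i \<le> b i" "\<And>i. i \<ge> k \<Longrightarrow> a i = b i"
  shows "fwd k a - mean_time d \<epsilon> (\<lambda>_. 0) a \<le> fwd k b - mean_time d \<epsilon> (\<lambda>_. 0) b"
  using mean_time_lipschitz[OF assms(2,3), of \<epsilon>] dist1_eq_fwd_diff[OF assms(1,4,5)] by simp

text \<open>The last hypothesis makes the coarse image of \<open>n * z\<close> lie below the
  rounding of \<open>m * z'\<close> with \<open>m\<close> the ceiling of \<open>t * n\<close>. After
  monotonicity of the gain and division by \<open>n\<close>, the ratio \<open>m / n\<close> tends to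
  \<open>t\<close> and the additive constant vanishes.\<close>

lemma gain_rate_compare:
  assumes z: "z \<in> pos_cone k" and z': "z' \<in> pos_cone k" and k: "k \<le> d"
    and K: "\<And>i. K i \<ge> 1" "\<And>i. i \<ge> k \<Longrightarrow> K i = 1"
    and e: "0 \<le> \<epsilon>'" "real (\<Prod>i<d. K i) * \<epsilon>' \<le> \<epsilon>" "\<epsilon> < 1"
    and \<delta>: "0 < \<delta>" "\<delta> \<le> 1"
    and al1: "0 < \<alpha>1" "\<alpha>1 \<le> \<delta> * ln 2" and al2: "0 < \<alpha>2" "\<alpha>2 \<le> 1/2 * ln 2"
    and small1: "2 * \<epsilon>\<^sup>2 * ((4 / \<alpha>1) ^ k * (4 / (\<delta> * ln 2)) ^ (d - k)) \<le> 1/2"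
    and small2: "4 * \<epsilon> * ((4 / \<alpha>2) ^ k * (4 / (1/2 * ln 2)) ^ (d - k)) \<le> 1/2"
    and t: "t > 0" "\<And>i. i < k \<Longrightarrow> z i \<le> t * real (K i) * z' i"
  shows "gain_rate d \<epsilon>' z \<le> t * (gain_rate d \<epsilon> z' + (2 * \<alpha>1 + 4 * \<delta> * \<alpha>2) * norm1 d z')"
proof -
  define \<kappa> where "\<kappa> = 2 * \<alpha>1 + 4 * \<delta> * \<alpha>2"
  have \<kappa>0: "\<kappa> \<ge> 0" using al1 al2 \<delta> by (simp add: \<kappa>_def)
  have "1 \<le> (\<Prod>i<d. K i)" using K(1) by (intro prod_ge_1) auto
  then have "1 * \<epsilon>' \<le> real (\<Prod>i<d. K i) * \<epsilon>'" using e(1) by (intro mult_right_mono) linarith+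
  then have e': "\<epsilon>' \<le> 1" "0 \<le> \<epsilon>" "\<epsilon> \<le> 1" using e by linarith+
  define a where "a n = floor_vec (\<lambda>i. real n * z i)" for n :: nat
  define a' where "a' n = floor_vec (\<lambda>i. real n * z' i)" for n :: nat
  define m where "m n = nat \<lceil>t * real n\<rceil>" for n :: nat
  have m_ge: "real (m n) \<ge> t * real n" for n using t by (simp add: m_def)
  have m_le: "real (m n) \<le> t * real n + 1" for n
  proof -
    have "0 \<le> t * real n" using t by simp
    then show ?thesis unfolding m_def by (simp add: ceiling_le_iff)
  qed
  have zi: "z i \<ge> 0" "z' i \<ge> 0" "i \<ge> k \<Longrightarrow> z i = 0 \<and> z' i = 0" for i
    using z z' by (cases "i < k"; auto simp: pos_cone_def less_imp_le)+
  have a0: "a n i \<ge> 0" "i \<ge> k \<Longrightarrow> a n i = 0" for n i using zi[of i] by (auto simp: a_def floor_vec_def)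
  have a'0: "i \<ge> k \<Longrightarrow> a' n i = 0" for n i using zi[of i] by (auto simp: a'_def floor_vec_def)
  have a'Z: "a' n \<in> Zd d" for n unfolding a'_def by (intro floor_vec_Zd pos_cone_Rd[OF z' k])
  have aZ: "a n \<in> Zd d" for n unfolding a_def by (intro floor_vec_Zd pos_cone_Rd[OF z k])
  define A where "A n = (fwd k (a n) - mean_time d \<epsilon>' (\<lambda>_. 0) (a n)) / real n" for n
  define A' where "A' n = (fwd k (a' n) - mean_time d \<epsilon> (\<lambda>_. 0) (a' n)) / real n" for n
  have main: "A n \<le> A' (m n) * (real (m n) / real n) + \<kappa> * norm1 d z' * (real (m n) / real n) + 13 / real n"
    if n: "n \<ge> 1" for n
  proof -
    have "t * real n > 0" using t n by simp
    then have mn: "m n \<ge> 1" using m_ge[of n] by linarith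
    define b where "b = coarse K (a n)"
    have bZ: "b \<in> Zd d" unfolding b_def by (rule coarse_Zd[OF aZ])
    have b_le: "b i \<le> a' (m n) i" for i
    proof (cases "i < k")
      case True
      have Ki: "real (K i) > 0" using K(1)[of i] by simp
      have "real_of_int (b i) \<le> real_of_int (a n i) / real (K i)"
        unfolding b_def coarse_def using real_of_int_div4[of "a n i" "int (K i)"] by simp
      also have "\<dots> \<le> real n * z i / real (K i)"
        using Ki by (intro divide_right_mono) (auto simp: a_def floor_vec_def)
      also have "\<dots> \<le> real n * (t * real (K i) * z' i) / real (K i)"
        using t(2)[OF True] Ki by (intro divide_right_mono mult_left_mono) auto
      also have "\<dots> = t * real n * z' i" using Ki by simp
      also have "\<dots> \<le> real (m n) * z' i" using m_ge[of n] zi by (intro mult_right_mono)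
      finally show ?thesis by (simp add: a'_def floor_vec_def le_floor_iff)
    next
      case False
      then show ?thesis using a0(2)[of i n] a'0[of i] by (simp add: b_def coarse_def)
    qed
    have b_eq: "b i = a' (m n) i" if "i \<ge> k" for i
      using that a0(2)[of i n] a'0[of i] by (simp add: b_def coarse_def)
    have "fwd k (a n) - mean_time d \<epsilon>' (\<lambda>_. 0) (a n)
      \<le> fwd k b - mean_time d \<epsilon> (\<lambda>_. 0) b + \<kappa> * fwd k b + 13"
      unfolding b_def \<kappa>_def
      by (rule coarse_graining[OF K k a0 e \<delta> al1 al2 small1 small2])
    also have "fwd k b - mean_time d \<epsilon> (\<lambda>_. 0) b \<le> fwd k (a' (m n)) - mean_time d \<epsilon> (\<lambda>_. 0) (a' (m n))"
      by (rule gain_mono[OF k bZ a'Z b_le b_eq])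
    also have "\<kappa> * fwd k b \<le> \<kappa> * (real (m n) * norm1 d z')"
    proof (intro mult_left_mono \<kappa>0)
      have "fwd k b \<le> fwd k (a' (m n))" unfolding fwd_def by (intro sum_mono b_le)
      moreover have "real_of_int (fwd k (a' (m n))) \<le> (\<Sum>i<k. real (m n) * z' i)"
        unfolding fwd_def of_int_sum by (intro sum_mono) (simp add: a'_def floor_vec_def)
      ultimately show "real_of_int (fwd k b) \<le> real (m n) * norm1 d z'"
        by (simp add: norm1_cone[OF z' k] sum_distrib_left)
    qed
    finally have "real n * A n \<le> real (m n) * A' (m n) + \<kappa> * (real (m n) * norm1 d z') + 13"
      using n mn by (simp add: A_def A'_def)
    then show ?thesis using n by (simp add: field_simps)
  qed
  have mlim: "(\<lambda>n. real (m n) / real n) \<longlonglongrightarrow> t"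
  proof -
    have "(\<lambda>n. real (m n) / real n - t) \<longlonglongrightarrow> 0"
    proof (rule Lim_null_comparison)
      show "(\<lambda>n. 1 / real n) \<longlonglongrightarrow> 0" by (rule lim_const_over_n)
      show "\<forall>\<^sub>F n in sequentially. norm (real (m n) / real n - t) \<le> 1 / real n"
      proof (rule eventually_sequentiallyI[of 1])
        fix n :: nat assume n: "n \<ge> 1"
        have "real (m n) / real n - t = (real (m n) - t * real n) / real n" using n by (simp add: field_simps)
        moreover have "\<bar>real (m n) - t * real n\<bar> \<le> 1" using m_ge[of n] m_le[of n] by linarith
        ultimately show "norm (real (m n) / real n - t) \<le> 1 / real n" by (simp add: divide_right_mono)
      qed
    qed
    from tendsto_add[OF this tendsto_const[of t]] show ?thesis by simp
  qed
  have "filterlim (\<lambda>n. t * real n) at_top sequentially"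
    by (intro filterlim_tendsto_pos_mult_at_top[OF tendsto_const t(1)] filterlim_real_sequentially)
  then have "filterlim (\<lambda>n. real (m n)) at_top sequentially"
    by (rule filterlim_at_top_mono) (use m_ge in simp)
  then have minf: "filterlim m at_top sequentially"
    by (simp add: filterlim_sequentially_iff_filterlim_real)
  have "A' \<longlonglongrightarrow> gain_rate d \<epsilon> z'"
    unfolding A'_def a'_def by (rule gain_limit[OF z' k e'(2,3)])
  then have A'lim: "(\<lambda>n. A' (m n)) \<longlonglongrightarrow> gain_rate d \<epsilon> z'"
    using minf by (rule filterlim_compose)
  have Alim: "A \<longlonglongrightarrow> gain_rate d \<epsilon>' z"
    unfolding A_def a_def by (rule gain_limit[OF z k e(1) e'(1)])
  have "(\<lambda>n. A' (m n) * (real (m n) / real n) + \<kappa> * norm1 d z' * (real (m n) / real n) + 13 / real n)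
    \<longlonglongrightarrow> gain_rate d \<epsilon> z' * t + \<kappa> * norm1 d z' * t + 0"
    by (intro tendsto_add tendsto_mult A'lim mlim tendsto_const lim_const_over_n)
  from LIMSEQ_le[OF Alim this] main
  have "gain_rate d \<epsilon>' z \<le> gain_rate d \<epsilon> z' * t + \<kappa> * norm1 d z' * t + 0" by blast
  then show ?thesis by (simp add: \<kappa>_def algebra_simps)
qed

definition scaled_gain :: "nat \<Rightarrow> nat \<Rightarrow> (nat \<Rightarrow> real) \<Rightarrow> real \<Rightarrow> real" where
  "scaled_gain d k z \<epsilon> = gain_rate d \<epsilon> z / (gam d z * \<epsilon> powr (1 / real k))"

lemma root_scale_power:
  assumes "Q > 0" "y > 0" "k \<ge> 1"
  shows "(4 / (4 * Q powr (1 / real k) * y)) ^ k = 1 / (Q * y ^ k)"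
  using assms powr_inverse_power[OF assms(1,3)] by (simp add: power_divide power_mult_distrib)

text \<open>The blocks have side lengths \<open>K i \<approx> z i / (t * z' i)\<close>, with \<open>t\<close> chosen so that a block contains
  on average about \<open>\<epsilon>\<close> open sites of density \<open>\<epsilon>'\<close>.\<close>
lemma scaled_gain_compare:
  assumes z: "z \<in> pos_cone k" and z': "z' \<in> pos_cone k" and k: "1 \<le> k" "k \<le> d" and \<kappa>: "\<kappa> > 0"
  shows "\<forall>\<^sub>F \<epsilon> in at_right 0. \<forall>\<^sub>F \<epsilon>' in at_right 0.
    scaled_gain d k z \<epsilon>' \<le> (1 + \<kappa>) * (scaled_gain d k z' \<epsilon> + \<kappa>)"
proof -
  define R where "R = norm1 d z' / gam d z'"
  have g: "gam d z > 0" "gam d z' > 0" by (rule gam_cone[OF _ k]; fact)+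
  have R0: "R \<ge> 0" unfolding R_def using g by (auto simp: norm1_def intro!: divide_nonneg_pos sum_nonneg)
  define Q2 :: real where "Q2 = (4 / (1/2 * ln 2)) ^ (d - k)"
  have Q2: "Q2 > 0" by (simp add: Q2_def)
  \<comment> \<open>The numbers 8 here and 4 in \<open>c1\<close> turn \<open>small2\<close> and
    \<open>small1\<close> into equalities for the rates \<open>c2 * x\<close> and
    \<open>c1 * x\<^sup>2\<close> below.\<close>
  define c2 where "c2 = 4 * (8 * Q2) powr (1 / real k)"
  have c2: "c2 > 0" using Q2 by (simp add: c2_def)
  \<comment> \<open>The error from the excess length is \<open>4 * \<delta> * c2 * R\<close> after
    scaling. It does not decrease with \<open>\<epsilon>\<close>, so \<open>\<delta>\<close> itself
    has to push it below \<open>\<kappa> / 2\<close>. Since \<open>c2\<close> is independent of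
    \<open>\<delta>\<close>, there is no circularity; \<open>c1\<close> depends on
    \<open>\<delta>\<close>, but its error vanishes with \<open>\<epsilon>\<close>.\<close>
  define \<delta> where "\<delta> = min 1 (\<kappa> / (8 * c2 * R + 1))"
  have den: "8 * c2 * R + 1 > 0" using c2 R0 by (simp add: add_nonneg_pos)
  have \<delta>: "0 < \<delta>" "\<delta> \<le> 1" using \<kappa> den by (auto simp: \<delta>_def)
  have "\<delta> * (8 * c2 * R + 1) \<le> \<kappa>" using den mult_right_mono[of \<delta> "\<kappa> / (8 * c2 * R + 1)" "8 * c2 * R + 1"] by (simp add: \<delta>_def)
  then have \<delta>R: "4 * \<delta> * c2 * R \<le> \<kappa> / 2" using \<delta> by (simp add: algebra_simps)
  define Q1 :: real where "Q1 = (4 / (\<delta> * ln 2)) ^ (d - k)"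
  have Q1: "Q1 > 0" using \<delta> by (simp add: Q1_def)
  define c1 where "c1 = 4 * (4 * Q1) powr (1 / real k)"
  have c1: "c1 > 0" using Q1 by (simp add: c1_def)
  have x0: "((\<lambda>\<epsilon>::real. \<epsilon> powr (1 / real k)) \<longlongrightarrow> 0) (at_right 0)"
    by (rule tendsto_zero_powrI[OF tendsto_ident_at tendsto_const])
       (use k in \<open>auto simp: eventually_at_right_less intro: eventually_mono[OF eventually_at_right_less]\<close>)
  have l2: "\<delta> * ln 2 > 0" "1/2 * ln 2 > (0::real)" using \<delta> by auto
  have "((\<lambda>\<epsilon>::real. c1 * (\<epsilon> powr (1 / real k))\<^sup>2) \<longlongrightarrow> c1 * 0\<^sup>2) (at_right 0)"
    by (intro tendsto_mult tendsto_power x0 tendsto_const)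
  then have ev1: "\<forall>\<^sub>F \<epsilon> in at_right 0. c1 * (\<epsilon> powr (1 / real k))\<^sup>2 < \<delta> * ln 2"
    by (rule order_tendstoD) (use l2 in simp)
  have "((\<lambda>\<epsilon>::real. c2 * (\<epsilon> powr (1 / real k))) \<longlongrightarrow> c2 * 0) (at_right 0)"
    by (intro tendsto_mult x0 tendsto_const)
  then have ev2: "\<forall>\<^sub>F \<epsilon> in at_right 0. c2 * (\<epsilon> powr (1 / real k)) < 1/2 * ln 2"
    by (rule order_tendstoD) (use l2 in simp)
  have "((\<lambda>\<epsilon>::real. 2 * c1 * R * (\<epsilon> powr (1 / real k))) \<longlongrightarrow> 2 * c1 * R * 0) (at_right 0)"
    by (intro tendsto_mult x0 tendsto_const)
  then have ev3: "\<forall>\<^sub>F \<epsilon> in at_right 0. 2 * c1 * R * (\<epsilon> powr (1 / real k)) < \<kappa> / 2"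
    by (rule order_tendstoD) (use \<kappa> in simp)
  have ev4: "\<forall>\<^sub>F \<epsilon> in at_right (0::real). 0 < \<epsilon> \<and> \<epsilon> < 1"
    by (rule eventually_at_rightI[of 0 1]) auto
  show ?thesis
    using ev1 ev2 ev3 ev4
  proof eventually_elim
    case (elim \<epsilon>)
    define x where "x = \<epsilon> powr (1 / real k)"
    have x: "x > 0" using elim by (simp add: x_def)
    have xk: "x ^ k = \<epsilon>" unfolding x_def using elim k by (intro powr_inverse_power) auto
    define \<alpha>1 where "\<alpha>1 = c1 * x\<^sup>2"
    define \<alpha>2 where "\<alpha>2 = c2 * x"
    have al: "0 < \<alpha>1" "\<alpha>1 \<le> \<delta> * ln 2" "0 < \<alpha>2" "\<alpha>2 \<le> 1/2 * ln 2"
      using elim x c1 c2 by (auto simp: \<alpha>1_def \<alpha>2_def x_def)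
    have small1: "2 * \<epsilon>\<^sup>2 * ((4 / \<alpha>1) ^ k * (4 / (\<delta> * ln 2)) ^ (d - k)) \<le> 1/2"
    proof -
      have "(4 / \<alpha>1) ^ k = 1 / (4 * Q1 * (x\<^sup>2) ^ k)"
        unfolding \<alpha>1_def c1_def by (rule root_scale_power) (use Q1 x k in auto)
      also have "(x\<^sup>2) ^ k = \<epsilon>\<^sup>2" by (simp add: xk[symmetric] power_mult[symmetric] mult.commute)
      finally show ?thesis unfolding Q1_def[symmetric] using elim Q1 by (simp add: field_simps)
    qed
    have small2: "4 * \<epsilon> * ((4 / \<alpha>2) ^ k * (4 / (1/2 * ln 2)) ^ (d - k)) \<le> 1/2"
    proof -
      have "(4 / \<alpha>2) ^ k = 1 / (8 * Q2 * x ^ k)"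
        unfolding \<alpha>2_def c2_def by (rule root_scale_power) (use Q2 x k in auto)
      then show ?thesis unfolding Q2_def[symmetric] xk using elim Q2 by (simp add: field_simps)
    qed
    have err: "(gain_rate d \<epsilon> z' + (2 * \<alpha>1 + 4 * \<delta> * \<alpha>2) * norm1 d z') / (gam d z' * x)
      \<le> scaled_gain d k z' \<epsilon> + \<kappa>"
    proof -
      have "(gain_rate d \<epsilon> z' + (2 * \<alpha>1 + 4 * \<delta> * \<alpha>2) * norm1 d z') / (gam d z' * x)
        = scaled_gain d k z' \<epsilon> + (2 * c1 * R * x + 4 * \<delta> * c2 * R)"
        using x g by (simp add: scaled_gain_def x_def[symmetric] \<alpha>1_def \<alpha>2_def R_def field_simps power2_eq_square)
      moreover have "2 * c1 * R * x < \<kappa> / 2" using elim by (simp add: x_def)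
      ultimately show ?thesis using \<delta>R by linarith
    qed
    \<comment> \<open>The factor \<open>1 + \<kappa>\<close> pays for rounding the side lengths up:
      the volume grows by at most its k-th power, and \<open>T ^ k\<close> contains the same power.
      The ratio of the \<open>gam\<close> terms is what equates the volume of a block with
      \<epsilon> / \<epsilon>'.\<close>
    define t where "t \<epsilon>' = (1 + \<kappa>) * (\<epsilon>' powr (1 / real k) / x) * (gam d z / gam d z')" for \<epsilon>'
    have zi: "z i > 0" "z' i > 0" if "i < k" for i using that z z' by (auto simp: pos_cone_def)
    have tlim: "(t \<longlongrightarrow> (1 + \<kappa>) * (0 / x) * (gam d z / gam d z')) (at_right 0)"
      unfolding t_def by (intro tendsto_mult tendsto_divide x0 tendsto_const) (use x in auto)
    \<comment> \<open>As \<open>t\<close> tends to 0 the ideal side lengths tend to infinity, and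
      rounding changes them by a factor of at most \<open>1 + \<kappa>\<close>.\<close>
    have ev5: "\<forall>\<^sub>F \<epsilon>' in at_right 0. \<forall>i\<in>{..<k}. t \<epsilon>' * z' i / z i < \<kappa>"
    proof (intro eventually_ball_finite ballI)
      fix i assume "i \<in> {..<k}"
      have "((\<lambda>\<epsilon>'. t \<epsilon>' * (z' i / z i)) \<longlongrightarrow> (1 + \<kappa>) * (0 / x) * (gam d z / gam d z') * (z' i / z i)) (at_right 0)"
        by (intro tendsto_mult tlim tendsto_const)
      then show "\<forall>\<^sub>F \<epsilon>' in at_right 0. t \<epsilon>' * z' i / z i < \<kappa>"
        by (intro order_tendstoD[where y="(0::real)" and a=\<kappa>]) (use \<kappa> in auto)
    qed auto
    have ev6: "\<forall>\<^sub>F \<epsilon>' in at_right (0::real). \<epsilon>' > 0" by (rule eventually_at_right_less)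
    show ?case
      using ev5 ev6
    proof eventually_elim
      case inner: (elim \<epsilon>')
      define T where "T = t \<epsilon>'"
      define x' where "x' = \<epsilon>' powr (1 / real k)"
      have x': "x' > 0" using inner by (simp add: x'_def)
      have x'k: "x' ^ k = \<epsilon>'" unfolding x'_def using inner k by (intro powr_inverse_power) auto
      have T_eq: "T = (1 + \<kappa>) * (x' / x) * (gam d z / gam d z')" by (simp add: T_def t_def x'_def)
      have T: "T > 0" unfolding T_eq using \<kappa> x x' g by simp
      define r where "r i = z i / (T * z' i)" for i
      have r: "r i > 0" if "i < k" for i using zi[OF that] T by (simp add: r_def)
      define K where "K i = (if i < k then nat \<lceil>r i\<rceil> else 1)" for i
      have K1: "K i \<ge> 1" for i using r[of i] by (simp add: K_def) linarith
      have Kr: "r i \<le> real (K i)" if "i < k" for i using that r[of i] by (simp add: K_def)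
      have K_le: "real (K i) \<le> r i * (1 + \<kappa>)" if i: "i < k" for i
      proof -
        have "real (K i) = real_of_int \<lceil>r i\<rceil>" using i r[OF i] by (simp add: K_def)
        then have "real (K i) \<le> r i + 1" by linarith
        also have "1 = r i * (T * z' i / z i)" using zi[OF i] T by (simp add: r_def)
        also have "r i + r i * (T * z' i / z i) \<le> r i + r i * \<kappa>"
          using inner i r[OF i] by (intro add_left_mono mult_left_mono) (auto simp: T_def less_imp_le)
        finally show ?thesis by (simp add: algebra_simps)
      qed
      have "real (\<Prod>i<d. K i) = (\<Prod>i<k. real (K i))"
        unfolding of_nat_prod using k by (intro prod.mono_neutral_right) (auto simp: K_def)
      also have "\<dots> \<le> (\<Prod>i<k. r i * (1 + \<kappa>))" using K_le by (intro prod_mono) auto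
      also have "\<dots> = (\<Prod>i<k. z i) / (T ^ k * (\<Prod>i<k. z' i)) * (1 + \<kappa>) ^ k"
        by (simp add: r_def prod.distrib prod_dividef)
      also have "\<dots> = gam d z ^ k / (T ^ k * gam d z' ^ k) * (1 + \<kappa>) ^ k"
        by (simp add: gam_cone[OF z k] gam_cone[OF z' k])
      also have "T ^ k = (1 + \<kappa>) ^ k * (\<epsilon>' / \<epsilon>) * (gam d z ^ k / gam d z' ^ k)"
        unfolding T_eq power_mult_distrib power_divide x'k xk by simp
      also have "gam d z ^ k / ((1 + \<kappa>) ^ k * (\<epsilon>' / \<epsilon>) * (gam d z ^ k / gam d z' ^ k) * gam d z' ^ k) * (1 + \<kappa>) ^ k
        = \<epsilon> / \<epsilon>'"
        using g \<kappa> elim inner by (simp add: field_simps)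
      finally have Kprod: "real (\<Prod>i<d. K i) * \<epsilon>' \<le> \<epsilon>" using inner by (simp add: field_simps)
      have "gain_rate d \<epsilon>' z \<le> T * (gain_rate d \<epsilon> z' + (2 * \<alpha>1 + 4 * \<delta> * \<alpha>2) * norm1 d z')"
      proof (rule gain_rate_compare[OF z z' k(2) K1 _ _ Kprod _ \<delta> al small1 small2 T])
        show "z i \<le> T * real (K i) * z' i" if "i < k" for i
          using Kr[OF that] zi[OF that] T by (simp add: r_def field_simps)
      qed (use inner elim in \<open>auto simp: K_def\<close>)
      then have "scaled_gain d k z \<epsilon>'
        \<le> T * (gain_rate d \<epsilon> z' + (2 * \<alpha>1 + 4 * \<delta> * \<alpha>2) * norm1 d z') / (gam d z * x')"
        unfolding scaled_gain_def x'_def[symmetric] using g x' by (intro divide_right_mono) auto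
      also have "\<dots> = (1 + \<kappa>) * ((gain_rate d \<epsilon> z' + (2 * \<alpha>1 + 4 * \<delta> * \<alpha>2) * norm1 d z') / (gam d z' * x))"
        using g x x' by (simp add: T_eq)
      also have "\<dots> \<le> (1 + \<kappa>) * (scaled_gain d k z' \<epsilon> + \<kappa>)"
        using err \<kappa> by (intro mult_left_mono) auto
      finally show ?case .
    qed
  qed
qed

section \<open>Convergence of the scaled gain rate\<close>

lemma tendsto_if_compare:
  fixes f :: "real \<Rightarrow> real"
  assumes C: "C \<ge> 0"
    and up: "\<And>\<kappa>. \<kappa> > 0 \<Longrightarrow> \<forall>\<^sub>F \<epsilon> in F. f \<epsilon> \<le> (1 + \<kappa>) * (C + 2 * \<kappa>)"
    and lo: "\<And>\<kappa>. \<kappa> > 0 \<Longrightarrow> \<forall>\<^sub>F \<epsilon> in F. C \<le> (1 + \<kappa>) * (f \<epsilon> + \<kappa>)"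
  shows "(f \<longlongrightarrow> C) F"
proof (rule tendstoI)
  fix e :: real assume e: "e > 0"
  \<comment> \<open>For \<kappa> at most 1 the upper bound exceeds \<open>C\<close> by at most
    \<kappa> * (C + 4); the 5 instead of 4 makes the inequality strict.\<close>
  define \<kappa> where "\<kappa> = min 1 (e / (C + 5))"
  have \<kappa>: "0 < \<kappa>" "\<kappa> \<le> 1" using e C by (auto simp: \<kappa>_def)
  have "\<kappa> \<le> e / (C + 5)" by (simp add: \<kappa>_def)
  then have ke: "\<kappa> * (C + 5) \<le> e" using C by (simp add: field_simps)
  have kk: "\<kappa> * \<kappa> \<le> \<kappa>" using \<kappa> by (simp add: mult_left_le_one_le)
  show "\<forall>\<^sub>F \<epsilon> in F. dist (f \<epsilon>) C < e"
    using up[OF \<kappa>(1)] lo[OF \<kappa>(1)]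
  proof eventually_elim
    case (elim \<epsilon>)
    have "f \<epsilon> \<le> C + \<kappa> * (C + 4)" using elim(1) kk by (simp add: algebra_simps)
    then have 1: "f \<epsilon> - C < e" using ke \<kappa> by (simp add: algebra_simps)
    have "C - f \<epsilon> < e"
    proof (rule ccontr)
      assume "\<not> C - f \<epsilon> < e"
      then have le: "f \<epsilon> + \<kappa> \<le> C - e + \<kappa>" by simp
      have "(1 + \<kappa>) * (f \<epsilon> + \<kappa>) \<le> (1 + \<kappa>) * (C - e + \<kappa>)"
        using le \<kappa> by (intro mult_left_mono) auto
      also have "\<dots> = C - e + \<kappa> * C - \<kappa> * e + \<kappa> + \<kappa> * \<kappa>" by (simp add: algebra_simps)
      also have "\<dots> < C"
      proof -
        have "\<kappa> * e > 0" using \<kappa> e by simp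
        moreover have "\<kappa> * C + 5 * \<kappa> \<le> e" using ke by (simp add: algebra_simps)
        ultimately show ?thesis using kk \<kappa>(1) by linarith
      qed
      finally show False using elim(2) by simp
    qed
    with 1 show ?case by (simp add: dist_real_def abs_less_iff)
  qed
qed

text \<open>\<open>C\<close> is the limit superior, the infimum of eventual upper bounds. By
  \<open>cmp\<close>, up to \<kappa>, eventually every value of \<open>f\<close> is itself such a
  bound, so the limit inferior is not smaller. The case \<kappa> = 1 shows that an upper bound
  exists at all.\<close>

lemma self_compare_convergent:
  fixes f :: "real \<Rightarrow> real"
  assumes nn: "\<forall>\<^sub>F \<epsilon> in F. 0 \<le> f \<epsilon>" and F: "F \<noteq> bot"
    and cmp: "\<And>\<kappa>. \<kappa> > 0 \<Longrightarrow> \<forall>\<^sub>F \<epsilon> in F. \<forall>\<^sub>F \<epsilon>' in F. f \<epsilon>' \<le> (1 + \<kappa>) * (f \<epsilon> + \<kappa>)"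
  obtains C where "C \<ge> 0" "(f \<longlongrightarrow> C) F"
proof -
  define S where "S = {c. \<forall>\<^sub>F \<epsilon> in F. f \<epsilon> \<le> c}"
  have S0: "c \<ge> 0" if "c \<in> S" for c
  proof -
    have "\<forall>\<^sub>F \<epsilon> in F. 0 \<le> c" using nn that unfolding S_def mem_Collect_eq by eventually_elim simp
    then show ?thesis using F by (simp add: eventually_const)
  qed
  have Sne: "S \<noteq> {}"
  proof -
    obtain \<epsilon> where "\<forall>\<^sub>F \<epsilon>' in F. f \<epsilon>' \<le> (1 + 1) * (f \<epsilon> + 1)"
      using eventually_happens'[OF F cmp[of 1]] by auto
    then show ?thesis by (auto simp: S_def)
  qed
  define C where "C = Inf S"
  have C0: "C \<ge> 0" unfolding C_def using Sne S0 by (intro cInf_greatest)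
  have bdd: "bdd_below S" using S0 by (intro bdd_belowI[of _ 0])
  have "(f \<longlongrightarrow> C) F"
  proof (rule tendsto_if_compare[OF C0])
    fix \<kappa> :: real assume \<kappa>: "\<kappa> > 0"
    have "\<exists>c\<in>S. c < C + \<kappa>" unfolding C_def using Sne \<kappa> by (intro cInf_lessD) auto
    then obtain c where c: "\<forall>\<^sub>F \<epsilon> in F. f \<epsilon> \<le> c" "c < C + \<kappa>" by (auto simp: S_def)
    have "C + \<kappa> \<le> (1 + \<kappa>) * (C + 2 * \<kappa>)" using C0 \<kappa> by (simp add: algebra_simps)
    then show "\<forall>\<^sub>F \<epsilon> in F. f \<epsilon> \<le> (1 + \<kappa>) * (C + 2 * \<kappa>)"
      using c by (auto elim!: eventually_mono)
    show "\<forall>\<^sub>F \<epsilon> in F. C \<le> (1 + \<kappa>) * (f \<epsilon> + \<kappa>)"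
      using cmp[OF \<kappa>]
    proof eventually_elim
      case (elim \<epsilon>)
      then have "(1 + \<kappa>) * (f \<epsilon> + \<kappa>) \<in> S" by (simp add: S_def)
      then show ?case unfolding C_def using bdd by (rule cInf_lower)
    qed
  qed
  with C0 that show ?thesis by blast
qed

section \<open>Lower bound in the diagonal direction\<close>

definition diag :: "nat \<Rightarrow> nat \<Rightarrow> nat \<Rightarrow> int" where
  "diag k L = (\<lambda>i. if i < k then int L else 0)"

text \<open>If the half-open box of side \<open>L\<close> contains an open site, a monotone path
  through it saves one unit. Excluding the upper faces keeps that site apart from the end point,
  where openness gives no saving.\<close>

lemma diag_gain:
  assumes k: "1 \<le> k" "k \<le> d" and L: "L \<ge> 1" and e: "0 \<le> \<epsilon>" "\<epsilon> \<le> 1"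
  shows "mean_time d \<epsilon> (\<lambda>_. 0) (diag k L) \<le> real k * real L - (1 - (1 - \<epsilon>) ^ (L ^ k))"
proof -
  interpret prob_space "env d \<epsilon>" by (rule prob_space_env)
  define K where "K i = (if i < k then L else 1)" for i
  have K1: "K i \<ge> 1" for i using L by (simp add: K_def)
  define B where "B = {x \<in> Zd d. coarse K x = (\<lambda>_. 0)}"
  have Bfin: "finite B" unfolding B_def by (rule coarse_fiber(1)[OF K1])
  have "card B = (\<Prod>i<d. K i)" unfolding B_def by (rule coarse_fiber(2)[OF K1 zero_Zd])
  also have "\<dots> = (\<Prod>i<k. K i)" using k by (intro prod.mono_neutral_right) (auto simp: K_def)
  finally have Bcard: "card B = L ^ k" by (simp add: K_def)
  have diagZ: "diag k L \<in> Zd d" using k by (auto simp: diag_def Zd_def)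
  have fd: "fwd k (diag k L) = int k * int L" by (simp add: fwd_def diag_def)
  define E where "E = {\<omega> \<in> space (env d \<epsilon>). \<exists>x\<in>B. \<omega> x \<in> {True}}"
  define N where "N = {\<omega> \<in> space (env d \<epsilon>). \<not> (\<exists>x\<in>B. \<omega> x \<in> {True})}"
  have N: "prob N = (1 - \<epsilon>) ^ (L ^ k)"
  proof -
    have "prob N = (\<Prod>x\<in>B. 1 - measure_pmf.prob (bernoulli_pmf \<epsilon>) {True})"
      unfolding N_def env_def by (rule prob_block_avoid) (use Bfin in \<open>auto simp: B_def\<close>)
    then show ?thesis using e by (simp add: measure_pmf_single Bcard)
  qed
  have Em: "E \<in> events"
  proof -
    have "(\<lambda>\<omega>. \<exists>x\<in>B. \<omega> x \<in> {True}) \<in> measurable (env d \<epsilon>) (count_space UNIV)"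
      unfolding env_def by (rule measurable_block_open) (use Bfin in \<open>auto simp: B_def\<close>)
    then show ?thesis unfolding E_def by measurable
  qed
  have "N = space (env d \<epsilon>) - E" by (auto simp: N_def E_def)
  then have PE: "prob E = 1 - (1 - \<epsilon>) ^ (L ^ k)" using prob_compl[OF Em] N by simp
  have point: "passage_time d \<omega> (\<lambda>_. 0) (diag k L) \<le> real k * real L - indicator E \<omega>"
    if w: "\<omega> \<in> space (env d \<epsilon>)" for \<omega>
  proof (cases "\<omega> \<in> E")
    case True
    then obtain x where x: "x \<in> B" "\<omega> x" by (auto simp: E_def)
    have xZ: "x \<in> Zd d" using x by (simp add: B_def)
    have xK: "x i div int (K i) = 0" for i using x by (auto simp: B_def coarse_def fun_eq_iff)
    have xi: "0 \<le> x i \<and> x i < int (K i)" for i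
      using xK[of i] K1[of i] by (auto simp: zdiv_eq_0_iff)
    have xk: "x i = 0" if "i \<ge> k" for i using xi[of i] that by (simp add: K_def)
    have "x 0 < int L" using xi[of 0] k by (simp add: K_def)
    then have ne: "x \<noteq> diag k L" using k by (auto simp: diag_def fun_eq_iff intro!: exI[of _ 0])
    have d1: "dist1 d (\<lambda>_. 0) x = fwd k x"
      using fwd_eq_dist1[OF k(2), of x] xi xk by simp
    have d2: "dist1 d x (diag k L) = fwd k (diag k L) - fwd k x"
    proof (rule dist1_eq_fwd_diff[OF k(2)])
      show "x i \<le> diag k L i" for i using xi[of i] xk[of i] by (cases "i < k") (auto simp: diag_def K_def)
      show "x i = diag k L i" if "i \<ge> k" for i using xk[OF that] that by (simp add: diag_def)
    qed
    have "passage_time d \<omega> (\<lambda>_. 0) (diag k L)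
      \<le> passage_time d \<omega> (\<lambda>_. 0) x + passage_time d \<omega> x (diag k L)"
      by (rule passage_time_triangle[OF zero_Zd xZ diagZ])
    then show ?thesis
      using passage_time_le_dist1[OF zero_Zd xZ, of \<omega>]
        passage_time_open_start[where \<omega>=\<omega>, OF xZ diagZ ne x(2)] d1 d2 fd True by simp
  next
    case False
    have "dist1 d (\<lambda>_. 0) (diag k L) = fwd k (diag k L)"
      using fwd_eq_dist1[OF k(2), of "diag k L"] by (simp add: diag_def)
    then show ?thesis using passage_time_le_dist1[OF zero_Zd diagZ, of \<omega>] fd False by simp
  qed
  have "mean_time d \<epsilon> (\<lambda>_. 0) (diag k L) \<le> (\<integral>\<omega>. real k * real L - indicator E \<omega> \<partial>env d \<epsilon>)"
    unfolding mean_time_def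
    by (intro integral_mono integrable_env zero_Zd diagZ Bochner_Integration.integrable_diff
        integrable_const integrable_real_indicator point) (use Em in \<open>auto simp: emeasure_eq_measure\<close>)
  also have "\<dots> = real k * real L - prob E"
    using Em by (subst Bochner_Integration.integral_diff) (auto simp: emeasure_eq_measure prob_space)
  finally show ?thesis by (simp add: PE)
qed

definition ones :: "nat \<Rightarrow> nat \<Rightarrow> real" where
  "ones k = (\<lambda>i. if i < k then 1 else 0)"

text \<open>Subadditivity along the multiples of \<open>L\<close> bounds the time constant by the
  mean time across a single box.\<close>

lemma gain_rate_ones:
  assumes k: "1 \<le> k" "k \<le> d" and L: "L \<ge> 1" and e: "0 \<le> \<epsilon>" "\<epsilon> \<le> 1"
  shows "gain_rate d \<epsilon> (ones k) \<ge> (1 - (1 - \<epsilon>) ^ (L ^ k)) / real L"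
proof -
  have cone: "ones k \<in> pos_cone k" by (auto simp: pos_cone_def ones_def)
  have diagZ: "diag k n \<in> Zd d" for n using k by (auto simp: diag_def Zd_def)
  have fl: "floor_vec (\<lambda>i. real n * ones k i) = diag k n" for n
    by (auto simp: floor_vec_def ones_def diag_def)
  define A where "A n = mean_time d \<epsilon> (\<lambda>_. 0) (diag k n)" for n
  have lim: "(\<lambda>n. A n / real n) \<longlonglongrightarrow> time_const d \<epsilon> (ones k)"
    using time_const_limit[OF pos_cone_Rd[OF cone k(2)] e] by (simp add: fl A_def)
  have A0: "A 0 = 0"
  proof -
    have "diag k 0 = (\<lambda>_. 0)" by (auto simp: diag_def)
    then show ?thesis
      using mean_time_le_dist1[OF zero_Zd zero_Zd, of d \<epsilon>] mean_time_nonneg[OF zero_Zd zero_Zd, of d \<epsilon>]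
      by (simp add: A_def dist1_def)
  qed
  have mult: "A (j * L) \<le> real j * A L" for j
  proof (induction j)
    case (Suc j)
    have "diag k (Suc j * L) = (\<lambda>i. diag k L i + diag k (j * L) i)" by (auto simp: diag_def algebra_simps)
    then have "A (Suc j * L) \<le> A L + A (j * L)"
      using mean_time_subadditive[OF diagZ diagZ e, of L "j * L"] by (simp add: A_def)
    then show ?case using Suc by (simp add: algebra_simps)
  qed (simp add: A0)
  have "strict_mono (\<lambda>j. j * L)" using L by (intro strict_monoI) auto
  from LIMSEQ_subseq_LIMSEQ[OF lim this]
  have lim2: "(\<lambda>j. A (j * L) / real (j * L)) \<longlonglongrightarrow> time_const d \<epsilon> (ones k)" by (simp add: comp_def)
  have "time_const d \<epsilon> (ones k) \<le> A L / real L"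
  proof (rule LIMSEQ_le_const2[OF lim2], intro exI[of _ 1] allI impI)
    fix j :: nat assume "j \<ge> 1"
    then show "A (j * L) / real (j * L) \<le> A L / real L"
      using mult[of j] L by (simp add: field_simps)
  qed
  also have "\<dots> \<le> (real k * real L - (1 - (1 - \<epsilon>) ^ (L ^ k))) / real L"
    unfolding A_def by (intro divide_right_mono diag_gain k L e) auto
  also have "\<dots> = real k - (1 - (1 - \<epsilon>) ^ (L ^ k)) / real L" using L by (simp add: diff_divide_distrib)
  finally have "time_const d \<epsilon> (ones k) \<le> real k - (1 - (1 - \<epsilon>) ^ (L ^ k)) / real L" .
  moreover have "norm1 d (ones k) = real k" unfolding norm1_cone[OF cone k(2)] by (simp add: ones_def)
  ultimately show ?thesis by (simp add: gain_rate_def)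
qed

text \<open>For \<open>L\<close> the ceiling of \<open>1 / x\<close> the box contains on average at
  least one open site, so none is open with probability at most exp(-1). Since \<open>x\<close> is
  at most 1, rounding up at most doubles \<open>L\<close>, whence the division by 2.\<close>

lemma scaled_gain_ones_ge:
  assumes k: "1 \<le> k" "k \<le> d" and e: "0 < \<epsilon>" "\<epsilon> < 1"
  shows "scaled_gain d k (ones k) \<epsilon> \<ge> (1 - exp (-1)) / 2"
proof -
  have cone: "ones k \<in> pos_cone k" by (auto simp: pos_cone_def ones_def)
  have gam: "gam d (ones k) = 1"
    unfolding gam_def dd1_cone[OF cone k(2)] by (simp add: ones_def)
  define x where "x = \<epsilon> powr (1 / real k)"
  have x: "x > 0" using e by (simp add: x_def)
  have x1: "x \<le> 1" unfolding x_def using e by (intro powr_le1) auto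
  have xk: "x ^ k = \<epsilon>" unfolding x_def using e k by (intro powr_inverse_power) auto
  define L where "L = nat \<lceil>1 / x\<rceil>"
  have Lge: "real L \<ge> 1 / x" using x by (simp add: L_def)
  have x1': "1 / x \<ge> 1" using x x1 by simp
  have L: "L \<ge> 1" using Lge x1' by linarith
  have Lle: "real L \<le> 2 / x"
  proof -
    have "real L = real_of_int \<lceil>1 / x\<rceil>" using x by (simp add: L_def)
    then have "real L \<le> 1 / x + 1" by linarith
    then show ?thesis using x1' by simp
  qed
  have "1 \<le> real L * x" using Lge x by (simp add: field_simps)
  then have "1 \<le> (real L * x) ^ k" by (rule one_le_power)
  then have Lk: "1 \<le> real (L ^ k) * \<epsilon>" by (simp add: power_mult_distrib xk)
  have "(1 - \<epsilon>) ^ (L ^ k) \<le> exp (- \<epsilon>) ^ (L ^ k)"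
    using e exp_ge_add_one_self[of "- \<epsilon>"] by (intro power_mono) auto
  also have "\<dots> = exp (- (real (L ^ k) * \<epsilon>))" by (simp add: exp_of_nat_mult[symmetric])
  also have "\<dots> \<le> exp (- 1)" using Lk by simp
  finally have pw: "(1 - \<epsilon>) ^ (L ^ k) \<le> exp (- 1)" .
  have E: "1 - exp (-1) \<ge> (0::real)" by simp
  have "(1 - exp (-1)) / 2 = (1 - exp (-1)) / (2 / x) / x" using x by simp
  also have "\<dots> \<le> (1 - exp (-1)) / real L / x"
    using Lle L x E by (intro divide_right_mono divide_left_mono) auto
  also have "\<dots> \<le> (1 - (1 - \<epsilon>) ^ (L ^ k)) / real L / x"
    using pw x by (intro divide_right_mono) auto
  also have "\<dots> \<le> gain_rate d \<epsilon> (ones k) / x"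
    using gain_rate_ones[OF k L, of \<epsilon>] e x by (intro divide_right_mono) auto
  finally show ?thesis by (simp add: scaled_gain_def gam x_def)
qed

lemma scaled_gain_ones_limit:
  assumes k: "1 \<le> k" "k \<le> d"
  shows "\<exists>C>0. (scaled_gain d k (ones k) \<longlongrightarrow> C) (at_right 0)"
proof -
  have cone: "ones k \<in> pos_cone k" by (auto simp: pos_cone_def ones_def)
  have ev: "\<forall>\<^sub>F \<epsilon> in at_right (0::real). 0 < \<epsilon> \<and> \<epsilon> < 1"
    by (rule eventually_at_rightI[of 0 1]) auto
  have low: "\<forall>\<^sub>F \<epsilon> in at_right 0. (1 - exp (-1)) / 2 \<le> scaled_gain d k (ones k) \<epsilon>"
    using ev by eventually_elim (use scaled_gain_ones_ge[OF k] in auto)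
  have E: "(1 - exp (-1)) / 2 > (0::real)" by simp
  have nn: "\<forall>\<^sub>F \<epsilon> in at_right 0. 0 \<le> scaled_gain d k (ones k) \<epsilon>"
    using low by eventually_elim (use E in linarith)
  obtain C where C: "(scaled_gain d k (ones k) \<longlongrightarrow> C) (at_right 0)"
    using self_compare_convergent[OF nn _ scaled_gain_compare[OF cone cone k]] by auto
  have "(1 - exp (-1)) / 2 \<le> C"
    by (rule tendsto_lowerbound[OF C low]) simp
  with E have "C > 0" by linarith
  with C show ?thesis by blast
qed

text \<open>The comparison is used both ways: with \<open>ones k\<close> as the coarse direction for
  the upper bound, and with \<open>z\<close> as the coarse direction for the lower one.\<close>

lemma scaled_gain_limit:
  assumes k: "1 \<le> k" "k \<le> d" and z: "z \<in> pos_cone k"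
    and C: "C \<ge> 0" "(scaled_gain d k (ones k) \<longlongrightarrow> C) (at_right 0)"
  shows "(scaled_gain d k z \<longlongrightarrow> C) (at_right 0)"
proof (rule tendsto_if_compare[OF C(1)])
  have cone: "ones k \<in> pos_cone k" by (auto simp: pos_cone_def ones_def)
  fix \<kappa> :: real assume \<kappa>: "\<kappa> > 0"
  have "\<forall>\<^sub>F \<epsilon> in at_right 0. scaled_gain d k (ones k) \<epsilon> < C + \<kappa>"
    by (rule order_tendstoD[OF C(2)]) (use \<kappa> in simp)
  then have "\<forall>\<^sub>F \<epsilon> in at_right (0::real). \<forall>\<^sub>F \<epsilon>' in at_right 0. scaled_gain d k z \<epsilon>' \<le> (1 + \<kappa>) * (C + 2 * \<kappa>)"
    using scaled_gain_compare[OF z cone k \<kappa>]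
  proof eventually_elim
    case (elim \<epsilon>)
    have "(1 + \<kappa>) * (scaled_gain d k (ones k) \<epsilon> + \<kappa>) \<le> (1 + \<kappa>) * (C + 2 * \<kappa>)"
      using elim(1) \<kappa> by (intro mult_left_mono) auto
    with elim(2) show ?case by (auto elim!: eventually_mono)
  qed
  then show "\<forall>\<^sub>F \<epsilon> in at_right 0. scaled_gain d k z \<epsilon> \<le> (1 + \<kappa>) * (C + 2 * \<kappa>)"
    by (simp add: eventually_const)
  show "\<forall>\<^sub>F \<epsilon> in at_right 0. C \<le> (1 + \<kappa>) * (scaled_gain d k z \<epsilon> + \<kappa>)"
    using scaled_gain_compare[OF cone z k \<kappa>]
    by eventually_elim (rule tendsto_upperbound[OF C(2)], auto)
qed

theorem theorem2:
  shows "\<exists>C :: nat \<Rightarrow> nat \<Rightarrow> real.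
    (\<forall>d1 d2. d1 \<ge> 1 \<longrightarrow> C d1 d2 > 0) \<and>
    (\<forall>d z. d \<ge> 2 \<longrightarrow> z \<in> Rd d \<longrightarrow> z \<noteq> (\<lambda>_. 0) \<longrightarrow>
       (\<lambda>\<epsilon>. time_const d \<epsilon> z
            - (norm1 d z - C (dd1 d z) (dd2 d z) * gam d z * \<epsilon> powr (1 / real (dd1 d z))))
       \<in> o[at_right 0](\<lambda>\<epsilon>. \<epsilon> powr (1 / real (dd1 d z))))"
proof -
  \<comment> \<open>The constant is the limit for the diagonal direction \<open>ones d1\<close> in
    dimension \<open>d1 + d2\<close>; at \<open>d1 = 0\<close> it is arbitrary.\<close>
  have "\<forall>d1 d2. \<exists>C. d1 \<ge> 1 \<longrightarrow> C > 0 \<and> (scaled_gain (d1 + d2) d1 (ones d1) \<longlongrightarrow> C) (at_right 0)"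
    using scaled_gain_ones_limit by (metis le_add1)
  then obtain C where C: "\<And>d1 d2. d1 \<ge> 1 \<Longrightarrow> C d1 d2 > 0"
    "\<And>d1 d2. d1 \<ge> 1 \<Longrightarrow> (scaled_gain (d1 + d2) d1 (ones d1) \<longlongrightarrow> C d1 d2) (at_right 0)"
    by metis
  show ?thesis
  proof (intro exI[of _ C] conjI allI impI)
    fix d :: nat and z :: "nat \<Rightarrow> real"
    assume z: "z \<in> Rd d" "z \<noteq> (\<lambda>_. 0)"
    define k where "k = dd1 d z"
    define c where "c = C k (dd2 d z)"
    obtain z' where z': "z' \<in> pos_cone k" "dd1 d z' = k" "gam d z' = gam d z" "norm1 d z' = norm1 d z"
      "\<And>\<epsilon>. 0 \<le> \<epsilon> \<Longrightarrow> \<epsilon> \<le> 1 \<Longrightarrow> time_const d \<epsilon> z' = time_const d \<epsilon> z"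
      using symmetrize[OF z(1)] unfolding k_def by metis
    have "k \<le> card {..<d}" unfolding k_def dd1_def by (intro card_mono) auto
    then have kd: "k \<le> d" by simp
    obtain i where i: "z i \<noteq> 0" using z(2) by auto
    then have "i \<in> {i. i < d \<and> z i \<noteq> 0}" using z(1) by (auto simp: Rd_def not_le[symmetric])
    then have "k \<noteq> 0" unfolding k_def dd1_def by (auto simp: card_eq_0_iff)
    then have k1: "1 \<le> k" by simp
    have d: "k + dd2 d z = d" using kd by (simp add: dd2_def k_def)
    have "(scaled_gain d k (ones k) \<longlongrightarrow> c) (at_right 0)"
      using C(2)[OF k1, of "dd2 d z"] by (simp add: d c_def)
    then have lim: "(scaled_gain d k z' \<longlongrightarrow> c) (at_right 0)"
      using scaled_gain_limit[OF k1 kd z'(1), of c] C(1)[OF k1, of "dd2 d z"] by (simp add: c_def)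
    have g: "gam d z > 0" using gam_cone(1)[OF z'(1) k1 kd] z'(3) by simp
    have ev: "\<forall>\<^sub>F \<epsilon> in at_right (0::real). 0 < \<epsilon> \<and> \<epsilon> < 1"
      by (rule eventually_at_rightI[of 0 1]) auto
    have "((\<lambda>\<epsilon>. gam d z * (c - scaled_gain d k z' \<epsilon>)) \<longlongrightarrow> gam d z * (c - c)) (at_right 0)"
      by (intro tendsto_mult tendsto_diff tendsto_const lim)
    then have "((\<lambda>\<epsilon>. gam d z * (c - scaled_gain d k z' \<epsilon>)) \<longlongrightarrow> 0) (at_right 0)" by simp
    moreover have "\<forall>\<^sub>F \<epsilon> in at_right 0. gam d z * (c - scaled_gain d k z' \<epsilon>)
      = (time_const d \<epsilon> z - (norm1 d z - c * gam d z * \<epsilon> powr (1 / real k))) / \<epsilon> powr (1 / real k)"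
      using ev
    proof eventually_elim
      case (elim \<epsilon>)
      then have "\<epsilon> powr (1 / real k) > 0" by simp
      then show ?case using g elim z'
        by (simp add: scaled_gain_def gain_rate_def field_simps)
    qed
    ultimately have "((\<lambda>\<epsilon>. (time_const d \<epsilon> z - (norm1 d z - c * gam d z * \<epsilon> powr (1 / real k)))
      / \<epsilon> powr (1 / real k)) \<longlongrightarrow> 0) (at_right 0)"
      by (rule Lim_transform_eventually)
    then have "(\<lambda>\<epsilon>. time_const d \<epsilon> z - (norm1 d z - c * gam d z * \<epsilon> powr (1 / real k)))
      \<in> o[at_right 0](\<lambda>\<epsilon>. \<epsilon> powr (1 / real k))"
      by (rule smalloI_tendsto) (use ev in \<open>auto elim!: eventually_mono\<close>)
    then show "(\<lambda>\<epsilon>. time_const d \<epsilon> z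
            - (norm1 d z - C (dd1 d z) (dd2 d z) * gam d z * \<epsilon> powr (1 / real (dd1 d z))))
       \<in> o[at_right 0](\<lambda>\<epsilon>. \<epsilon> powr (1 / real (dd1 d z)))"
      by (simp add: c_def k_def)
  qed (use C(1) in blast)
qed

end
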